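(* Let $\mathcal D=\{a_1,a_2,a_3\}\subset\mathbb{CP}^1$ be three distinct points. If a reducible representation $\chi:\pi_1(\mathbb{CP}^1\setminus\mathcal D)\to GL(2,\mathbb C)$ is realized by the monodromy of a Riemann equation with singular points $\mathcal D$, then $\chi$ is diagonalizable at least at one point, i.e. at least one of the monodromy matrices $G_1,G_2,G_3$ is diagonalizable.
   Context: A Riemann equation with singular points $\mathcal D=\{a_1,a_2,a_3\}$ is a second order linear differential equation $y''+b_1(z)y'+b_2(z)y=0$ on the Riemann sphere whose coefficients are holomorphic outside $\mathcal D$ (with every point of $\mathbb{CP}^1\setminus\mathcal D$, including $\infty$ in the local coordinate $1/z$ if $\infty\notin\mathcal D$, being an ordinary point) and which is Fuchsian at each $a_i$: in a local coordinate $t$ centred at $a_i$, the coefficient of the $(2-j)$-th derivative has a pole of order at most $j$, $j=1,2$. Monodromy: continuing a basis (row) $Y$ of the two-dimensional solution space near a base point along a loop $\gamma$ in $\mathbb{CP}^1\setminus\mathcal D$ gives another basis $Y^*$ with $Y=Y^*G_\gamma$, $G_\gamma\in GL(2,\mathbb C)$. The matrix depends only on the homotopy class of $\gamma$, and $[\gamma]\mapsto G_\gamma$ is the monodromy representation, defined up to simultaneous conjugation (choice of basis). An equation realizes $\chi$ if $\chi$ is its monodromy representation in some basis of solutions. The group $\pi_1(\mathbb{CP}^1\setminus\mathcal D)$ is generated by loops around $a_1,a_2,a_3$ whose product is trivial; $G_i$ denotes the matrix corresponding to the loop around $a_i$. *)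

theory Defs
  imports "HOL-Complex_Analysis.Complex_Analysis" "HOL-Algebra.Generated_Groups"
begin

section \<open>The Riemann sphere\<close>

datatype riemann_sphere = Fin_pt complex | Infty

text \<open>\<open>sph a t\<close> is the point with parameter \<open>t\<close> in the local coordinate centred at \<open>a\<close>:
  \<open>t = z - c\<close> at a finite point \<open>c\<close> and \<open>t = 1/z\<close> at infinity.\<close>

fun sph :: "riemann_sphere \<Rightarrow> complex \<Rightarrow> riemann_sphere" where
  "sph (Fin_pt c) t = Fin_pt (c + t)"
| "sph Infty t = (if t = 0 then Infty else Fin_pt (1 / t))"

text \<open>The topology is the one glued from the two charts \<open>z\<close> and \<open>1/z\<close>.\<close>

instantiation riemann_sphere :: topological_space
begin

definition open_riemann_sphere :: "riemann_sphere set \<Rightarrow> bool" where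
  "open_riemann_sphere U \<longleftrightarrow> open (sph (Fin_pt 0) -` U) \<and> open (sph Infty -` U)"

instance
proof
  show "open (UNIV :: riemann_sphere set)"
    by (simp add: open_riemann_sphere_def)
next
  fix S T :: "riemann_sphere set"
  assume "open S" "open T"
  then show "open (S \<inter> T)"
    by (auto simp: open_riemann_sphere_def vimage_Int intro: open_Int)
next
  fix K :: "riemann_sphere set set"
  assume "\<forall>S\<in>K. open S"
  then show "open (\<Union>K)"
    by (auto simp: open_riemann_sphere_def vimage_Union intro: open_UN)
qed

end


section \<open>Riemann equations and their local solutions\<close>

text \<open>Coefficients of \<open>y'' + b1 y' + b2 y = 0\<close> rewritten in the local coordinate \<open>t\<close> at a point.
  For \<open>z = 1/t\<close> one has \<open>dy/dz = - t^2 dy/dt\<close> and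
  \<open>d^2y/dz^2 = t^4 d^2y/dt^2 + 2 t^3 dy/dt\<close>; divide by \<open>t^4\<close>.
  At infinity the values at \<open>t = 0\<close> are meaningless, so only punctured neighbourhoods
  of \<open>t = 0\<close> are used below.\<close>

fun coord_coeff1 :: "(complex \<Rightarrow> complex) \<Rightarrow> riemann_sphere \<Rightarrow> complex \<Rightarrow> complex" where
  "coord_coeff1 b1 (Fin_pt c) t = b1 (c + t)"
| "coord_coeff1 b1 Infty t = 2 / t - b1 (1 / t) / t ^ 2"

fun coord_coeff2 :: "(complex \<Rightarrow> complex) \<Rightarrow> riemann_sphere \<Rightarrow> complex \<Rightarrow> complex" where
  "coord_coeff2 b2 (Fin_pt c) t = b2 (c + t)"
| "coord_coeff2 b2 Infty t = b2 (1 / t) / t ^ 4"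

text \<open>Pole of order at most \<open>k\<close> at \<open>0\<close>; for \<open>k = 0\<close>, a removable singularity.\<close>

definition pole_order_le :: "nat \<Rightarrow> (complex \<Rightarrow> complex) \<Rightarrow> bool" where
  "pole_order_le k f \<longleftrightarrow>
     (\<exists>g. g analytic_on {0} \<and> (\<forall>\<^sub>F t in at 0. f t = g t / t ^ k))"

definition riemann_equation ::
  "riemann_sphere set \<Rightarrow> (complex \<Rightarrow> complex) \<Rightarrow> (complex \<Rightarrow> complex) \<Rightarrow> bool" where
  "riemann_equation D b1 b2 \<longleftrightarrow>
     b1 holomorphic_on {z. Fin_pt z \<notin> D} \<and>
     b2 holomorphic_on {z. Fin_pt z \<notin> D} \<and>
     (Infty \<notin> D \<longrightarrow>
        pole_order_le 0 (coord_coeff1 b1 Infty) \<and> pole_order_le 0 (coord_coeff2 b2 Infty)) \<and>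
     (\<forall>a\<in>D. pole_order_le 1 (coord_coeff1 b1 a) \<and> pole_order_le 2 (coord_coeff2 b2 a))"

text \<open>Only the germ of \<open>f\<close> at the point \<open>a\<close> matters. At an ordinary point the equation at
  \<open>t = 0\<close> itself follows by continuity.\<close>

definition local_solution ::
  "(complex \<Rightarrow> complex) \<Rightarrow> (complex \<Rightarrow> complex) \<Rightarrow> riemann_sphere \<Rightarrow> (riemann_sphere \<Rightarrow> complex) \<Rightarrow> bool"
  where
  "local_solution b1 b2 a f \<longleftrightarrow>
     (\<lambda>t. f (sph a t)) analytic_on {0} \<and>
     (\<forall>\<^sub>F t in at 0.
        deriv (deriv (\<lambda>t. f (sph a t))) t
        + coord_coeff1 b1 a t * deriv (\<lambda>t. f (sph a t)) t
        + coord_coeff2 b2 a t * f (sph a t) = 0)"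

definition solution_basis ::
  "(complex \<Rightarrow> complex) \<Rightarrow> (complex \<Rightarrow> complex) \<Rightarrow> riemann_sphere \<Rightarrow> (riemann_sphere \<Rightarrow> complex ^ 2) \<Rightarrow> bool"
  where
  "solution_basis b1 b2 x Y \<longleftrightarrow>
     (\<forall>i. local_solution b1 b2 x (\<lambda>p. Y p $ i)) \<and>
     (\<forall>f. local_solution b1 b2 x f \<longrightarrow>
        (\<exists>!c :: complex ^ 2. \<forall>\<^sub>F p in nhds x. f p = (\<Sum>i\<in>UNIV. c $ i * Y p $ i)))"


section \<open>Fundamental group and monodromy\<close>

definition loop_class ::
  "'a::topological_space set \<Rightarrow> (real \<Rightarrow> 'a) \<Rightarrow> (real \<Rightarrow> 'a) set" where
  "loop_class S p = {q. homotopic_paths S p q}"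

definition loops_at :: "'a::topological_space set \<Rightarrow> 'a \<Rightarrow> (real \<Rightarrow> 'a) set" where
  "loops_at S x = {p. path p \<and> path_image p \<subseteq> S \<and> pathstart p = x \<and> pathfinish p = x}"

definition fundamental_group ::
  "'a::topological_space set \<Rightarrow> 'a \<Rightarrow> (real \<Rightarrow> 'a) set monoid" where
  "fundamental_group S x =
     \<lparr>carrier = loop_class S ` loops_at S x,
      mult = (\<lambda>A B. \<Union>p\<in>A. \<Union>q\<in>B. loop_class S (p +++ q)),
      one = loop_class S (\<lambda>_. x)\<rparr>"

definition GL2 :: "(complex ^ 2 ^ 2) monoid" where
  "GL2 = \<lparr>carrier = {A. invertible A}, mult = (**), one = mat 1\<rparr>"

text \<open>\<open>F s\<close> represents the germ at \<open>\<gamma> s\<close> of the solution continued along \<open>\<gamma>\<close>.\<close>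

definition continuation_along ::
  "(complex \<Rightarrow> complex) \<Rightarrow> (complex \<Rightarrow> complex) \<Rightarrow> (real \<Rightarrow> riemann_sphere)
   \<Rightarrow> (real \<Rightarrow> riemann_sphere \<Rightarrow> complex) \<Rightarrow> bool" where
  "continuation_along b1 b2 \<gamma> F \<longleftrightarrow>
     (\<forall>t\<in>{0..1}. local_solution b1 b2 (\<gamma> t) (F t) \<and>
        (\<forall>\<^sub>F s in at t within {0..1}. \<forall>\<^sub>F p in nhds (\<gamma> s). F s p = F t p))"

text \<open>The row \<open>Y\<close> and its continuation \<open>Y\<^sup>*\<close> (the germ \<open>F 1\<close>) satisfy \<open>Y = Y\<^sup>* G\<close>.\<close>

definition monodromy_matrix ::
  "(complex \<Rightarrow> complex) \<Rightarrow> (complex \<Rightarrow> complex) \<Rightarrow> riemann_sphere \<Rightarrow> (riemann_sphere \<Rightarrow> complex ^ 2)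
   \<Rightarrow> (real \<Rightarrow> riemann_sphere) \<Rightarrow> complex ^ 2 ^ 2 \<Rightarrow> bool" where
  "monodromy_matrix b1 b2 x Y \<gamma> G \<longleftrightarrow>
     (\<exists>F. (\<forall>i. continuation_along b1 b2 \<gamma> (\<lambda>t p. F t p $ i)) \<and>
          (\<forall>\<^sub>F p in nhds x. F 0 p = Y p) \<and>
          (\<forall>\<^sub>F p in nhds x. Y p = F 1 p v* G))"

definition realizes_representation ::
  "riemann_sphere set \<Rightarrow> riemann_sphere \<Rightarrow> (complex \<Rightarrow> complex) \<Rightarrow> (complex \<Rightarrow> complex)
   \<Rightarrow> ((real \<Rightarrow> riemann_sphere) set \<Rightarrow> complex ^ 2 ^ 2) \<Rightarrow> bool" where
  "realizes_representation D x b1 b2 \<rho> \<longleftrightarrow>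
     (\<exists>Y. solution_basis b1 b2 x Y \<and>
        (\<forall>\<gamma>\<in>loops_at (- D) x. monodromy_matrix b1 b2 x Y \<gamma> (\<rho> (loop_class (- D) \<gamma>))))"

text \<open>Up to homotopy, a loop around \<open>a\<close> runs along a path \<open>\<delta>\<close> to a small positively oriented
  circle about \<open>a\<close> (in the local coordinate), once along the circle, and back along \<open>\<delta>\<close>.\<close>

definition loop_around ::
  "riemann_sphere set \<Rightarrow> riemann_sphere \<Rightarrow> riemann_sphere \<Rightarrow> (real \<Rightarrow> riemann_sphere) \<Rightarrow> bool" where
  "loop_around D x a \<gamma> \<longleftrightarrow>
     \<gamma> \<in> loops_at (- D) x \<and>
     (\<exists>r>0. \<exists>\<delta>. sph a ` cball 0 r \<inter> D = {a} \<and>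
        path \<delta> \<and> path_image \<delta> \<subseteq> - D \<and>
        pathstart \<delta> = x \<and> pathfinish \<delta> = sph a (of_real r) \<and>
        homotopic_paths (- D) \<gamma> (\<delta> +++ (sph a \<circ> circlepath 0 r) +++ reversepath \<delta>))"

definition standard_loops ::
  "riemann_sphere \<Rightarrow> riemann_sphere \<Rightarrow> riemann_sphere \<Rightarrow> riemann_sphere
   \<Rightarrow> (real \<Rightarrow> riemann_sphere) \<Rightarrow> (real \<Rightarrow> riemann_sphere) \<Rightarrow> (real \<Rightarrow> riemann_sphere) \<Rightarrow> bool" where
  "standard_loops x a1 a2 a3 \<gamma>1 \<gamma>2 \<gamma>3 \<longleftrightarrow>
     (let D = {a1, a2, a3}; P = fundamental_group (- D) x; cl = loop_class (- D) in
        loop_around D x a1 \<gamma>1 \<and> loop_around D x a2 \<gamma>2 \<and> loop_around D x a3 \<gamma>3 \<and>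
        generate P {cl \<gamma>1, cl \<gamma>2, cl \<gamma>3} = carrier P \<and>
        cl \<gamma>1 \<otimes>\<^bsub>P\<^esub> cl \<gamma>2 \<otimes>\<^bsub>P\<^esub> cl \<gamma>3 = \<one>\<^bsub>P\<^esub>)"


section \<open>Reducibility and diagonalizability\<close>

text \<open>\<open>vec.subspace\<close> refers to complex scalars.\<close>

definition reducible_representation ::
  "('g, 'b) monoid_scheme \<Rightarrow> ('g \<Rightarrow> complex ^ 2 ^ 2) \<Rightarrow> bool" where
  "reducible_representation P \<rho> \<longleftrightarrow>
     (\<exists>W :: (complex ^ 2) set. vec.subspace W \<and> W \<noteq> {0} \<and> W \<noteq> UNIV \<and>
        (\<forall>g\<in>carrier P. \<forall>v\<in>W. \<rho> g *v v \<in> W))"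

definition diagonalizable :: "'a::field ^ 'n ^ 'n \<Rightarrow> bool" where
  "diagonalizable A \<longleftrightarrow>
     (\<exists>P :: 'a ^ 'n ^ 'n. invertible P \<and>
        (\<forall>i j. i \<noteq> j \<longrightarrow> (matrix_inv P ** A ** P) $ i $ j = 0))"

end

theory Submission
  imports Defs
begin

text \<open>
  Suppose that no \<open>G\<^sub>i\<close> is diagonalizable. Reducibility gives a solution \<open>y\<close> that is multiplied by a
  scalar along every loop, and since each \<open>G\<^sub>i\<close> has a single eigenvalue, so does every monodromy
  matrix. Hence for a second solution with Wronskian \<open>w\<close> the quotient \<open>v = y\<^sup>2/w\<close> is single-valued,
  and it transforms as a vector field \<open>v \<partial>/\<partial>z\<close> on the sphere, holomorphic outside the singular points.
  The triple \<open>(y\<^sup>2/w, y y'/w, y'\<^sup>2/w)\<close> satisfies a linear system with Fuchsian singularities, so \<open>v\<close>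
  has at most a pole at each \<open>a\<^sub>i\<close>. If \<open>v\<close> did not vanish at \<open>a\<^sub>i\<close>, then \<open>1/v\<close>, the derivative of
  the quotient of the two solutions, would have a single-valued primitive near \<open>a\<^sub>i\<close> and \<open>G\<^sub>i\<close> would be
  scalar. So \<open>v\<close> vanishes at three points, whereas a nonzero holomorphic vector field on the sphere
  has only two zeros.
\<close>

section \<open>Germs and continuation on the Riemann sphere\<close>

text \<open>The form y^2/w is dictated by how the basis changes. Along a loop the pair (y, y2)
  becomes (l y, l y2 + b y). The summand b y drops out of the Wronskian, which is multiplied by l^2,
  exactly like y^2. Two different diagonal entries l and m would leave a factor l/m, so this is the
  point where non-diagonalizability of every generator enters.

  The obstacle is growth at a singular point: y is multivalued there, and v alone satisfies only a
  third order equation. The triple of quadratic expressions is single-valued along with v and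
  satisfies a first order system. Integrating along rays that end on a compact circle therefore
  gives one bound for the whole punctured disc.

  That v is a vector field comes from w alone: y is a function, while w contains one derivative with
  respect to the coordinate, so y^2/w is multiplied by dt/dz when z is replaced by t. Its degree on
  the sphere is 2 whatever the exponents at the singular points are, and three zeros are just one
  too many.\<close>

lemma inj_sph: "inj (sph a)"
  by (cases a) (auto intro!: injI split: if_splits)

lemma open_vimage_add: "open {t. c + t \<in> U} \<longleftrightarrow> open (U :: complex set)"
proof
  assume "open {t. c + t \<in> U}"
  from open_translation[OF this, of c] have "open ((\<lambda>x. c + x) ` {t. c + t \<in> U})" .
  moreover have "(\<lambda>x. c + x) ` {t. c + t \<in> U} = U"
    by (auto simp: image_iff intro!: exI[of _ "_ - c"])
  ultimately show "open U" by simp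
next
  assume "open U"
  then show "open {t. c + t \<in> U}"
    using open_vimage[of U "\<lambda>t. c + t"] by (simp add: vimage_def continuous_intros)
qed

lemma open_inverse_preimage:
  assumes "open (U :: complex set)"
  shows "open {t. t \<noteq> 0 \<and> 1 / t \<in> U}"
proof -
  have "continuous_on (- {0}) (\<lambda>t::complex. 1 / t)"
    by (intro continuous_intros) auto
  then have "open ((\<lambda>t. 1 / t) -` U \<inter> - {0})"
    using assms by (intro continuous_on_open_vimage[THEN iffD1, rule_format]) auto
  moreover have "(\<lambda>t. 1 / t) -` U \<inter> - {0} = {t. t \<noteq> 0 \<and> 1 / t \<in> U}" by auto
  ultimately show ?thesis by simp
qed

lemma open_sph_vimage:
  assumes "open U"
  shows "open (sph a -` U)"
proof (cases a)
  case (Fin_pt c)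
  have "open {z. Fin_pt z \<in> U}"
    using assms by (auto simp: open_riemann_sphere_def vimage_def)
  then show ?thesis
    using open_vimage_add[of c "{z. Fin_pt z \<in> U}"] by (simp add: Fin_pt vimage_def)
qed (use assms in \<open>auto simp: open_riemann_sphere_def\<close>)

lemma open_sph_image:
  assumes "open V"
  shows "open (sph a ` V)"
proof (cases a)
  case (Fin_pt c)
  let ?T = "(\<lambda>t. c + t) ` V"
  have T: "open ?T" using assms by (rule open_translation)
  have "sph (Fin_pt 0) -` (sph a ` V) = ?T" by (auto simp: Fin_pt)
  moreover have "sph Infty -` (sph a ` V) = {t. t \<noteq> 0 \<and> 1 / t \<in> ?T}"
    by (auto simp: Fin_pt image_iff split: if_splits)
  ultimately show ?thesis
    using T open_inverse_preimage[OF T] by (simp add: open_riemann_sphere_def)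
next
  case Infty
  have "sph (Fin_pt 0) -` (sph a ` V) = {t. t \<noteq> 0 \<and> 1 / t \<in> V}"
  proof (rule Set.set_eqI)
    fix z
    have "Fin_pt z = sph Infty t \<longleftrightarrow> t \<noteq> 0 \<and> t = 1 / z \<and> z \<noteq> 0" for t
      by auto
    then show "z \<in> sph (Fin_pt 0) -` (sph a ` V) \<longleftrightarrow> z \<in> {t. t \<noteq> 0 \<and> 1 / t \<in> V}"
      by (auto simp: Infty image_iff simp del: sph.simps(2))
  qed
  moreover have "sph Infty -` (sph a ` V) = V"
    unfolding Infty by (rule inj_vimage_image_eq[OF inj_sph])
  ultimately show ?thesis
    using assms open_inverse_preimage[OF assms] by (simp add: open_riemann_sphere_def)
qed

lemma continuous_on_sph: "continuous_on S (sph a)"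
  by (rule continuous_on_subset[of UNIV]) (auto simp: continuous_on_open_vimage open_sph_vimage)

text \<open>Each chart is continuous and open, so germs on the sphere are germs in the coordinate;
  the local arguments are carried out there.\<close>

lemma nhds_sph: "nhds (sph a t) = filtermap (sph a) (nhds t)"
proof (rule filter_eqI)
  fix P
  show "eventually P (nhds (sph a t)) \<longleftrightarrow> eventually P (filtermap (sph a) (nhds t))"
    unfolding eventually_filtermap eventually_nhds
  proof (intro iffI; elim exE conjE)
    fix U assume "open U" "sph a t \<in> U" "\<forall>x\<in>U. P x"
    then show "\<exists>V. open V \<and> t \<in> V \<and> (\<forall>x\<in>V. P (sph a x))"
      by (intro exI[of _ "sph a -` U"]) (auto simp: open_sph_vimage)
  next
    fix V assume "open V" "t \<in> V" "\<forall>x\<in>V. P (sph a x)"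
    then show "\<exists>U. open U \<and> sph a t \<in> U \<and> (\<forall>x\<in>U. P x)"
      by (intro exI[of _ "sph a ` V"]) (auto simp: open_sph_image)
  qed
qed

lemma sph_0 [simp]: "sph a 0 = a"
  by (cases a) auto

lemma eventually_nhds_sph:
  "eventually P (nhds (sph a t)) \<longleftrightarrow> eventually (\<lambda>t. P (sph a t)) (nhds t)"
  by (simp add: nhds_sph eventually_filtermap)

lemma eventually_nhds_sphere:
  "eventually P (nhds a) \<longleftrightarrow> eventually (\<lambda>t. P (sph a t)) (nhds 0)"
  using eventually_nhds_sph[of P a 0] by simp

lemma eventually_nhds_Fin_pt:
  "eventually P (nhds (Fin_pt z)) \<longleftrightarrow> eventually (\<lambda>z. P (Fin_pt z)) (nhds z)"
  using eventually_nhds_sph[of P "Fin_pt 0" z] by simp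

lemma continuous_on_Fin_pt: "continuous_on S Fin_pt"
proof -
  have "sph (Fin_pt 0) = Fin_pt" by (rule ext) simp
  then show ?thesis using continuous_on_sph[of S "Fin_pt 0"] by simp
qed

lemma finite_preimage_Fin_pt: "finite D \<Longrightarrow> finite {z. Fin_pt z \<in> D}"
  using finite_vimageI[of D Fin_pt] by (simp add: vimage_def inj_def)

lemma open_finite_points:
  assumes "finite D"
  shows "open {z. Fin_pt z \<notin> D}"
  using finite_imp_closed[OF finite_preimage_Fin_pt[OF assms]]
  by (simp add: closed_def Collect_neg_eq)

lemma path_to_finite_point:
  assumes "finite D" "x \<notin> D" "Fin_pt z \<notin> D"
  obtains \<delta> where "path \<delta>" "path_image \<delta> \<subseteq> - D" "pathstart \<delta> = x" "pathfinish \<delta> = Fin_pt z"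
proof -
  let ?K = "{z. Fin_pt z \<in> D}"
  have fin: "\<exists>\<delta>. path \<delta> \<and> path_image \<delta> \<subseteq> - D \<and> pathstart \<delta> = Fin_pt w \<and> pathfinish \<delta> = Fin_pt z"
    if "Fin_pt w \<notin> D" for w
  proof -
    have "path_connected (- ?K)"
      by (rule path_connected_complement_countable)
         (auto intro: countable_finite finite_preimage_Fin_pt assms)
    moreover have "w \<in> - ?K" "z \<in> - ?K" using that assms by simp_all
    ultimately obtain g where g: "path g" "path_image g \<subseteq> - ?K" "pathstart g = w" "pathfinish g = z"
      unfolding path_connected_def by (elim ballE[of _ _ w] ballE[of _ _ z] exE conjE) auto
    show ?thesis
      using g by (intro exI[of _ "Fin_pt \<circ> g"])
        (auto simp: path_continuous_image continuous_on_Fin_pt path_image_compose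
           pathstart_compose pathfinish_compose)
  qed
  show thesis
  proof (cases x)
    case (Fin_pt w)
    then show ?thesis using fin assms that by blast
  next
    case Infty
    have "bounded ?K" by (intro finite_imp_bounded finite_preimage_Fin_pt assms)
    then have "\<exists>B>0. \<forall>k\<in>?K. norm k \<le> B" by (rule bounded_pos[THEN iffD1])
    then obtain B where B: "B > 0" "\<And>k. k \<in> ?K \<Longrightarrow> norm k \<le> B"
      by (elim exE conjE) simp
    \<comment> \<open>In the coordinate \<open>1/z\<close> the segment from \<open>0\<close> to
      \<open>t\<close> consists of infinity and points of modulus at least \<open>B + 1\<close>,
      beyond every finite point of \<open>D\<close>.\<close>
    define t where "t = complex_of_real (1 / (B + 1))"
    have t: "norm t = 1 / (B + 1)" "t \<noteq> 0" using B(1) unfolding t_def by (auto simp del: of_real_divide)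
    have sub: "sph Infty ` closed_segment 0 t \<subseteq> - D"
    proof safe
      fix u assume u: "u \<in> closed_segment 0 t" "sph Infty u \<in> D"
      then have "u \<noteq> 0" using assms Infty by auto
      with u have "1 / u \<in> ?K" by auto
      from B(2)[OF this] have "1 \<le> B * norm u"
        using \<open>u \<noteq> 0\<close> by (simp add: norm_divide divide_simps)
      moreover have "norm u \<le> 1 / (B + 1)"
        using segment_bound1[OF u(1)] t by simp
      ultimately have "1 \<le> B * (1 / (B + 1))" using B
        using mult_left_mono[of "norm u" "1 / (B + 1)" B] by linarith
      then show False using B by (simp add: divide_simps)
    qed
    let ?g = "sph Infty \<circ> linepath 0 t"
    have g: "path ?g" "path_image ?g \<subseteq> - D" "pathstart ?g = x" "pathfinish ?g = Fin_pt (1 / t)"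
      using sub t path_continuous_image[OF path_linepath continuous_on_sph]
      by (auto simp: path_image_compose pathstart_compose pathfinish_compose Infty)
    have "Fin_pt (1 / t) \<notin> D" using g(2,4) pathfinish_in_path_image[of ?g] by auto
    from fin[OF this] obtain \<delta> where \<delta>: "path \<delta>" "path_image \<delta> \<subseteq> - D"
      "pathstart \<delta> = Fin_pt (1 / t)" "pathfinish \<delta> = Fin_pt z" by blast
    show ?thesis
      by (rule that[of "?g +++ \<delta>"])
         (use g \<delta> in \<open>auto simp: path_image_join pathstart_compose pathfinish_compose t\<close>)
  qed
qed

section \<open>Germs of functions on the sphere\<close>

definition germ_eq :: "riemann_sphere \<Rightarrow> (riemann_sphere \<Rightarrow> 'a) \<Rightarrow> (riemann_sphere \<Rightarrow> 'a) \<Rightarrow> bool" where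
  "germ_eq p f g \<longleftrightarrow> (\<forall>\<^sub>F q in nhds p. f q = g q)"

definition germ_analytic :: "riemann_sphere \<Rightarrow> (riemann_sphere \<Rightarrow> complex) \<Rightarrow> bool" where
  "germ_analytic p f \<longleftrightarrow> (\<lambda>t. f (sph p t)) analytic_on {0}"

lemma germ_eq_refl [simp, intro]: "germ_eq p f f"
  by (simp add: germ_eq_def)

lemma germ_eq_sym: "germ_eq p f g \<Longrightarrow> germ_eq p g f"
  by (auto simp: germ_eq_def elim: eventually_mono)

lemma germ_eq_trans [trans]: "germ_eq p f g \<Longrightarrow> germ_eq p g h \<Longrightarrow> germ_eq p f h"
  unfolding germ_eq_def by (drule (1) eventually_conj) (erule eventually_mono, simp)

lemma germ_eq_combine:
  assumes "germ_eq p f f'" "germ_eq p g g'"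
  shows "germ_eq p (\<lambda>q. a * f q + b * g q) (\<lambda>q. a * f' q + b * g' q)"
  using assms unfolding germ_eq_def by (rule eventually_elim2) auto

lemma germ_eq_nearby:
  assumes "germ_eq p f g"
  shows "\<forall>\<^sub>F q in nhds p. germ_eq q f g"
  using assms unfolding germ_eq_def by (subst (asm) eventually_eventually[symmetric])

lemma germ_analytic_cong:
  assumes "germ_eq p f g"
  shows "germ_analytic p f \<longleftrightarrow> germ_analytic p g"
  using assms unfolding germ_analytic_def germ_eq_def eventually_nhds_sphere
  by (intro analytic_at_cong) auto

lemma germ_analytic_combine:
  assumes "germ_analytic p f" "germ_analytic p g"
  shows "germ_analytic p (\<lambda>q. a * f q + b * g q)"
  using assms unfolding germ_analytic_def by (intro analytic_intros)

lemma germ_analytic_mult: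
  assumes "germ_analytic p f" "germ_analytic p g"
  shows "germ_analytic p (\<lambda>q. f q * g q)"
  using assms unfolding germ_analytic_def by (intro analytic_intros)

lemma germ_analytic_Fin_pt_iff:
  "germ_analytic (Fin_pt z) f \<longleftrightarrow> (\<lambda>w. f (Fin_pt w)) analytic_on {z}"
proof
  assume "germ_analytic (Fin_pt z) f"
  then have "(\<lambda>t. f (Fin_pt (z + t))) analytic_on {0}"
    by (simp add: germ_analytic_def)
  then have "((\<lambda>t. f (Fin_pt (z + t))) \<circ> (\<lambda>w. w - z)) analytic_on {z}"
    by (intro analytic_on_compose analytic_intros) auto
  then show "(\<lambda>w. f (Fin_pt w)) analytic_on {z}" by (simp add: o_def)
next
  assume "(\<lambda>w. f (Fin_pt w)) analytic_on {z}"
  then have "((\<lambda>w. f (Fin_pt w)) \<circ> (\<lambda>t. z + t)) analytic_on {0}"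
    by (intro analytic_on_compose analytic_intros) auto
  then show "germ_analytic (Fin_pt z) f"
    by (simp add: germ_analytic_def o_def)
qed

text \<open>Identity theorem on one fixed disc about \<open>p\<close>: an analytic function whose
  germ vanishes at some point of the disc vanishes on all of it. Together with
  \<open>germ_eq_nearby\<close> this makes vanishing a locally constant property along a
  continuation.\<close>

lemma germ_eq_zero_of_nearby:
  assumes "germ_analytic p f"
  shows "\<forall>\<^sub>F q in nhds p. germ_eq q f (\<lambda>_. 0) \<longrightarrow> germ_eq p f (\<lambda>_. 0)"
proof -
  let ?f = "\<lambda>t. f (sph p t)"
  obtain e where e: "e > 0" "?f holomorphic_on ball 0 e"
    using assms unfolding germ_analytic_def analytic_at_ball by blast
  have "germ_eq p f (\<lambda>_. 0)" if t: "t \<in> ball 0 e" and g: "germ_eq (sph p t) f (\<lambda>_. 0)" for t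
  proof -
    have "\<forall>\<^sub>F s in nhds t. ?f s = 0"
      using g unfolding germ_eq_def eventually_nhds_sph .
    then obtain U where U: "open U" "t \<in> U" "\<And>s. s \<in> U \<Longrightarrow> ?f s = 0"
      unfolding eventually_nhds by blast
    have "?f s = 0" if "s \<in> ball 0 e" for s
    proof (rule analytic_continuation_open[of "U \<inter> ball 0 e" "ball 0 e" ?f "\<lambda>_. 0" s])
      show "U \<inter> ball 0 e \<noteq> {}" using U(2) t by blast
    qed (use U e that in auto)
    moreover have "\<forall>\<^sub>F s in nhds 0. s \<in> ball 0 e"
      using e by (intro eventually_nhds_in_open) auto
    ultimately show ?thesis unfolding germ_eq_def eventually_nhds_sphere
      by (auto elim: eventually_mono)
  qed
  moreover have "\<forall>\<^sub>F s in nhds 0. s \<in> ball 0 e"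
    using e by (intro eventually_nhds_in_open) auto
  ultimately show ?thesis unfolding eventually_nhds_sphere[of _ p]
    by (rule_tac eventually_mono) blast+
qed

section \<open>Analytic continuation along paths\<close>

text \<open>Only the two end germs are visible and the differential equation is not mentioned, so
  that products with other analytic functions, as in \<open>continues_mult\<close>, can be continued
  as well.\<close>

definition continues :: "(real \<Rightarrow> riemann_sphere) \<Rightarrow> (riemann_sphere \<Rightarrow> complex) \<Rightarrow> (riemann_sphere \<Rightarrow> complex) \<Rightarrow> bool" where
  "continues \<gamma> f g \<longleftrightarrow>
     (\<exists>F. (\<forall>t\<in>{0..1}. germ_analytic (\<gamma> t) (F t) \<and>
             (\<forall>\<^sub>F s in at t within {0..1}. germ_eq (\<gamma> s) (F s) (F t))) \<and>
          germ_eq (pathstart \<gamma>) (F 0) f \<and> germ_eq (pathfinish \<gamma>) (F 1) g)"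

lemma continues_const:
  assumes "\<And>p. p \<in> path_image \<gamma> \<Longrightarrow> germ_analytic p f"
  shows "continues \<gamma> f f"
  unfolding continues_def using assms
  by (intro exI[of _ "\<lambda>_. f"]) (auto simp: path_image_def)

lemma continues_cong:
  assumes "continues \<gamma> f g" "germ_eq (pathstart \<gamma>) f f'" "germ_eq (pathfinish \<gamma>) g g'"
  shows "continues \<gamma> f' g'"
proof -
  from assms obtain F where
    "\<forall>t\<in>{0..1}. germ_analytic (\<gamma> t) (F t) \<and>
       (\<forall>\<^sub>F s in at t within {0..1}. germ_eq (\<gamma> s) (F s) (F t))"
    "germ_eq (pathstart \<gamma>) (F 0) f" "germ_eq (pathfinish \<gamma>) (F 1) g"
    unfolding continues_def by blast
  then show ?thesis
    unfolding continues_def using germ_eq_trans[OF _ assms(2)] germ_eq_trans[OF _ assms(3)]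
    by (intro exI[of _ F]) blast
qed

lemma continues_combine:
  assumes "continues \<gamma> f g" "continues \<gamma> f' g'"
  shows "continues \<gamma> (\<lambda>q. a * f q + b * f' q) (\<lambda>q. a * g q + b * g' q)"
proof -
  from assms(1) obtain F where
    F: "\<And>t. t \<in> {0..1} \<Longrightarrow> germ_analytic (\<gamma> t) (F t)"
       "\<And>t. t \<in> {0..1} \<Longrightarrow> \<forall>\<^sub>F s in at t within {0..1}. germ_eq (\<gamma> s) (F s) (F t)"
       "germ_eq (pathstart \<gamma>) (F 0) f" "germ_eq (pathfinish \<gamma>) (F 1) g"
    unfolding continues_def by metis
  from assms(2) obtain F' where F': "\<And>t. t \<in> {0..1} \<Longrightarrow> germ_analytic (\<gamma> t) (F' t)"
       "\<And>t. t \<in> {0..1} \<Longrightarrow> \<forall>\<^sub>F s in at t within {0..1}. germ_eq (\<gamma> s) (F' s) (F' t)"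
       "germ_eq (pathstart \<gamma>) (F' 0) f'" "germ_eq (pathfinish \<gamma>) (F' 1) g'"
    unfolding continues_def by metis
  show ?thesis unfolding continues_def
  proof (intro exI[of _ "\<lambda>t q. a * F t q + b * F' t q"] conjI ballI)
    fix t :: real assume "t \<in> {0..1}"
    then show "\<forall>\<^sub>F s in at t within {0..1}.
        germ_eq (\<gamma> s) (\<lambda>q. a * F s q + b * F' s q) (\<lambda>q. a * F t q + b * F' t q)"
      by (intro eventually_mono[OF eventually_conj[OF F(2) F'(2)]] germ_eq_combine) blast+
  qed (intro germ_analytic_combine germ_eq_combine F F'; assumption)+
qed

lemma continues_scale:
  assumes "continues \<gamma> f g"
  shows "continues \<gamma> (\<lambda>q. a * f q) (\<lambda>q. a * g q)"
  using continues_combine[OF assms assms, of a 0] by simp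

lemma continues_mult:
  assumes "continues \<gamma> f g" "\<And>p. p \<in> path_image \<gamma> \<Longrightarrow> germ_analytic p h"
  shows "continues \<gamma> (\<lambda>q. h q * f q) (\<lambda>q. h q * g q)"
proof -
  from assms obtain F where
    F: "\<And>t. t \<in> {0..1} \<Longrightarrow> germ_analytic (\<gamma> t) (F t)"
       "\<And>t. t \<in> {0..1} \<Longrightarrow> \<forall>\<^sub>F s in at t within {0..1}. germ_eq (\<gamma> s) (F s) (F t)"
       "germ_eq (pathstart \<gamma>) (F 0) f" "germ_eq (pathfinish \<gamma>) (F 1) g"
    unfolding continues_def by metis
  have mult: "germ_eq p (\<lambda>q. h q * f q) (\<lambda>q. h q * g q)" if "germ_eq p f g" for p f g
    using that unfolding germ_eq_def by eventually_elim auto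
  show ?thesis unfolding continues_def
  proof (intro exI[of _ "\<lambda>t q. h q * F t q"] conjI ballI)
    fix t :: real assume t: "t \<in> {0..1}"
    then show "\<forall>\<^sub>F s in at t within {0..1}.
        germ_eq (\<gamma> s) (\<lambda>q. h q * F s q) (\<lambda>q. h q * F t q)"
      by (intro eventually_mono[OF F(2)] mult)
    show "germ_analytic (\<gamma> t) (\<lambda>q. h q * F t q)"
      using t by (intro germ_analytic_mult F assms) (auto simp: path_image_def)
  qed (auto intro: F mult)
qed

text \<open>Whether the continued germ vanishes is locally constant in the parameter, hence constant
  on the connected interval. Applied to differences, this is uniqueness of continuation.\<close>

lemma continues_zero:
  assumes "continues \<gamma> f g" "path \<gamma>" "germ_eq (pathstart \<gamma>) f (\<lambda>_. 0)"
  shows "germ_eq (pathfinish \<gamma>) g (\<lambda>_. 0)"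
proof -
  from assms obtain F where
    F: "\<And>t. t \<in> {0..1} \<Longrightarrow> germ_analytic (\<gamma> t) (F t)"
       "\<And>t. t \<in> {0..1} \<Longrightarrow> \<forall>\<^sub>F s in at t within {0..1}. germ_eq (\<gamma> s) (F s) (F t)"
       "germ_eq (pathstart \<gamma>) (F 0) f" "germ_eq (pathfinish \<gamma>) (F 1) g"
    unfolding continues_def by metis
  let ?P = "\<lambda>t. germ_eq (\<gamma> t) (F t) (\<lambda>_. 0)"
  have loc: "\<forall>\<^sub>F s in at t within {0..1}. ?P s \<longleftrightarrow> ?P t" if t: "t \<in> {0..1}" for t
  proof -
    have lim: "(\<gamma> \<longlongrightarrow> \<gamma> t) (at t within {0..1})"
      using assms(2) t unfolding path_def continuous_on_def by blast
    have "\<forall>\<^sub>F q in nhds (\<gamma> t). germ_eq q (F t) (\<lambda>_. 0) \<longleftrightarrow> ?P t"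
    proof (cases "?P t")
      case True
      from germ_eq_nearby[OF this] True show ?thesis by (auto elim: eventually_mono)
    next
      case False
      from germ_eq_zero_of_nearby[OF F(1)[OF t]] False show ?thesis
        by (auto elim: eventually_mono)
    qed
    then have "\<forall>\<^sub>F s in at t within {0..1}. germ_eq (\<gamma> s) (F t) (\<lambda>_. 0) \<longleftrightarrow> ?P t"
      using lim by (rule eventually_compose_filterlim)
    then show ?thesis using F(2)[OF t]
      by eventually_elim (meson germ_eq_sym germ_eq_trans)
  qed
  have "?P 0 = ?P 1"
    by (rule connected_local_const[of "{0..1::real}"])
       (use loc in \<open>auto simp: eq_commute\<close>)
  moreover have "?P 0"
    using germ_eq_trans[OF F(3) assms(3)] by (simp add: pathstart_def)
  ultimately show ?thesis
    using germ_eq_trans[OF germ_eq_sym[OF F(4)]] by (simp add: pathfinish_def)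
qed

lemma continues_unique:
  assumes "continues \<gamma> f g" "continues \<gamma> f' g'" "path \<gamma>" "germ_eq (pathstart \<gamma>) f f'"
  shows "germ_eq (pathfinish \<gamma>) g g'"
proof -
  have "germ_eq (pathstart \<gamma>) (\<lambda>q. 1 * f q + (-1) * f' q) (\<lambda>_. 0)"
    using assms(4) unfolding germ_eq_def by eventually_elim auto
  from continues_zero[OF continues_combine[OF assms(1,2)] assms(3) this]
  show ?thesis unfolding germ_eq_def by eventually_elim auto
qed

lemma continues_reversepath:
  assumes "continues \<gamma> f g"
  shows "continues (reversepath \<gamma>) g f"
proof -
  from assms obtain F where
    F: "\<And>t. t \<in> {0..1} \<Longrightarrow> germ_analytic (\<gamma> t) (F t)"
       "\<And>t. t \<in> {0..1} \<Longrightarrow> \<forall>\<^sub>F s in at t within {0..1}. germ_eq (\<gamma> s) (F s) (F t)"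
       "germ_eq (pathstart \<gamma>) (F 0) f" "germ_eq (pathfinish \<gamma>) (F 1) g"
    unfolding continues_def by metis
  show ?thesis unfolding continues_def
  proof (intro exI[of _ "\<lambda>t. F (1 - t)"] conjI ballI)
    fix t :: real assume t: "t \<in> {0..1}"
    then obtain d where d: "d > 0"
      "\<And>s. s \<in> {0..1} \<Longrightarrow> s \<noteq> 1 - t \<Longrightarrow> dist s (1 - t) < d \<Longrightarrow> germ_eq (\<gamma> s) (F s) (F (1 - t))"
      using F(2)[of "1 - t"] unfolding eventually_at by auto
    show "\<forall>\<^sub>F s in at t within {0..1}. germ_eq (reversepath \<gamma> s) (F (1 - s)) (F (1 - t))"
      unfolding eventually_at
      by (intro exI[of _ d] conjI ballI impI)
         (use d t in \<open>auto simp: reversepath_def dist_norm intro!: d(2)\<close>)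
  qed (use F in \<open>auto simp: reversepath_def pathstart_def pathfinish_def\<close>)
qed

text \<open>The middle germ \<open>F (1 / 2)\<close> stays explicit because continuation along an
  open path is later read off from a loop at exactly this parameter, where \<open>F\<close> is also
  known to solve the equation.\<close>

lemma continuation_along_join_halves:
  assumes F: "\<And>t. t \<in> {0..1} \<Longrightarrow> germ_analytic ((\<gamma> +++ \<delta>) t) (F t)"
      "\<And>t. t \<in> {0..1} \<Longrightarrow> \<forall>\<^sub>F s in at t within {0..1}. germ_eq ((\<gamma> +++ \<delta>) s) (F s) (F t)"
    and ends: "pathfinish \<gamma> = pathstart \<delta>"
  shows "continues \<gamma> (F 0) (F (1 / 2))" "continues \<delta> (F (1 / 2)) (F 1)"
proof -
  have left: "(\<gamma> +++ \<delta>) (t / 2) = \<gamma> t" if "t \<in> {0..1}" for t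
    using that by (auto simp: joinpaths_def)
  have right: "(\<gamma> +++ \<delta>) ((t + 1) / 2) = \<delta> t" if "t \<in> {0..1}" for t
    using that ends by (auto simp: joinpaths_def pathstart_def pathfinish_def add_divide_distrib)
  have loc: "\<exists>d>0. \<forall>s\<in>{0..1}. s \<noteq> t \<and> dist s t < d \<longrightarrow> germ_eq ((\<gamma> +++ \<delta>) s) (F s) (F t)"
    if "t \<in> {0..1}" for t
    using F(2)[OF that] unfolding eventually_at by blast
  show "continues \<gamma> (F 0) (F (1 / 2))" unfolding continues_def
  proof (intro exI[of _ "\<lambda>t. F (t / 2)"] conjI ballI)
    fix t :: real assume t: "t \<in> {0..1}"
    then show "germ_analytic (\<gamma> t) (F (t / 2))" using F(1)[of "t / 2"] left[OF t] by auto
    obtain d where d: "d > 0"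
      "\<And>s. s \<in> {0..1} \<Longrightarrow> s \<noteq> t / 2 \<Longrightarrow> dist s (t / 2) < d \<Longrightarrow> germ_eq ((\<gamma> +++ \<delta>) s) (F s) (F (t / 2))"
      using loc[of "t / 2"] t by auto
    show "\<forall>\<^sub>F s in at t within {0..1}. germ_eq (\<gamma> s) (F (s / 2)) (F (t / 2))"
      unfolding eventually_at
    proof (intro exI[of _ d] conjI ballI impI d(1))
      fix s assume s: "s \<in> {0..1}" "s \<noteq> t \<and> dist s t < d"
      then have "germ_eq ((\<gamma> +++ \<delta>) (s / 2)) (F (s / 2)) (F (t / 2))"
        by (intro d(2)) (auto simp: dist_real_def)
      then show "germ_eq (\<gamma> s) (F (s / 2)) (F (t / 2))" using left[OF s(1)] by simp
    qed
  qed auto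
  show "continues \<delta> (F (1 / 2)) (F 1)" unfolding continues_def
  proof (intro exI[of _ "\<lambda>t. F ((t + 1) / 2)"] conjI ballI)
    fix t :: real assume t: "t \<in> {0..1}"
    then show "germ_analytic (\<delta> t) (F ((t + 1) / 2))"
      using F(1)[of "(t + 1) / 2"] right[OF t] by auto
    obtain d where d: "d > 0"
      "\<And>s. s \<in> {0..1} \<Longrightarrow> s \<noteq> (t + 1) / 2 \<Longrightarrow> dist s ((t + 1) / 2) < d \<Longrightarrow>
         germ_eq ((\<gamma> +++ \<delta>) s) (F s) (F ((t + 1) / 2))"
      using loc[of "(t + 1) / 2"] t by auto
    show "\<forall>\<^sub>F s in at t within {0..1}. germ_eq (\<delta> s) (F ((s + 1) / 2)) (F ((t + 1) / 2))"
      unfolding eventually_at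
    proof (intro exI[of _ d] conjI ballI impI d(1))
      fix s assume s: "s \<in> {0..1}" "s \<noteq> t \<and> dist s t < d"
      then have "germ_eq ((\<gamma> +++ \<delta>) ((s + 1) / 2)) (F ((s + 1) / 2)) (F ((t + 1) / 2))"
        by (intro d(2)) (auto simp: dist_real_def abs_if add_divide_distrib split: if_splits)
      then show "germ_eq (\<delta> s) (F ((s + 1) / 2)) (F ((t + 1) / 2))" using right[OF s(1)] by simp
    qed
  qed auto
qed

lemma continues_joinpaths_split:
  assumes "continues (\<gamma> +++ \<delta>) f g" and ends: "pathfinish \<gamma> = pathstart \<delta>"
  obtains h where "continues \<gamma> f h" "continues \<delta> h g"
proof -
  from assms obtain F where
    F: "\<And>t. t \<in> {0..1} \<Longrightarrow> germ_analytic ((\<gamma> +++ \<delta>) t) (F t)"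
       "\<And>t. t \<in> {0..1} \<Longrightarrow> \<forall>\<^sub>F s in at t within {0..1}. germ_eq ((\<gamma> +++ \<delta>) s) (F s) (F t)"
       "germ_eq (pathstart \<gamma>) (F 0) f" "germ_eq (pathfinish \<delta>) (F 1) g"
    unfolding continues_def by (metis pathstart_join pathfinish_join)
  note halves = continuation_along_join_halves[OF F(1,2) ends]
  show thesis
    by (rule that[OF continues_cong[OF halves(1) F(3) germ_eq_refl]
          continues_cong[OF halves(2) germ_eq_refl F(4)]])
qed

section \<open>The symmetric square system\<close>

text \<open>A Gronwall estimate with integrating factor \<open>\<phi>\<close>. By Cauchy-Schwarz the
  norm of \<open>x\<close> decays at most at the rate \<open>k\<close>, and the growth of
  \<open>\<phi>\<close> compensates for this. Squares are used because the norm need not be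
  differentiable at zeros of \<open>x\<close>.\<close>

lemma weighted_norm_mono:
  fixes x :: "real \<Rightarrow> 'a::real_inner"
  assumes "a \<le> b"
    and x: "\<And>r. r \<in> {a..b} \<Longrightarrow> (x has_vector_derivative x' r) (at r)"
    and \<phi>: "\<And>r. r \<in> {a..b} \<Longrightarrow> (\<phi> has_real_derivative k r * \<phi> r) (at r)"
    and bound: "\<And>r. r \<in> {a..b} \<Longrightarrow> norm (x' r) \<le> k r * norm (x r)"
  shows "(\<phi> a * norm (x a))\<^sup>2 \<le> (\<phi> b * norm (x b))\<^sup>2"
proof -
  have "(\<phi> a)\<^sup>2 * (x a \<bullet> x a) \<le> (\<phi> b)\<^sup>2 * (x b \<bullet> x b)"
  proof (rule DERIV_nonneg_imp_nondecreasing[OF \<open>a \<le> b\<close>])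
    fix r assume r: "a \<le> r" "r \<le> b"
    have d1: "((\<lambda>r. x r \<bullet> x r) has_vector_derivative (x r \<bullet> x' r + x' r \<bullet> x r)) (at r)"
      using r by (intro bounded_bilinear.has_vector_derivative[OF bounded_bilinear_inner] x) auto
    have d2: "((\<lambda>r. (\<phi> r)\<^sup>2) has_vector_derivative 2 * \<phi> r * (k r * \<phi> r)) (at r)"
      unfolding has_real_derivative_iff_has_vector_derivative[symmetric]
      using r by (auto intro!: derivative_eq_intros \<phi>)
    have "((\<lambda>r. (\<phi> r)\<^sup>2 * (x r \<bullet> x r)) has_real_derivative
        (\<phi> r)\<^sup>2 * (x r \<bullet> x' r + x' r \<bullet> x r) + 2 * \<phi> r * (k r * \<phi> r) * (x r \<bullet> x r)) (at r)"
      using has_vector_derivative_mult[OF d2 d1]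
      by (simp add: has_real_derivative_iff_has_vector_derivative)
    moreover have "- (k r * norm (x r) * norm (x r)) \<le> x r \<bullet> x' r"
    proof -
      have "\<bar>x r \<bullet> x' r\<bar> \<le> norm (x r) * norm (x' r)" by (rule Cauchy_Schwarz_ineq2)
      also have "\<dots> \<le> norm (x r) * (k r * norm (x r))"
        using r by (intro mult_left_mono bound) auto
      finally show ?thesis by (simp add: mult_ac)
    qed
    then have "0 \<le> 2 * (\<phi> r)\<^sup>2 * (x r \<bullet> x' r + k r * norm (x r) * norm (x r))"
      by simp
    then have "0 \<le> (\<phi> r)\<^sup>2 * (x r \<bullet> x' r + x' r \<bullet> x r) + 2 * \<phi> r * (k r * \<phi> r) * (x r \<bullet> x r)"
      by (simp add: inner_commute[of "x' r"] dot_square_norm power2_eq_square algebra_simps)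
    ultimately show "\<exists>y. ((\<lambda>r. (\<phi> r)\<^sup>2 * (x r \<bullet> x r)) has_real_derivative y) (at r) \<and> 0 \<le> y"
      by blast
  qed
  then show ?thesis by (simp add: power_mult_distrib dot_square_norm)
qed

text \<open>Every \<open>t\<close> is joined by its ray to the circle of radius \<open>R\<close>, on
  which the triple is bounded by compactness. The weight is the integrating factor of
  \<open>k\<close>: an exponential when \<open>k\<close> is constant, a power of the radius when
  \<open>k\<close> is a multiple of its reciprocal.\<close>

lemma radial_growth_bound:
  fixes X Y Z :: "complex \<Rightarrow> complex"
  assumes "0 < R"
    and d: "\<And>t. 0 < norm t \<Longrightarrow> norm t \<le> R \<Longrightarrow> (X has_field_derivative X' t) (at t)"
      "\<And>t. 0 < norm t \<Longrightarrow> norm t \<le> R \<Longrightarrow> (Y has_field_derivative Y' t) (at t)"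
      "\<And>t. 0 < norm t \<Longrightarrow> norm t \<le> R \<Longrightarrow> (Z has_field_derivative Z' t) (at t)"
    and bound: "\<And>t. 0 < norm t \<Longrightarrow> norm t \<le> R \<Longrightarrow>
        norm (X' t, Y' t, Z' t) \<le> k (norm t) * norm (X t, Y t, Z t)"
    and \<phi>: "\<And>r. 0 < r \<Longrightarrow> r \<le> R \<Longrightarrow> (\<phi> has_real_derivative k r * \<phi> r) (at r)"
    and pos: "\<And>r. 0 < r \<Longrightarrow> r \<le> R \<Longrightarrow> 0 < \<phi> r"
  shows "\<exists>C. \<forall>t. 0 < norm t \<and> norm t \<le> R \<longrightarrow> \<phi> (norm t) * norm (X t) \<le> C"
proof -
  let ?n = "\<lambda>t. norm (X t, Y t, Z t)"
  have cont: "continuous_on (sphere 0 R) f"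
    if "\<And>t. 0 < norm t \<Longrightarrow> norm t \<le> R \<Longrightarrow> (f has_field_derivative f' t) (at t)"
    for f f' :: "complex \<Rightarrow> complex"
    using that \<open>0 < R\<close>
    by (intro continuous_at_imp_continuous_on ballI, rule_tac DERIV_isCont, rule_tac that) auto
  have "continuous_on (sphere 0 R) ?n"
    using cont[of X X'] cont[of Y Y'] cont[of Z Z'] d by (intro continuous_intros) auto
  then have "bounded (?n ` sphere 0 R)"
    by (intro compact_imp_bounded compact_continuous_image) auto
  then obtain M where M: "\<And>t. t \<in> sphere 0 R \<Longrightarrow> ?n t \<le> M"
    unfolding bounded_iff by force
  have "\<phi> (norm t) * norm (X t) \<le> \<phi> R * M" if t: "0 < norm t" "norm t \<le> R" for t
  proof -
    define u where "u = t / of_real (norm t)"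
    have u: "norm u = 1" using t by (simp add: u_def norm_divide)
    have tu: "of_real (norm t) * u = t" using t by (simp add: u_def)
    let ?x = "\<lambda>r. (X (of_real r * u), Y (of_real r * u), Z (of_real r * u))"
    let ?x' = "\<lambda>r. (X' (of_real r * u) * u, Y' (of_real r * u) * u, Z' (of_real r * u) * u)"
    have ray: "((\<lambda>r. f (of_real r * u)) has_vector_derivative f' (of_real r * u) * u) (at r)"
      if r: "r \<in> {norm t..R}"
      and "\<And>t. 0 < norm t \<Longrightarrow> norm t \<le> R \<Longrightarrow> (f has_field_derivative f' t) (at t)"
      for r and f f' :: "complex \<Rightarrow> complex"
    proof -
      have "(f has_field_derivative f' (of_real r * u)) (at (of_real r * u))"
      proof (rule that(2))
        have r0: "r > 0" using r t(1) unfolding atLeastAtMost_iff by linarith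
        then have "norm (of_real r * u) = r" using u by (simp add: norm_mult)
        then show "0 < norm (of_real r * u)" "norm (of_real r * u) \<le> R" using r r0 by auto
      qed
      moreover have "((\<lambda>r. of_real r * u) has_vector_derivative u) (at r)"
        by (auto intro!: derivative_eq_intros has_vector_derivative_of_real simp: has_vector_derivative_def scaleR_conv_of_real)
      ultimately show ?thesis
        using field_vector_diff_chain_at[of "\<lambda>r. of_real r * u" u r f "f' (of_real r * u)"]
        by (simp add: o_def mult.commute)
    qed
    have "(\<phi> (norm t) * norm (?x (norm t)))\<^sup>2 \<le> (\<phi> R * norm (?x R))\<^sup>2"
    proof (rule weighted_norm_mono[where x' = ?x' and k = k])
      fix r assume r: "r \<in> {norm t..R}"
      then have r0: "0 < r" "r \<le> R" using t(1) unfolding atLeastAtMost_iff by linarith+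
      show "(?x has_vector_derivative ?x' r) (at r)"
        using r d by (intro has_vector_derivative_Pair ray[of r X X'] ray[of r Y Y'] ray[of r Z Z']) auto
      show "(\<phi> has_real_derivative k r * \<phi> r) (at r)" using r0 by (intro \<phi>)
      have "norm (?x' r) = norm (X' (of_real r * u), Y' (of_real r * u), Z' (of_real r * u))"
        by (simp add: norm_Pair norm_mult u)
      also have "\<dots> \<le> k r * norm (?x r)"
        using bound[of "of_real r * u"] r0 u by (simp add: norm_mult)
      finally show "norm (?x' r) \<le> k r * norm (?x r)" .
    qed (use t in auto)
    then have "\<phi> (norm t) * ?n t \<le> \<phi> R * ?n (of_real R * u)"
      using abs_le_square_iff pos[of R] pos[of "norm t"] t \<open>0 < R\<close> tu
      by (auto simp: abs_mult)
    also have "\<dots> \<le> \<phi> R * M"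
      using M[of "of_real R * u"] u pos[of R] \<open>0 < R\<close> by (intro mult_left_mono) (auto simp: norm_mult)
    finally have "\<phi> (norm t) * ?n t \<le> \<phi> R * M" .
    moreover have "norm (X t) \<le> ?n t" by (simp add: norm_Pair real_le_rsqrt)
    then have "\<phi> (norm t) * norm (X t) \<le> \<phi> (norm t) * ?n t"
      using pos[of "norm t"] t by (intro mult_left_mono) auto
    ultimately show ?thesis by linarith
  qed
  then show ?thesis by blast
qed

lemma norm_triple_le: "norm (a, b, c) \<le> norm a + norm b + norm c"
  using norm_Pair_le[of a "(b, c)"] norm_Pair_le[of b c] by linarith

lemma norm_triple_ge:
  "norm a \<le> norm (a, b, c)" "norm b \<le> norm (a, b, c)" "norm c \<le> norm (a, b, c)"
proof -
  have "norm b \<le> norm (b, c)" "norm c \<le> norm (b, c)" "norm (b, c) \<le> norm (a, b, c)"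
    by (simp_all add: norm_Pair real_le_rsqrt)
  then show "norm b \<le> norm (a, b, c)" "norm c \<le> norm (a, b, c)" by linarith+
qed (simp add: norm_Pair real_le_rsqrt)

text \<open>The linear system satisfied by \<open>(y\<^sup>2/w, y y'/w, y'\<^sup>2/w)\<close> when \<open>y\<close> solves
  \<open>y'' + c1 y' + c2 y = 0\<close> and \<open>w\<close> is a Wronskian, \<open>w' = - c1 w\<close>.\<close>

definition symmetric_square_system ::
  "(complex \<Rightarrow> complex) \<Rightarrow> (complex \<Rightarrow> complex) \<Rightarrow> (complex \<Rightarrow> complex) \<Rightarrow> (complex \<Rightarrow> complex)
   \<Rightarrow> (complex \<Rightarrow> complex) \<Rightarrow> complex \<Rightarrow> bool" where
  "symmetric_square_system c1 c2 v p s t \<longleftrightarrow>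
     (v has_field_derivative 2 * p t + c1 t * v t) (at t) \<and>
     (p has_field_derivative s t - c2 t * v t) (at t) \<and>
     (s has_field_derivative - c1 t * s t - 2 * c2 t * p t) (at t)"

lemma analytic_bounded_near:
  assumes "g analytic_on {0::complex}"
  obtains M where "M \<ge> 0" "\<forall>\<^sub>F t in at 0. norm (g t) \<le> M"
proof -
  have "isCont g 0" using assms by (rule analytic_at_imp_isCont)
  then have "(g \<longlongrightarrow> g 0) (at 0)" by (simp add: isCont_def)
  then have "\<forall>\<^sub>F t in at 0. norm (g t - g 0) < 1"
    by (auto dest: tendstoD[of _ _ _ 1] simp: dist_norm)
  then have "\<forall>\<^sub>F t in at 0. norm (g t) \<le> norm (g 0) + 1"
    by eventually_elim (use norm_triangle_ineq2 in smt)
  then show thesis by (intro that[of "norm (g 0) + 1"]) auto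
qed

lemma pole_order_leE:
  assumes "pole_order_le k c"
  obtains g M where "M \<ge> 0" "\<forall>\<^sub>F t in at 0. c t = g t / t ^ k \<and> norm (g t) \<le> M"
proof -
  obtain g where g: "g analytic_on {0}" "\<forall>\<^sub>F t in at 0. c t = g t / t ^ k"
    using assms unfolding pole_order_le_def by blast
  obtain M where "M \<ge> 0" "\<forall>\<^sub>F t in at 0. norm (g t) \<le> M"
    using analytic_bounded_near[OF g(1)] .
  then show thesis using g(2) by (intro that[of M g]) (auto elim: eventually_elim2)
qed

lemma eventually_at_0_punctured_disc:
  assumes "\<forall>\<^sub>F t in at (0::complex). P t"
  obtains R where "0 < R" "\<And>t. 0 < norm t \<Longrightarrow> norm t \<le> R \<Longrightarrow> P t"
proof -
  obtain d where d: "d > 0" "\<And>t. t \<noteq> 0 \<Longrightarrow> dist t 0 < d \<Longrightarrow> P t"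
    using assms unfolding eventually_at by auto
  show thesis by (rule that[of "d / 2"]) (use d in auto)
qed

text \<open>Meant for infinity when it is an ordinary point. The coefficients are controlled only
  off \<open>t = 0\<close>, so boundedness comes from the radial estimate and not from a value at
  the centre.\<close>

lemma ordinary_system_bounded:
  assumes "pole_order_le 0 c1" "pole_order_le 0 c2"
    and sys: "\<forall>\<^sub>F t in at 0. symmetric_square_system c1 c2 v p s t"
  obtains C where "\<forall>\<^sub>F t in at 0. norm (v t) \<le> C"
proof -
  obtain g1 M1 where M1: "M1 \<ge> 0" "\<forall>\<^sub>F t in at 0. c1 t = g1 t / t ^ 0 \<and> norm (g1 t) \<le> M1"
    using pole_order_leE[OF assms(1)] .
  obtain g2 M2 where M2: "M2 \<ge> 0" "\<forall>\<^sub>F t in at 0. c2 t = g2 t / t ^ 0 \<and> norm (g2 t) \<le> M2"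
    using pole_order_leE[OF assms(2)] .
  have "\<forall>\<^sub>F t in at 0. symmetric_square_system c1 c2 v p s t \<and> norm (c1 t) \<le> M1 \<and> norm (c2 t) \<le> M2"
    using sys M1(2) M2(2) by eventually_elim auto
  then obtain R where R: "0 < R" "\<And>t. 0 < norm t \<Longrightarrow> norm t \<le> R \<Longrightarrow>
      symmetric_square_system c1 c2 v p s t \<and> norm (c1 t) \<le> M1 \<and> norm (c2 t) \<le> M2"
    using eventually_at_0_punctured_disc by blast
  \<comment> \<open>The sum of the bounds of the three rows, \<open>2 + M1\<close>,
    \<open>1 + M2\<close> and \<open>M1 + 2 * M2\<close>.\<close>
  define K where "K = 3 + 2 * M1 + 3 * M2"
  have "\<exists>C. \<forall>t. 0 < norm t \<and> norm t \<le> R \<longrightarrow> exp (K * norm t) * norm (v t) \<le> C"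
  proof (rule radial_growth_bound[where k = "\<lambda>_. K", OF R(1)])
    fix t :: complex assume t: "0 < norm t" "norm t \<le> R"
    let ?n = "norm (v t, p t, s t)"
    note n = norm_triple_ge(1)[of "v t" "p t" "s t"] norm_triple_ge(2)[of "p t" "v t" "s t"]
      norm_triple_ge(3)[of "s t" "v t" "p t"]
    have c: "norm (c1 t * y) \<le> M1 * ?n" "norm (c2 t * y) \<le> M2 * ?n" if "norm y \<le> ?n" for y
      using R(2)[OF t] that M1(1) M2(1) by (auto simp: norm_mult intro!: mult_mono)
    have "norm (2 * p t + c1 t * v t) \<le> 2 * ?n + M1 * ?n"
      using norm_triangle_ineq[of "2 * p t" "c1 t * v t"] c(1)[OF n(1)] n(2) by (simp add: norm_mult)
    moreover have "norm (s t - c2 t * v t) \<le> ?n + M2 * ?n"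
      using norm_triangle_ineq4[of "s t" "c2 t * v t"] c(2)[OF n(1)] n(3) by simp
    moreover have "norm (- c1 t * s t - 2 * c2 t * p t) \<le> M1 * ?n + 2 * (M2 * ?n)"
      using norm_triangle_ineq4[of "- c1 t * s t" "2 * c2 t * p t"] c(1)[OF n(3)] c(2)[OF n(2)]
      by (simp add: norm_mult)
    ultimately show "norm (2 * p t + c1 t * v t, s t - c2 t * v t, - c1 t * s t - 2 * c2 t * p t)
        \<le> K * ?n"
      using norm_triple_le[of "2 * p t + c1 t * v t" "s t - c2 t * v t" "- c1 t * s t - 2 * c2 t * p t"]
      by (simp add: K_def algebra_simps)
  next
    show "((\<lambda>r. exp (K * r)) has_real_derivative K * exp (K * r)) (at r)" for r
      by (auto intro!: derivative_eq_intros)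
  qed (use R(2) in \<open>auto simp: symmetric_square_system_def\<close>)
  then obtain C where C: "\<And>t. 0 < norm t \<Longrightarrow> norm t \<le> R \<Longrightarrow> exp (K * norm t) * norm (v t) \<le> C"
    by blast
  have "K \<ge> 0" using M1(1) M2(1) by (simp add: K_def)
  have "norm (v t) \<le> C" if "0 < norm t" "norm t \<le> R" for t
  proof -
    have "1 * norm (v t) \<le> exp (K * norm t) * norm (v t)"
      using \<open>K \<ge> 0\<close> by (intro mult_right_mono) auto
    then show ?thesis using C[OF that] by linarith
  qed
  then have "\<forall>\<^sub>F t in at 0. norm (v t) \<le> C"
    unfolding eventually_at using R(1) by (intro exI[of _ R]) auto
  then show thesis by (rule that)
qed

text \<open>Passing to \<open>(v, t p, t^2 s)\<close> absorbs the poles of order 1 and 2 and leaves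
  a system \<open>t x' = A x\<close> with bounded \<open>A\<close>. The norm then grows at most like
  a power of \<open>1 / norm t\<close> towards the point.\<close>

lemma fuchsian_system_moderate_growth:
  assumes "pole_order_le 1 c1" "pole_order_le 2 c2"
    and sys: "\<forall>\<^sub>F t in at 0. symmetric_square_system c1 c2 v p s t"
  obtains C N where "\<forall>\<^sub>F t in at 0. norm (t ^ N * v t) \<le> C"
proof -
  obtain g1 M1 where M1: "M1 \<ge> 0" "\<forall>\<^sub>F t in at 0. c1 t = g1 t / t ^ 1 \<and> norm (g1 t) \<le> M1"
    using pole_order_leE[OF assms(1)] .
  obtain g2 M2 where M2: "M2 \<ge> 0" "\<forall>\<^sub>F t in at 0. c2 t = g2 t / t ^ 2 \<and> norm (g2 t) \<le> M2"
    using pole_order_leE[OF assms(2)] .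
  have "\<forall>\<^sub>F t in at 0. symmetric_square_system c1 c2 v p s t \<and> c1 t = g1 t / t \<and> c2 t = g2 t / t ^ 2
      \<and> norm (g1 t) \<le> M1 \<and> norm (g2 t) \<le> M2"
    using sys M1(2) M2(2) by eventually_elim auto
  then obtain R where R: "0 < R" "\<And>t. 0 < norm t \<Longrightarrow> norm t \<le> R \<Longrightarrow>
      symmetric_square_system c1 c2 v p s t \<and> c1 t = g1 t / t \<and> c2 t = g2 t / t ^ 2
      \<and> norm (g1 t) \<le> M1 \<and> norm (g2 t) \<le> M2"
    using eventually_at_0_punctured_disc by blast
  \<comment> \<open>The three rows contribute \<open>2 + M1\<close>, \<open>2 + M2\<close> and
    \<open>2 + M1 + 2 * M2\<close>; rounding up makes the weight an integral power, so that
    \<open>t ^ N * v t\<close> is again single-valued.\<close>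
  define N where "N = nat \<lceil>6 + 2 * M1 + 3 * M2\<rceil>"
  have N: "6 + 2 * M1 + 3 * M2 \<le> real N" unfolding N_def by linarith
  \<comment> \<open>\<open>X\<close>, \<open>Y\<close>, \<open>Z\<close> are the derivatives of
    \<open>v\<close>, \<open>t p\<close>, \<open>t^2 s\<close> with the factor \<open>1 / t\<close>
    pulled out; the numerators are combinations of these three functions with bounded
    coefficients.\<close>
  define X where "X = (\<lambda>t. (2 * (t * p t) + g1 t * v t) / t)"
  define Y where "Y = (\<lambda>t. (t * p t + t ^ 2 * s t - g2 t * v t) / t)"
  define Z where "Z = (\<lambda>t. (2 * (t ^ 2 * s t) - g1 t * (t ^ 2 * s t) - 2 * (g2 t * (t * p t))) / t)"
  have "\<exists>C. \<forall>t. 0 < norm t \<and> norm t \<le> R \<longrightarrow> norm t ^ N * norm (v t) \<le> C"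
  proof (rule radial_growth_bound[where k = "\<lambda>r. real N / r" and Y = "\<lambda>t. t * p t" and Z = "\<lambda>t. t ^ 2 * s t"
        and X' = X and Y' = Y and Z' = Z, OF R(1)])
    fix t :: complex assume t: "0 < norm t" "norm t \<le> R"
    then have t0: "t \<noteq> 0" by auto
    note Rt = R(2)[OF t]
    have dv: "(v has_field_derivative 2 * p t + c1 t * v t) (at t)"
      and dp: "(p has_field_derivative s t - c2 t * v t) (at t)"
      and ds: "(s has_field_derivative - c1 t * s t - 2 * c2 t * p t) (at t)"
      using Rt by (auto simp: symmetric_square_system_def)
    have "2 * p t + c1 t * v t = X t" using Rt t0 by (simp add: X_def field_simps)
    then show "(v has_field_derivative X t) (at t)" using dv by simp
    have "((\<lambda>t. t * p t) has_field_derivative t * (s t - c2 t * v t) + p t) (at t)"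
      by (auto intro!: derivative_eq_intros dp)
    moreover have "t * (s t - c2 t * v t) + p t = Y t"
      using Rt t0 by (simp add: Y_def field_simps power2_eq_square)
    ultimately show "((\<lambda>t. t * p t) has_field_derivative Y t) (at t)" by simp
    have "((\<lambda>t. t ^ 2 * s t) has_field_derivative t ^ 2 * (- c1 t * s t - 2 * c2 t * p t) + 2 * t * s t) (at t)"
      by (auto intro!: derivative_eq_intros ds)
    moreover have "t ^ 2 * (- c1 t * s t - 2 * c2 t * p t) + 2 * t * s t = Z t"
      using t0 by (simp add: conjunct1[OF conjunct2[OF Rt]]
          conjunct1[OF conjunct2[OF conjunct2[OF Rt]]] Z_def field_simps power2_eq_square)
    ultimately show "((\<lambda>t. t ^ 2 * s t) has_field_derivative Z t) (at t)" by simp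
    let ?n = "norm (v t, t * p t, t ^ 2 * s t)"
    note n = norm_triple_ge(1)[of "v t" "t * p t" "t ^ 2 * s t"]
      norm_triple_ge(2)[of "t * p t" "v t" "t ^ 2 * s t"]
      norm_triple_ge(3)[of "t ^ 2 * s t" "v t" "t * p t"]
    have c: "norm (g1 t * y) \<le> M1 * ?n" "norm (g2 t * y) \<le> M2 * ?n" if "norm y \<le> ?n" for y
      using Rt that M1(1) M2(1) by (auto simp: norm_mult intro!: mult_mono)
    have "norm (2 * (t * p t) + g1 t * v t) \<le> 2 * ?n + M1 * ?n"
      using norm_triangle_ineq[of "2 * (t * p t)" "g1 t * v t"] c(1)[OF n(1)] n(2)
      by (simp add: norm_mult)
    moreover have "norm (t * p t + t ^ 2 * s t - g2 t * v t) \<le> 2 * ?n + M2 * ?n"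
      using norm_triangle_ineq4[of "t * p t + t ^ 2 * s t" "g2 t * v t"]
        norm_triangle_ineq[of "t * p t" "t ^ 2 * s t"] c(2)[OF n(1)] n(2,3) by linarith
    moreover have "norm (2 * (t ^ 2 * s t) - g1 t * (t ^ 2 * s t) - 2 * (g2 t * (t * p t)))
        \<le> 2 * ?n + M1 * ?n + 2 * (M2 * ?n)"
    proof -
      have "norm (2 * (t ^ 2 * s t)) \<le> 2 * ?n" "norm (2 * (g2 t * (t * p t))) \<le> 2 * (M2 * ?n)"
        using n(3) c(2)[OF n(2)] unfolding norm_mult[of 2] by simp_all
      then show ?thesis
        using norm_triangle_ineq4[of "2 * (t ^ 2 * s t) - g1 t * (t ^ 2 * s t)" "2 * (g2 t * (t * p t))"]
          norm_triangle_ineq4[of "2 * (t ^ 2 * s t)" "g1 t * (t ^ 2 * s t)"] c(1)[OF n(3)] by linarith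
    qed
    ultimately have "norm (X t) * norm t + norm (Y t) * norm t + norm (Z t) * norm t
        \<le> (6 + 2 * M1 + 3 * M2) * ?n"
      using t0 by (simp add: X_def Y_def Z_def norm_divide algebra_simps)
    also have "\<dots> \<le> real N * ?n" using N by (intro mult_right_mono) auto
    finally have "norm (X t) + norm (Y t) + norm (Z t) \<le> real N * ?n / norm t"
      using t by (simp add: pos_le_divide_eq algebra_simps)
    then show "norm (X t, Y t, Z t) \<le> real N / norm t * ?n"
      using norm_triple_le[of "X t" "Y t" "Z t"] by simp
  next
    fix r :: real assume r: "0 < r"
    have "((\<lambda>r. r ^ N) has_real_derivative real N * r ^ (N - 1)) (at r)"
      by (auto intro!: derivative_eq_intros)
    moreover have "real N * r ^ (N - 1) = real N / r * r ^ N"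
      using r by (cases N) auto
    ultimately show "((\<lambda>r. r ^ N) has_real_derivative real N / r * r ^ N) (at r)" by (simp only:)
  qed auto
  then obtain C where C: "\<And>t. 0 < norm t \<Longrightarrow> norm t \<le> R \<Longrightarrow> norm t ^ N * norm (v t) \<le> C"
    by blast
  have "\<forall>\<^sub>F t in at 0. norm (t ^ N * v t) \<le> C"
    unfolding eventually_at using R(1) C by (intro exI[of _ R]) (auto simp: norm_mult norm_power)
  then show thesis by (rule that)
qed

section \<open>Isolated singularities of moderate growth\<close>

text \<open>Moderate growth excludes an essential singularity. Unless \<open>V\<close> tends to
  zero, \<open>1 / V\<close> has a finite limit, namely \<open>0\<close> at a pole of
  \<open>V\<close> and \<open>1 / l\<close> at a nonzero limit \<open>l\<close>. It then extends
  holomorphically over the centre and has a primitive on a full disc, so no logarithm can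
  occur.\<close>

lemma vanishes_or_reciprocal_primitive:
  fixes V :: "complex \<Rightarrow> complex"
  assumes growth: "\<forall>\<^sub>F t in at 0. norm (t ^ N * V t) \<le> C"
    and diff: "\<forall>\<^sub>F t in at 0. V field_differentiable at t"
  shows "(V \<longlongrightarrow> 0) (at 0) \<or>
    (\<exists>r>0. \<exists>H. \<forall>t\<in>ball 0 r - {0}.
       V t \<noteq> 0 \<and> (H has_field_derivative 1 / V t) (at t))"
proof -
  obtain R where R: "0 < R" "\<And>t. 0 < norm t \<Longrightarrow> norm t \<le> R \<Longrightarrow> V field_differentiable at t"
    using eventually_at_0_punctured_disc[OF diff] by metis
  have holV: "V holomorphic_on ball 0 R - {0}"
    by (rule holomorphic_onI, rule field_differentiable_at_within, rule R(2)) auto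
  have anaV: "V analytic_on ball 0 R - {0}"
    using holV by (subst analytic_on_open) auto
  have isoV: "isolated_singularity_at V 0"
    using R(1) anaV unfolding isolated_singularity_at_def by blast
  \<comment> \<open>One power more than in the bound turns boundedness into convergence; afterwards
    the power is divided off again.\<close>
  have "((\<lambda>t. t ^ Suc N * V t) \<longlongrightarrow> 0) (at 0)"
  proof (rule Lim_null_comparison)
    show "\<forall>\<^sub>F t in at 0. norm (t ^ Suc N * V t) \<le> norm t * C"
      using growth by eventually_elim (auto simp: norm_mult mult.assoc intro!: mult_left_mono)
    show "((\<lambda>t::complex. norm t * C) \<longlongrightarrow> 0) (at 0)"
      by (auto intro!: tendsto_eq_intros)
  qed
  then have ne: "not_essential (\<lambda>t. t ^ Suc N * V t) 0" by blast
  have "(\<lambda>t. t ^ Suc N * V t) analytic_on ball 0 R - {0}"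
    by (intro analytic_intros anaV)
  then have iso: "isolated_singularity_at (\<lambda>t. t ^ Suc N * V t) 0"
    using R(1) unfolding isolated_singularity_at_def by blast
  have "not_essential (\<lambda>t. t ^ Suc N * V t / t ^ Suc N) 0"
    by (intro not_essential_divide ne iso not_essential_analytic isolated_singularity_at_analytic analytic_intros)
  moreover have "\<forall>\<^sub>F t in at 0. t ^ Suc N * V t / t ^ Suc N = V t"
    by (auto simp: eventually_at_filter)
  ultimately have "not_essential V 0" using not_essential_cong[OF _ refl] by fast
  moreover {
    fix l assume l: "((\<lambda>t. 1 / V t) \<longlongrightarrow> l) (at 0)" and nz: "\<forall>\<^sub>F t in at 0. V t \<noteq> 0"
    obtain r where r: "0 < r" "\<And>t. 0 < norm t \<Longrightarrow> norm t \<le> r \<Longrightarrow> V t \<noteq> 0"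
      using eventually_at_0_punctured_disc[OF nz] by metis
    let ?B = "ball 0 (min r R)"
    \<comment> \<open>The value \<open>l\<close> at the centre fills the removable singularity of
      \<open>1 / V\<close>.\<close>
    let ?u = "\<lambda>t. if t = 0 then l else 1 / V t"
    have "(\<lambda>t. 1 / V t) holomorphic_on ?B - {0}"
      using r by (intro holomorphic_intros holomorphic_on_subset[OF holV]) auto
    then have "?u holomorphic_on ?B"
      using l by (intro removable_singularity) auto
    then obtain H where H: "\<And>t. t \<in> ?B \<Longrightarrow> (H has_field_derivative ?u t) (at t within ?B)"
      using holomorphic_convex_primitive'[of ?B ?u] by auto
    have H': "(H has_field_derivative ?u t) (at t)" if "t \<in> ?B" for t
      using H[OF that] at_within_open[OF that open_ball] by simp
    have "V t \<noteq> 0 \<and> (H has_field_derivative 1 / V t) (at t)" if "t \<in> ?B - {0}" for t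
      using that r(2)[of t] H'[of t] by auto
    moreover have "min r R > 0" using r R by simp
    ultimately have "\<exists>r>0. \<exists>H. \<forall>t\<in>ball 0 r - {0}.
       V t \<noteq> 0 \<and> (H has_field_derivative 1 / V t) (at t)"
      by blast
  }
  note case_B = this
  moreover have ?thesis if l: "(V \<longlongrightarrow> l) (at 0)" for l
  proof (cases "l = 0")
    case False
    then have "((\<lambda>t. 1 / V t) \<longlongrightarrow> 1 / l) (at 0)"
      by (intro tendsto_intros l)
    moreover have "\<forall>\<^sub>F t in at 0. V t \<noteq> 0"
      using l False by (rule tendsto_imp_eventually_ne)
    ultimately show ?thesis using case_B by blast
  qed (use l in simp)
  moreover have ?thesis if pole: "is_pole V 0"
  proof -
    have "((\<lambda>t. inverse (V t)) \<longlongrightarrow> 0) (at 0)"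
      using pole unfolding is_pole_def by (rule filterlim_compose[OF tendsto_inverse_0])
    then show ?thesis
      using case_B[of 0] non_zero_neighbour_pole[OF pole] by (simp add: inverse_eq_divide)
  qed
  ultimately show ?thesis unfolding not_essential_def by blast
qed

section \<open>The fundamental group\<close>

text \<open>The homotopy is taken between straight paths in the unit interval and carried over by
  \<open>p\<close> itself, viewed as a continuous map on \<open>{0..1}\<close>. The argument thus
  works in any topological space.\<close>

lemma homotopic_paths_const_left:
  fixes p :: "real \<Rightarrow> 'a::topological_space"
  assumes "path p" "path_image p \<subseteq> S"
  shows "homotopic_paths S ((\<lambda>_. pathstart p) +++ p) p"
proof -
  have "homotopic_paths {0..1} (linepath 0 (0::real) +++ linepath 0 1) (linepath 0 1)"
    using homotopic_paths_lid[of "linepath 0 (1::real)" "{0..1}"]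
    by (simp add: closed_segment_eq_real_ivl)
  then have "homotopic_paths S (p \<circ> (linepath 0 0 +++ linepath 0 1)) (p \<circ> linepath 0 1)"
    by (rule homotopic_paths_continuous_image) (use assms in \<open>auto simp: path_def path_image_def\<close>)
  moreover have "p \<circ> linepath 0 1 = p"
    by (simp add: linepath_def o_def)
  moreover have "p \<circ> (linepath 0 0 +++ linepath 0 1) = (\<lambda>_. pathstart p) +++ p"
    by (auto simp: joinpaths_def linepath_def pathstart_def)
  ultimately show ?thesis by simp
qed

lemma homotopic_paths_reversepath_left:
  fixes p :: "real \<Rightarrow> 'a::topological_space"
  assumes "path p" "path_image p \<subseteq> S"
  shows "homotopic_paths S (reversepath p +++ p) (\<lambda>_. pathfinish p)"
proof -
  have "homotopic_paths {0..1} (reversepath (linepath 0 1) +++ linepath 0 1) (linepath 1 (1::real))"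
    using homotopic_paths_linv[of "linepath 0 (1::real)" "{0..1}"]
    by (simp add: closed_segment_eq_real_ivl)
  then have "homotopic_paths S (p \<circ> (reversepath (linepath 0 1) +++ linepath 0 1)) (p \<circ> linepath 1 1)"
    by (rule homotopic_paths_continuous_image) (use assms in \<open>auto simp: path_def path_image_def\<close>)
  moreover have "p \<circ> linepath 1 1 = (\<lambda>_. pathfinish p)"
    by (simp add: linepath_def o_def pathfinish_def)
  moreover have "p \<circ> (reversepath (linepath 0 1) +++ linepath 0 1) = reversepath p +++ p"
    by (auto simp: joinpaths_def linepath_def reversepath_def)
  ultimately show ?thesis by simp
qed

lemma loop_class_eq:
  assumes "homotopic_paths S p q"
  shows "loop_class S p = loop_class S q"
proof (rule Set.set_eqI)
  fix r
  show "r \<in> loop_class S p \<longleftrightarrow> r \<in> loop_class S q"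
    unfolding loop_class_def mem_Collect_eq
    by (intro iffI; erule homotopic_paths_trans[rotated]) (simp_all add: assms homotopic_paths_sym)
qed

lemma loops_at_join: "p \<in> loops_at S x \<Longrightarrow> q \<in> loops_at S x \<Longrightarrow> p +++ q \<in> loops_at S x"
  by (simp add: loops_at_def path_image_join)

lemma loops_at_reversepath: "p \<in> loops_at S x \<Longrightarrow> reversepath p \<in> loops_at S x"
  by (simp add: loops_at_def)

text \<open>All representatives yield the same class, so the union in the definition of the product
  is taken over a constant family.\<close>

lemma loop_class_mult:
  assumes "p \<in> loops_at S x" "q \<in> loops_at S x"
  shows "loop_class S p \<otimes>\<^bsub>fundamental_group S x\<^esub> loop_class S q = loop_class S (p +++ q)"
proof -
  have "loop_class S (p' +++ q') = loop_class S (p +++ q)"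
    if "p' \<in> loop_class S p" "q' \<in> loop_class S q" for p' q'
  proof -
    have "homotopic_paths S (p +++ q) (p' +++ q')"
      using that assms by (intro homotopic_paths_join) (auto simp: loop_class_def loops_at_def)
    then show ?thesis by (simp add: loop_class_eq)
  qed
  moreover have p: "p \<in> loop_class S p" and q: "q \<in> loop_class S q"
    using assms by (auto simp: loop_class_def loops_at_def)
  ultimately have "(\<Union>p'\<in>loop_class S p. \<Union>q'\<in>loop_class S q. loop_class S (p' +++ q'))
      = loop_class S (p +++ q)"
    by (intro UN_constant_eq[OF p] UN_constant_eq[OF q] ballI)
  then show ?thesis by (simp add: fundamental_group_def)
qed

lemma group_fundamental_group:
  fixes x :: "'a::topological_space"
  assumes "x \<in> S"
  shows "group (fundamental_group S x)"
proof (rule groupI)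
  let ?P = "fundamental_group S x"
  have carrier: "carrier ?P = loop_class S ` loops_at S x"
    and one: "\<one>\<^bsub>?P\<^esub> = loop_class S (\<lambda>_. x)"
    by (simp_all add: fundamental_group_def)
  have const: "(\<lambda>_. x) \<in> loops_at S x"
    using assms by (auto simp: loops_at_def path_def path_image_def pathstart_def pathfinish_def)
  show "\<one>\<^bsub>?P\<^esub> \<in> carrier ?P"
    unfolding carrier one using const by simp
  fix A assume "A \<in> carrier ?P"
  then obtain p where p: "A = loop_class S p" "p \<in> loops_at S x"
    unfolding carrier by auto
  have p': "path p" "path_image p \<subseteq> S" "pathstart p = x" "pathfinish p = x"
    using p(2) by (auto simp: loops_at_def)
  show "\<one>\<^bsub>?P\<^esub> \<otimes>\<^bsub>?P\<^esub> A = A"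
    using homotopic_paths_const_left[OF p'(1,2)] p'
    by (simp add: p(1) one loop_class_mult[OF const p(2)] loop_class_eq)
  show "\<exists>B\<in>carrier ?P. B \<otimes>\<^bsub>?P\<^esub> A = \<one>\<^bsub>?P\<^esub>"
  proof (rule bexI)
    show "loop_class S (reversepath p) \<otimes>\<^bsub>?P\<^esub> A = \<one>\<^bsub>?P\<^esub>"
      using homotopic_paths_reversepath_left[OF p'(1,2)] p'
      by (simp add: p(1) one loop_class_mult[OF loops_at_reversepath[OF p(2)] p(2)] loop_class_eq)
    show "loop_class S (reversepath p) \<in> carrier ?P"
      unfolding carrier using loops_at_reversepath[OF p(2)] by blast
  qed
  fix B assume "B \<in> carrier ?P"
  then obtain q where q: "B = loop_class S q" "q \<in> loops_at S x"
    unfolding carrier by auto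
  show "A \<otimes>\<^bsub>?P\<^esub> B \<in> carrier ?P"
    unfolding p(1) q(1) loop_class_mult[OF p(2) q(2)] carrier
    using loops_at_join[OF p(2) q(2)] by blast
  fix C assume "C \<in> carrier ?P"
  then obtain r where r: "C = loop_class S r" "r \<in> loops_at S x"
    unfolding carrier by auto
  have "homotopic_paths S (p +++ (q +++ r)) ((p +++ q) +++ r)"
    using p(2) q(2) r(2) by (intro homotopic_paths_assoc) (auto simp: loops_at_def)
  then show "A \<otimes>\<^bsub>?P\<^esub> B \<otimes>\<^bsub>?P\<^esub> C = A \<otimes>\<^bsub>?P\<^esub> (B \<otimes>\<^bsub>?P\<^esub> C)"
    unfolding p(1) q(1) r(1)
    by (simp add: loop_class_mult loops_at_join p(2) q(2) r(2) loop_class_eq)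
qed

lemma group_GL2: "group GL2"
proof (rule groupI)
  have one: "invertible (mat 1 :: complex ^ 2 ^ 2)"
    unfolding invertible_def by (intro exI[of _ "mat 1"]) simp
  then show "\<one>\<^bsub>GL2\<^esub> \<in> carrier GL2" by (simp add: GL2_def)
  fix A assume "A \<in> carrier GL2"
  then have A: "invertible A" by (simp add: GL2_def)
  then obtain B where B: "A ** B = mat 1" "B ** A = mat 1" unfolding invertible_def by metis
  then have "invertible B" unfolding invertible_def by metis
  with B show "\<exists>B\<in>carrier GL2. B \<otimes>\<^bsub>GL2\<^esub> A = \<one>\<^bsub>GL2\<^esub>" by (auto simp: GL2_def)
  show "\<one>\<^bsub>GL2\<^esub> \<otimes>\<^bsub>GL2\<^esub> A = A" by (simp add: GL2_def)
  fix B assume "B \<in> carrier GL2"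
  then show "A \<otimes>\<^bsub>GL2\<^esub> B \<in> carrier GL2" using A by (simp add: GL2_def invertible_mult)
  fix C assume "C \<in> carrier GL2"
  show "A \<otimes>\<^bsub>GL2\<^esub> B \<otimes>\<^bsub>GL2\<^esub> C = A \<otimes>\<^bsub>GL2\<^esub> (B \<otimes>\<^bsub>GL2\<^esub> C)"
    by (simp add: GL2_def matrix_mul_assoc)
qed

text \<open>The circle of radius \<open>r\<close> and its detour through the radius \<open>e\<close> are the images under \<open>exp\<close>
  of two paths with common endpoints in a half-plane.\<close>

lemma homotopic_circlepath_smaller:
  assumes "0 < e" "e \<le> r" "sph a ` (cball 0 r - {0}) \<subseteq> S"
  obtains \<sigma> where "path \<sigma>" "path_image \<sigma> \<subseteq> S"
    "pathstart \<sigma> = sph a (of_real r)" "pathfinish \<sigma> = sph a (of_real e)"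
    "homotopic_paths S (sph a \<circ> circlepath 0 r) (\<sigma> +++ (sph a \<circ> circlepath 0 e) +++ reversepath \<sigma>)"
proof -
  define T where "T = {z. Re z \<le> ln r}"
  define f where "f = sph a \<circ> exp"
  define c where "c = 2 * of_real pi * \<i>"
  let ?r = "complex_of_real (ln r)" and ?e = "complex_of_real (ln e)"
  define l1 where "l1 = linepath ?r ?e"
  define l2 where "l2 = linepath ?e (?e + c)"
  define l3 where "l3 = linepath (?e + c) (?r + c)"
  have r: "0 < r" using assms by linarith
  have conv: "convex T" unfolding T_def by (rule convex_halfspace_Re_le)
  have "f ` T \<subseteq> S"
  proof -
    have "norm (exp z) \<le> r" if "Re z \<le> ln r" for z
      using that r by (metis exp_le_cancel_iff exp_ln norm_exp_eq_Re)
    then have "exp ` T \<subseteq> cball 0 r - {0}" by (auto simp: T_def)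
    then show ?thesis using assms(3) unfolding f_def image_comp[symmetric] by blast
  qed
  have contf: "continuous_on T f" unfolding f_def
    by (intro continuous_on_compose continuous_on_sph continuous_intros)
  have inT: "?r \<in> T" "?e \<in> T" "?r + c \<in> T" "?e + c \<in> T"
    using assms by (auto simp: T_def c_def)
  have ends: "pathfinish l1 = pathstart l2" "pathfinish l2 = pathstart l3"
    by (simp_all add: l1_def l2_def l3_def)
  have paths: "path l1" "path l2" "path l3" by (simp_all add: l1_def l2_def l3_def)
  have im: "path_image l1 \<subseteq> T" "path_image l2 \<subseteq> T" "path_image l3 \<subseteq> T"
    using inT conv by (simp_all add: l1_def l2_def l3_def closed_segment_subset)
  let ?q = "l1 +++ l2 +++ l3"
  have q: "path ?q" "path_image ?q \<subseteq> T"
    using ends paths im by (auto simp: path_image_join)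
  have "homotopic_paths T (linepath ?r (?r + c)) ?q"
  proof (rule homotopic_paths_linear)
    fix t :: real assume t: "t \<in> {0..1}"
    have "linepath ?r (?r + c) t \<in> T"
      using t closed_segment_subset[OF inT(1,3) conv] linepath_in_path[OF t] by blast
    moreover have "?q t \<in> T" using q(2) t by (auto simp: path_image_def)
    ultimately show "closed_segment (linepath ?r (?r + c) t) (?q t) \<subseteq> T"
      by (intro closed_segment_subset conv)
  qed (use q in \<open>auto simp: l1_def l2_def l3_def\<close>)
  then have "homotopic_paths S (f \<circ> linepath ?r (?r + c)) (f \<circ> ?q)"
    by (rule homotopic_paths_continuous_image) (use contf \<open>f ` T \<subseteq> S\<close> in auto)
  moreover have circ: "f \<circ> linepath (of_real (ln x)) (of_real (ln x) + c) = sph a \<circ> circlepath 0 x"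
    if "0 < x" for x
  proof
    fix t
    have "linepath (of_real (ln x)) (of_real (ln x) + c) t = of_real (ln x) + c * of_real t"
      by (simp add: linepath_def algebra_simps scaleR_conv_of_real)
    then have "exp (linepath (of_real (ln x)) (of_real (ln x) + c) t) = of_real x * exp (c * of_real t)"
      using that by (simp add: exp_add exp_of_real flip: of_real_exp)
    then show "(f \<circ> linepath (of_real (ln x)) (of_real (ln x) + c)) t = (sph a \<circ> circlepath 0 x) t"
      by (simp add: f_def circlepath c_def)
  qed
  \<comment> \<open>\<open>l3\<close> is \<open>l1\<close> reversed and shifted by \<open>c\<close>,
    a period of \<open>exp\<close>.\<close>
  moreover have "f \<circ> l3 = reversepath (f \<circ> l1)"
  proof
    fix t
    have "l3 t = reversepath l1 t + c"
      by (simp add: l1_def l3_def linepath_def reversepath_def algebra_simps)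
    moreover have "exp c = 1" unfolding c_def by (rule exp_two_pi_i)
    ultimately have "exp (l3 t) = exp (reversepath l1 t)" by (simp only: exp_add mult_1_right)
    then show "(f \<circ> l3) t = reversepath (f \<circ> l1) t" by (simp add: f_def reversepath_def)
  qed
  moreover have "f \<circ> ?q = (f \<circ> l1) +++ (f \<circ> l2) +++ (f \<circ> l3)"
    by (simp add: path_compose_join)
  ultimately have hom: "homotopic_paths S (sph a \<circ> circlepath 0 r)
      ((f \<circ> l1) +++ (sph a \<circ> circlepath 0 e) +++ reversepath (f \<circ> l1))"
    unfolding l2_def by (simp only: circ[OF r] circ[OF assms(1)])
  have p: "path (f \<circ> l1)"
    using paths im contf by (intro path_continuous_image) (auto intro: continuous_on_subset)
  have i: "path_image (f \<circ> l1) \<subseteq> S"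
    using im(1) \<open>f ` T \<subseteq> S\<close> by (auto simp: path_image_compose)
  have "exp (of_real (ln r)) = complex_of_real r" "exp (of_real (ln e)) = complex_of_real e"
    using r assms(1) by (simp_all add: exp_of_real)
  then have "pathstart (f \<circ> l1) = sph a (of_real r)" "pathfinish (f \<circ> l1) = sph a (of_real e)"
    by (simp_all add: pathstart_compose pathfinish_compose f_def l1_def)
  from that[OF p i this hom] show thesis .
qed

text \<open>Pure reassociation. The target has the circle \<open>c\<close> isolated between one path
  and its reverse, which is the shape needed to split a continuation at the two ends of
  \<open>c\<close>.\<close>

lemma homotopic_paths_conjugate_detour:
  fixes \<delta> \<sigma> c :: "real \<Rightarrow> 'a::topological_space"
  assumes paths: "path \<delta>" "path \<sigma>" "path c"
    and im: "path_image \<delta> \<subseteq> S" "path_image \<sigma> \<subseteq> S" "path_image c \<subseteq> S"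
    and ends: "pathfinish \<delta> = pathstart \<sigma>" "pathfinish \<sigma> = pathstart c" "pathfinish c = pathstart c"
  shows "homotopic_paths S (\<delta> +++ (\<sigma> +++ c +++ reversepath \<sigma>) +++ reversepath \<delta>)
    (((\<delta> +++ \<sigma>) +++ c) +++ reversepath (\<delta> +++ \<sigma>))"
proof -
  let ?r = "reversepath \<sigma> +++ reversepath \<delta>"
  note simps = paths im ends path_image_join
  have "homotopic_paths S ((\<sigma> +++ c +++ reversepath \<sigma>) +++ reversepath \<delta>)
      (\<sigma> +++ (c +++ reversepath \<sigma>) +++ reversepath \<delta>)"
    by (rule homotopic_paths_sym[OF homotopic_paths_assoc]) (simp_all add: simps)
  also have "homotopic_paths S \<dots> (\<sigma> +++ c +++ ?r)"
    by (intro homotopic_paths_join homotopic_paths_sym[OF homotopic_paths_assoc])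
       (simp_all add: simps)
  finally have "homotopic_paths S (\<delta> +++ (\<sigma> +++ c +++ reversepath \<sigma>) +++ reversepath \<delta>)
      (\<delta> +++ \<sigma> +++ c +++ ?r)"
    by (rule_tac homotopic_paths_join) (simp_all add: simps)
  also have "homotopic_paths S \<dots> ((\<delta> +++ \<sigma>) +++ c +++ ?r)"
    by (rule homotopic_paths_assoc) (simp_all add: simps)
  also have "homotopic_paths S \<dots> (((\<delta> +++ \<sigma>) +++ c) +++ ?r)"
    by (rule homotopic_paths_assoc) (simp_all add: simps)
  finally show ?thesis by (simp add: reversepath_joinpaths ends)
qed

section \<open>Single-valuedness of the vector field\<close>

lemma isCont_eventually_nonzero:
  fixes f :: "complex \<Rightarrow> complex"
  assumes "isCont f z" "f z \<noteq> 0"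
  shows "\<forall>\<^sub>F w in nhds z. f w \<noteq> 0"
proof -
  have "\<forall>\<^sub>F w in at z. f w \<noteq> 0"
    using assms(1)[unfolded isCont_def] assms(2) by (rule tendsto_imp_eventually_ne)
  with assms(2) show ?thesis by (simp add: eventually_nhds_conv_at)
qed

lemma local_solution_germ_analytic: "local_solution b1 b2 p f \<Longrightarrow> germ_analytic p f"
  by (simp add: local_solution_def germ_analytic_def)

lemma local_solution_cong:
  assumes "germ_eq p f g" "local_solution b1 b2 p f"
  shows "local_solution b1 b2 p g"
proof -
  let ?f = "\<lambda>t. f (sph p t)" and ?g = "\<lambda>t. g (sph p t)"
  have ev: "\<forall>\<^sub>F t in nhds 0. ?f t = ?g t"
    using assms(1) unfolding germ_eq_def eventually_nhds_sphere[of _ p] .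
  \<comment> \<open>One nested neighbourhood is consumed by each of the two
    differentiations.\<close>
  have "\<forall>\<^sub>F t in nhds 0. \<forall>\<^sub>F s in nhds t. \<forall>\<^sub>F u in nhds s. ?f u = ?g u"
    using ev by (simp add: eventually_eventually)
  then have "\<forall>\<^sub>F t in nhds 0. ?f t = ?g t \<and> deriv ?f t = deriv ?g t \<and>
      deriv (deriv ?f) t = deriv (deriv ?g) t"
  proof eventually_elim
    case (elim t)
    have 1: "\<forall>\<^sub>F s in nhds t. deriv ?f s = deriv ?g s"
      using elim by (rule eventually_mono) (rule deriv_cong_ev, auto)
    have 2: "\<forall>\<^sub>F s in nhds t. ?f s = ?g s"
      using elim by (subst (asm) eventually_eventually)
    from 1 2 show ?case by (auto dest: eventually_nhds_x_imp_x intro: deriv_cong_ev)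
  qed
  then have "\<forall>\<^sub>F t in at 0. ?f t = ?g t \<and> deriv ?f t = deriv ?g t \<and>
      deriv (deriv ?f) t = deriv (deriv ?g) t"
    by (rule eventually_nhds_conv_at[THEN iffD1, THEN conjunct1])
  moreover have "\<forall>\<^sub>F t in at 0. deriv (deriv ?f) t + coord_coeff1 b1 p t * deriv ?f t
        + coord_coeff2 b2 p t * ?f t = 0"
    using assms(2) unfolding local_solution_def by (rule conjunct2)
  ultimately have "\<forall>\<^sub>F t in at 0. deriv (deriv ?g) t + coord_coeff1 b1 p t * deriv ?g t
        + coord_coeff2 b2 p t * ?g t = 0"
    by eventually_elim simp
  moreover have "?g analytic_on {0}"
    using germ_analytic_cong[OF assms(1)] local_solution_germ_analytic[OF assms(2)]
    by (simp add: germ_analytic_def)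
  ultimately show ?thesis unfolding local_solution_def by blast
qed

lemma deriv_translate: "deriv (\<lambda>t. f (z + t)) = (\<lambda>t. deriv f (z + t :: 'a::real_normed_field))"
  unfolding deriv_def by (simp add: DERIV_shift add.commute[of z])

text \<open>\<open>local_solution\<close> asserts the equation only off the centre; where the
  coefficients are continuous, both sides pass to the limit.\<close>

lemma local_solution_at_point:
  assumes sol: "local_solution b1 b2 (Fin_pt z) f" and "isCont b1 z" "isCont b2 z"
  defines "F \<equiv> \<lambda>w. f (Fin_pt w)"
  shows "deriv (deriv F) z + b1 z * deriv F z + b2 z * F z = 0"
proof -
  have anaF: "F analytic_on {z}"
    using local_solution_germ_analytic[OF sol] by (simp add: germ_analytic_Fin_pt_iff F_def)
  then have ana: "deriv F analytic_on {z}" "deriv (deriv F) analytic_on {z}"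
    by (auto intro: analytic_deriv)
  have "\<forall>\<^sub>F t in at 0. deriv (deriv F) (z + t) + b1 (z + t) * deriv F (z + t) + b2 (z + t) * F (z + t) = 0"
    using sol unfolding local_solution_def
    by (simp add: deriv_translate[of "\<lambda>w. f (Fin_pt w)"] deriv_translate[of "deriv (\<lambda>w. f (Fin_pt w))"] F_def)
  then have ev: "\<forall>\<^sub>F w in at z. deriv (deriv F) w + b1 w * deriv F w + b2 w * F w = 0"
    by (simp only: eventually_at_to_0[of _ z] add.commute[of _ z])
  have "isCont (\<lambda>w. deriv (deriv F) w + b1 w * deriv F w + b2 w * F w) z"
    by (intro continuous_intros assms(2,3) analytic_at_imp_isCont[OF anaF]
        analytic_at_imp_isCont[OF ana(1)] analytic_at_imp_isCont[OF ana(2)])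
  then have "((\<lambda>w. deriv (deriv F) w + b1 w * deriv F w + b2 w * F w) \<longlongrightarrow>
      deriv (deriv F) z + b1 z * deriv F z + b2 z * F z) (at z)"
    by (simp add: isCont_def)
  moreover have "((\<lambda>w. deriv (deriv F) w + b1 w * deriv F w + b2 w * F w) \<longlongrightarrow> 0) (at z)"
    using ev by (rule tendsto_eventually)
  ultimately show ?thesis by (rule tendsto_unique[rotated]) simp
qed

section \<open>Branches of the pair of solutions and their Wronskian\<close>

definition wronskian :: "(riemann_sphere \<Rightarrow> complex) \<Rightarrow> (riemann_sphere \<Rightarrow> complex) \<Rightarrow> complex \<Rightarrow> complex" where
  "wronskian f g z = f (Fin_pt z) * deriv (\<lambda>w. g (Fin_pt w)) z - deriv (\<lambda>w. f (Fin_pt w)) z * g (Fin_pt z)"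

text \<open>The situation of a reducible monodromy none of whose local monodromies is diagonalizable.\<close>

locale unipotent_pair =
  fixes D :: "riemann_sphere set" and x0 :: riemann_sphere
    and b1 b2 :: "complex \<Rightarrow> complex" and \<eta>1 \<eta>2 :: "riemann_sphere \<Rightarrow> complex"
  assumes finD: "finite D" and x0: "x0 \<notin> D"
    and hol_b1: "b1 holomorphic_on {z. Fin_pt z \<notin> D}"
    and hol_b2: "b2 holomorphic_on {z. Fin_pt z \<notin> D}"
    and continuation_exists: "\<And>\<delta>. path \<delta> \<Longrightarrow> path_image \<delta> \<subseteq> - D \<Longrightarrow> pathstart \<delta> = x0 \<Longrightarrow>
        \<exists>f1 f2. continues \<delta> \<eta>1 f1 \<and> continues \<delta> \<eta>2 f2 \<and>
          local_solution b1 b2 (pathfinish \<delta>) f1 \<and> local_solution b1 b2 (pathfinish \<delta>) f2"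
    and loop_monodromy: "\<And>\<gamma>. \<gamma> \<in> loops_at (- D) x0 \<Longrightarrow>
        \<exists>l b. l \<noteq> 0 \<and> continues \<gamma> \<eta>1 (\<lambda>q. l * \<eta>1 q) \<and> continues \<gamma> \<eta>2 (\<lambda>q. l * \<eta>2 q + b * \<eta>1 q)"
    and independent: "\<And>c1 c2. germ_eq x0 (\<lambda>q. c1 * \<eta>1 q + c2 * \<eta>2 q) (\<lambda>_. 0) \<Longrightarrow> c1 = 0 \<and> c2 = 0"
begin

text \<open>Both germs are continued along the same path, so that two branches at one point differ
  by the monodromy of a single loop.\<close>

definition branch :: "complex \<Rightarrow> (riemann_sphere \<Rightarrow> complex) \<Rightarrow> (riemann_sphere \<Rightarrow> complex) \<Rightarrow> bool" where
  "branch z f1 f2 \<longleftrightarrow>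
     (\<exists>\<delta>. path \<delta> \<and> path_image \<delta> \<subseteq> - D \<and> pathstart \<delta> = x0 \<and> pathfinish \<delta> = Fin_pt z \<and>
        continues \<delta> \<eta>1 f1 \<and> continues \<delta> \<eta>2 f2)"

lemma branchE:
  assumes "branch z f1 f2"
  obtains \<delta> where "path \<delta>" "path_image \<delta> \<subseteq> - D" "pathstart \<delta> = x0" "pathfinish \<delta> = Fin_pt z"
    "continues \<delta> \<eta>1 f1" "continues \<delta> \<eta>2 f2"
  using assms unfolding branch_def by metis

lemma branch_exists:
  assumes "Fin_pt z \<notin> D"
  obtains f1 f2 where "branch z f1 f2"
proof -
  obtain \<delta> where \<delta>: "path \<delta>" "path_image \<delta> \<subseteq> - D" "pathstart \<delta> = x0" "pathfinish \<delta> = Fin_pt z"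
    using path_to_finite_point[OF finD x0 assms] by metis
  from continuation_exists[OF \<delta>(1-3)] obtain f1 f2 where
    "continues \<delta> \<eta>1 f1" "continues \<delta> \<eta>2 f2" by metis
  with \<delta> have "branch z f1 f2" unfolding branch_def by metis
  then show thesis by (rule that)
qed

lemma branch_notin: "branch z f1 f2 \<Longrightarrow> Fin_pt z \<notin> D"
  by (metis ComplD branchE pathfinish_in_path_image subsetD)

lemma branch_local_solution:
  assumes "branch z f1 f2"
  shows "local_solution b1 b2 (Fin_pt z) f1" "local_solution b1 b2 (Fin_pt z) f2"
proof -
  obtain \<delta> where \<delta>: "path \<delta>" "path_image \<delta> \<subseteq> - D" "pathstart \<delta> = x0" "pathfinish \<delta> = Fin_pt z"
    "continues \<delta> \<eta>1 f1" "continues \<delta> \<eta>2 f2"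
    using branchE[OF assms] .
  from continuation_exists[OF \<delta>(1-3)] obtain g1 g2 where
    g: "continues \<delta> \<eta>1 g1" "continues \<delta> \<eta>2 g2"
      "local_solution b1 b2 (Fin_pt z) g1" "local_solution b1 b2 (Fin_pt z) g2"
    using \<delta>(4) by metis
  have "germ_eq (Fin_pt z) g1 f1" "germ_eq (Fin_pt z) g2 f2"
    using continues_unique[OF g(1) \<delta>(5,1)] continues_unique[OF g(2) \<delta>(6,1)] \<delta>(4) by simp_all
  then show "local_solution b1 b2 (Fin_pt z) f1" "local_solution b1 b2 (Fin_pt z) f2"
    using g(3,4) local_solution_cong by metis+
qed

text \<open>A linear relation between the continued germs is carried back to \<open>x0\<close> along
  the reversed path.\<close>

lemma branch_independent:
  assumes "branch z f1 f2" "germ_eq (Fin_pt z) (\<lambda>q. c1 * f1 q + c2 * f2 q) (\<lambda>_. 0)"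
  shows "c1 = 0" "c2 = 0"
proof -
  obtain \<delta> where \<delta>: "path \<delta>" "path_image \<delta> \<subseteq> - D" "pathstart \<delta> = x0" "pathfinish \<delta> = Fin_pt z"
    "continues \<delta> \<eta>1 f1" "continues \<delta> \<eta>2 f2"
    using branchE[OF assms(1)] .
  have "germ_eq (pathfinish (reversepath \<delta>)) (\<lambda>q. c1 * \<eta>1 q + c2 * \<eta>2 q) (\<lambda>_. 0)"
    by (rule continues_zero[OF continues_reversepath[OF continues_combine[OF \<delta>(5,6)]]])
       (use \<delta> assms(2) in simp_all)
  then show "c1 = 0" "c2 = 0" using independent[of c1 c2] \<delta>(3) by simp_all
qed

text \<open>Going out along the first path and back along the second is a loop, whose monodromy is
  known. Splitting the continuation at \<open>z\<close> and undoing the return compares the two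
  branches.\<close>

lemma branch_related:
  assumes "branch z f1 f2" "branch z g1 g2"
  obtains l b where "l \<noteq> 0" "germ_eq (Fin_pt z) f1 (\<lambda>q. l * g1 q)"
    "germ_eq (Fin_pt z) f2 (\<lambda>q. l * g2 q + b * g1 q)"
proof -
  obtain \<delta> where \<delta>: "path \<delta>" "path_image \<delta> \<subseteq> - D" "pathstart \<delta> = x0" "pathfinish \<delta> = Fin_pt z"
    "continues \<delta> \<eta>1 f1" "continues \<delta> \<eta>2 f2"
    using branchE[OF assms(1)] .
  obtain \<epsilon> where \<epsilon>: "path \<epsilon>" "path_image \<epsilon> \<subseteq> - D" "pathstart \<epsilon> = x0" "pathfinish \<epsilon> = Fin_pt z"
    "continues \<epsilon> \<eta>1 g1" "continues \<epsilon> \<eta>2 g2"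
    using branchE[OF assms(2)] .
  have ends: "pathfinish \<delta> = pathstart (reversepath \<epsilon>)" using \<delta> \<epsilon> by simp
  have "\<delta> +++ reversepath \<epsilon> \<in> loops_at (- D) x0"
    using \<delta>(1-4) \<epsilon>(1-4) by (simp add: loops_at_def path_image_join)
  then obtain l b where l: "l \<noteq> 0" and
    1: "continues (\<delta> +++ reversepath \<epsilon>) \<eta>1 (\<lambda>q. l * \<eta>1 q)" and
    2: "continues (\<delta> +++ reversepath \<epsilon>) \<eta>2 (\<lambda>q. l * \<eta>2 q + b * \<eta>1 q)"
    using loop_monodromy by metis
  obtain h1 where h1: "continues \<delta> \<eta>1 h1" "continues (reversepath \<epsilon>) h1 (\<lambda>q. l * \<eta>1 q)"
    using continues_joinpaths_split[OF 1 ends] .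
  obtain h2 where h2: "continues \<delta> \<eta>2 h2" "continues (reversepath \<epsilon>) h2 (\<lambda>q. l * \<eta>2 q + b * \<eta>1 q)"
    using continues_joinpaths_split[OF 2 ends] .
  have "germ_eq (Fin_pt z) f1 h1"
    using continues_unique[OF \<delta>(5) h1(1) \<delta>(1)] \<delta>(4) by simp
  also have "germ_eq (Fin_pt z) h1 (\<lambda>q. l * g1 q)"
    using continues_unique[OF continues_reversepath[OF h1(2)], of "\<lambda>q. l * \<eta>1 q" "\<lambda>q. l * g1 q"]
      continues_scale[OF \<epsilon>(5), of l] \<epsilon>(1,4) by simp
  finally have r1: "germ_eq (Fin_pt z) f1 (\<lambda>q. l * g1 q)" .
  have "germ_eq (Fin_pt z) f2 h2"
    using continues_unique[OF \<delta>(6) h2(1) \<delta>(1)] \<delta>(4) by simp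
  also have "germ_eq (Fin_pt z) h2 (\<lambda>q. l * g2 q + b * g1 q)"
    using continues_unique[OF continues_reversepath[OF h2(2)], of "\<lambda>q. l * \<eta>2 q + b * \<eta>1 q" "\<lambda>q. l * g2 q + b * g1 q"]
      continues_combine[OF \<epsilon>(6,5), of l b] \<epsilon>(1,4) by simp
  finally show thesis using that l r1 by metis
qed

text \<open>The path is prolonged by a short segment inside a disc on which \<open>f1\<close> and
  \<open>f2\<close> are holomorphic, so the same two functions represent the germs there. This lets
  formulas in terms of a branch be differentiated.\<close>

lemma branch_nearby:
  assumes "branch z f1 f2"
  shows "\<forall>\<^sub>F w in nhds z. branch w f1 f2"
proof -
  obtain \<delta> where \<delta>: "path \<delta>" "path_image \<delta> \<subseteq> - D" "pathstart \<delta> = x0" "pathfinish \<delta> = Fin_pt z"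
    "continues \<delta> \<eta>1 f1" "continues \<delta> \<eta>2 f2"
    using branchE[OF assms] .
  have "(\<lambda>w. f1 (Fin_pt w)) analytic_on {z}" "(\<lambda>w. f2 (Fin_pt w)) analytic_on {z}"
    using branch_local_solution[OF assms, THEN local_solution_germ_analytic]
    by (simp_all add: germ_analytic_Fin_pt_iff)
  then obtain e1 e2 where e: "e1 > 0" "(\<lambda>w. f1 (Fin_pt w)) holomorphic_on ball z e1"
    "e2 > 0" "(\<lambda>w. f2 (Fin_pt w)) holomorphic_on ball z e2"
    unfolding analytic_at_ball by metis
  obtain e3 where e3: "e3 > 0" "ball z e3 \<subseteq> {z. Fin_pt z \<notin> D}"
    using open_contains_ball[of "{z. Fin_pt z \<notin> D}"] open_finite_points[OF finD] branch_notin[OF assms]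
    by (metis mem_Collect_eq)
  define B where "B = ball z e1 \<inter> ball z e2 \<inter> ball z e3"
  have an: "germ_analytic (Fin_pt w) f1" "germ_analytic (Fin_pt w) f2" if "w \<in> B" for w
    unfolding germ_analytic_Fin_pt_iff analytic_at using that e(2,4)
    unfolding B_def by (metis IntE open_ball)+
  have "branch w f1 f2" if w: "w \<in> B" for w
  proof -
    let ?s = "Fin_pt \<circ> linepath z w"
    have seg: "closed_segment z w \<subseteq> B"
      using w e(1,3) e3(1) by (intro closed_segment_subset) (auto simp: B_def convex_Int)
    have s: "path ?s" "path_image ?s \<subseteq> - D" "pathstart ?s = Fin_pt z" "pathfinish ?s = Fin_pt w"
      using seg e3 path_continuous_image[OF path_linepath continuous_on_Fin_pt]
      by (auto simp: path_image_compose pathstart_compose pathfinish_compose B_def)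
    have const: "continues ?s f1 f1" "continues ?s f2 f2"
      using an[OF subsetD[OF seg]] by (auto intro!: continues_const simp: path_image_compose)
    have ends: "pathfinish \<delta> = pathstart ?s" using \<delta> s by simp
    have p: "path (\<delta> +++ ?s)" "path_image (\<delta> +++ ?s) \<subseteq> - D" "pathstart (\<delta> +++ ?s) = x0"
      "pathfinish (\<delta> +++ ?s) = Fin_pt w"
      using \<delta>(1-4) s by (simp_all add: path_image_join)
    from continuation_exists[OF p(1-3)] obtain g1 g2 where
      g: "continues (\<delta> +++ ?s) \<eta>1 g1" "continues (\<delta> +++ ?s) \<eta>2 g2" by metis
    \<comment> \<open>\<open>continuation_exists\<close> supplies some continuation along the
      prolonged path; splitting it at \<open>z\<close> and applying uniqueness on both parts
      identifies its end germ.\<close>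
    have end_eq: "germ_eq (Fin_pt w) g f"
      if g: "continues (\<delta> +++ ?s) \<eta> g" and f: "continues \<delta> \<eta> f" "continues ?s f f" for \<eta> g f
    proof -
      obtain h where h: "continues \<delta> \<eta> h" "continues ?s h g"
        using continues_joinpaths_split[OF g ends] .
      have "germ_eq (Fin_pt z) h f" using continues_unique[OF h(1) f(1) \<delta>(1)] \<delta>(4) by simp
      then show ?thesis using continues_unique[OF h(2) f(2) s(1)] s by simp
    qed
    have "continues (\<delta> +++ ?s) \<eta>1 f1" "continues (\<delta> +++ ?s) \<eta>2 f2"
      using end_eq[OF g(1) \<delta>(5) const(1)] end_eq[OF g(2) \<delta>(6) const(2)] p(4)
        continues_cong[OF g(1) germ_eq_refl] continues_cong[OF g(2) germ_eq_refl] by simp_all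
    then show ?thesis unfolding branch_def using p by metis
  qed
  moreover have "\<forall>\<^sub>F w in nhds z. w \<in> B"
    using e(1,3) e3(1) by (intro eventually_nhds_in_open) (auto simp: B_def)
  ultimately show ?thesis by (auto elim: eventually_mono)
qed

lemma branch_ball:
  assumes "branch z f1 f2"
  obtains r where "r > 0" "\<And>w. w \<in> ball z r \<Longrightarrow> branch w f1 f2"
    "(\<lambda>w. f1 (Fin_pt w)) holomorphic_on ball z r" "(\<lambda>w. f2 (Fin_pt w)) holomorphic_on ball z r"
proof -
  obtain r where r: "r > 0" "\<And>w. w \<in> ball z r \<Longrightarrow> branch w f1 f2"
    using branch_nearby[OF assms] unfolding eventually_nhds_metric by (auto simp: dist_commute)
  have "(\<lambda>w. f (Fin_pt w)) holomorphic_on ball z r"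
    if "\<And>w. w \<in> ball z r \<Longrightarrow> local_solution b1 b2 (Fin_pt w) f" for f
  proof (rule analytic_imp_holomorphic)
    show "(\<lambda>w. f (Fin_pt w)) analytic_on ball z r"
      using that[THEN local_solution_germ_analytic]
      by (subst analytic_on_analytic_at) (simp add: germ_analytic_Fin_pt_iff)
  qed
  from that[OF r this this] show thesis using branch_local_solution r(2) by metis
qed

lemma isCont_coefficients:
  assumes "Fin_pt z \<notin> D"
  shows "isCont b1 z" "isCont b2 z"
  using hol_b1 hol_b2 assms open_finite_points[OF finD]
  by (auto dest!: holomorphic_on_imp_continuous_on simp: continuous_on_eq_continuous_at)

lemma branch_ode:
  assumes "branch z f1 f2"
  shows "deriv (deriv (\<lambda>w. f1 (Fin_pt w))) z = - b1 z * deriv (\<lambda>w. f1 (Fin_pt w)) z - b2 z * f1 (Fin_pt z)"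
    and "deriv (deriv (\<lambda>w. f2 (Fin_pt w))) z = - b1 z * deriv (\<lambda>w. f2 (Fin_pt w)) z - b2 z * f2 (Fin_pt z)"
  using branch_local_solution[OF assms, THEN local_solution_at_point] isCont_coefficients[OF branch_notin[OF assms]]
  by (simp_all add: algebra_simps eq_neg_iff_add_eq_0)

lemma branch_derivs:
  assumes "branch z f1 f2"
  shows "((\<lambda>w. f1 (Fin_pt w)) has_field_derivative deriv (\<lambda>w. f1 (Fin_pt w)) z) (at z)"
    and "((\<lambda>w. f2 (Fin_pt w)) has_field_derivative deriv (\<lambda>w. f2 (Fin_pt w)) z) (at z)"
    and "(deriv (\<lambda>w. f1 (Fin_pt w)) has_field_derivative
           - b1 z * deriv (\<lambda>w. f1 (Fin_pt w)) z - b2 z * f1 (Fin_pt z)) (at z)"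
    and "(deriv (\<lambda>w. f2 (Fin_pt w)) has_field_derivative
           - b1 z * deriv (\<lambda>w. f2 (Fin_pt w)) z - b2 z * f2 (Fin_pt z)) (at z)"
    and "(wronskian f1 f2 has_field_derivative - b1 z * wronskian f1 f2 z) (at z)"
proof -
  let ?F = "\<lambda>w. f1 (Fin_pt w)" and ?G = "\<lambda>w. f2 (Fin_pt w)"
  obtain r where r: "r > 0" "?F holomorphic_on ball z r" "?G holomorphic_on ball z r"
    using branch_ball[OF assms] by metis
  have z: "z \<in> ball z r" using r by simp
  note hd = holomorphic_derivI[OF _ open_ball z]
  show F: "(?F has_field_derivative deriv ?F z) (at z)" and G: "(?G has_field_derivative deriv ?G z) (at z)"
    using r by (auto intro: hd)
  have "(deriv ?F has_field_derivative deriv (deriv ?F) z) (at z)"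
    "(deriv ?G has_field_derivative deriv (deriv ?G) z) (at z)"
    using r by (auto intro!: hd holomorphic_deriv)
  then show F': "(deriv ?F has_field_derivative - b1 z * deriv ?F z - b2 z * ?F z) (at z)"
    and G': "(deriv ?G has_field_derivative - b1 z * deriv ?G z - b2 z * ?G z) (at z)"
    by (simp_all add: branch_ode[OF assms])
  \<comment> \<open>Abel's identity: the \<open>b2\<close> terms cancel.\<close>
  have "((\<lambda>w. ?F w * deriv ?G w - deriv ?F w * ?G w) has_field_derivative
      - b1 z * (?F z * deriv ?G z - deriv ?F z * ?G z)) (at z)"
    by (auto intro!: derivative_eq_intros F G F' G' simp: algebra_simps)
  then show "(wronskian f1 f2 has_field_derivative - b1 z * wronskian f1 f2 z) (at z)"
    unfolding wronskian_def .
qed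

lemma branch_not_zero:
  assumes "branch z f1 f2"
  shows "\<not> (\<forall>\<^sub>F w in nhds z. f1 (Fin_pt w) = 0)"
proof
  assume "\<forall>\<^sub>F w in nhds z. f1 (Fin_pt w) = 0"
  then have "germ_eq (Fin_pt z) (\<lambda>q. 1 * f1 q + 0 * f2 q) (\<lambda>_. 0)"
    by (simp add: germ_eq_def eventually_nhds_Fin_pt)
  from branch_independent(1)[OF assms this] show False by simp
qed

lemma quotient_derivative:
  assumes "branch z f1 f2" "f1 (Fin_pt z) \<noteq> 0"
  shows "((\<lambda>w. f2 (Fin_pt w) / f1 (Fin_pt w)) has_field_derivative
     wronskian f1 f2 z / (f1 (Fin_pt z))\<^sup>2) (at z)"
  by (rule derivative_eq_intros branch_derivs[OF assms(1)] assms(2) refl)+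
     (use assms(2) in \<open>simp add: wronskian_def power2_eq_square field_simps\<close>)

text \<open>With a primitive \<open>P\<close> of \<open>b1\<close>, the product of the Wronskian and
  \<open>exp P\<close> is constant, so one zero makes the Wronskian vanish on a disc. The quotient
  of the two solutions is then locally constant, against independence.\<close>

lemma wronskian_nonzero:
  assumes br: "branch z f1 f2"
  shows "wronskian f1 f2 z \<noteq> 0"
proof
  assume W0: "wronskian f1 f2 z = 0"
  let ?F = "\<lambda>w. f1 (Fin_pt w)" and ?G = "\<lambda>w. f2 (Fin_pt w)"
  obtain r where r: "r > 0" "\<And>w. w \<in> ball z r \<Longrightarrow> branch w f1 f2"
    "?F holomorphic_on ball z r"
    using branch_ball[OF br] by metis
  have "b1 holomorphic_on ball z r"
    by (rule holomorphic_on_subset[OF hol_b1]) (use branch_notin[OF r(2)] in auto)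
  then obtain P where P: "\<And>w. w \<in> ball z r \<Longrightarrow> (P has_field_derivative b1 w) (at w within ball z r)"
    using holomorphic_convex_primitive'[OF convex_ball open_ball] by metis
  have "((\<lambda>w. wronskian f1 f2 w * exp (P w)) has_field_derivative 0) (at w within ball z r)"
    if w: "w \<in> ball z r" for w
    using branch_derivs(5)[OF r(2)[OF w], THEN has_field_derivative_at_within, of "ball z r"] P[OF w]
    by (auto intro!: derivative_eq_intros simp: algebra_simps)
  then have "\<exists>c. \<forall>w\<in>ball z r. wronskian f1 f2 w * exp (P w) = c"
    by (intro has_field_derivative_zero_constant) auto
  then have W: "wronskian f1 f2 w = 0" if "w \<in> ball z r" for w
    using that r(1) W0 by (metis centre_in_ball exp_not_eq_zero mult_eq_0_iff)
  have "\<exists>w\<in>ball z r. ?F w \<noteq> 0"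
  proof (rule ccontr)
    assume "\<not> (\<exists>w\<in>ball z r. ?F w \<noteq> 0)"
    then have "\<forall>\<^sub>F w in nhds z. ?F w = 0"
      using r(1) unfolding eventually_nhds by (intro exI[of _ "ball z r"]) auto
    then show False using branch_not_zero[OF br] by simp
  qed
  \<comment> \<open>\<open>f1\<close> may vanish at \<open>z\<close> itself, so the quotient is
    formed near another point of the disc.\<close>
  then obtain w where w: "w \<in> ball z r" "?F w \<noteq> 0" by blast
  have "isCont ?F w"
    using branch_derivs(1)[OF r(2)[OF w(1)]] by (rule DERIV_isCont)
  then have "\<forall>\<^sub>F u in nhds w. ?F u \<noteq> 0"
    using w(2) by (rule isCont_eventually_nonzero)
  then obtain e where e: "e > 0" "\<And>u. u \<in> ball w e \<Longrightarrow> ?F u \<noteq> 0"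
    unfolding eventually_nhds_metric by (auto simp: dist_commute)
  obtain d where d: "d > 0" "ball w d \<subseteq> ball z r"
    using w(1) open_contains_ball[of "ball z r"] open_ball by metis
  let ?B = "ball w (min d e)"
  have "((\<lambda>u. ?G u / ?F u) has_field_derivative 0) (at u within ?B)" if u: "u \<in> ?B" for u
  proof -
    have "u \<in> ball z r" "?F u \<noteq> 0" using u d(2) e(2)[of u] by auto
    with quotient_derivative[OF r(2), of u] W[of u] show ?thesis
      by (auto intro: has_field_derivative_at_within)
  qed
  then obtain c where c: "\<And>u. u \<in> ?B \<Longrightarrow> ?G u / ?F u = c"
    using has_field_derivative_zero_constant[of ?B "\<lambda>u. ?G u / ?F u"] by auto
  have "(- c) * ?F u + 1 * ?G u = 0" if "u \<in> ?B" for u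
    using c[OF that] e(2)[of u] that by (auto simp: field_simps)
  then have "\<forall>\<^sub>F u in nhds w. (- c) * ?F u + 1 * ?G u = 0"
    unfolding eventually_nhds using d(1) e(1) by (intro exI[of _ ?B]) auto
  then have "germ_eq (Fin_pt w) (\<lambda>q. (- c) * f1 q + 1 * f2 q) (\<lambda>_. 0)"
    by (simp add: germ_eq_def eventually_nhds_Fin_pt)
  from branch_independent(2)[OF r(2)[OF w(1)] this] show False by simp
qed

section \<open>The single-valued quadratic expressions\<close>

definition squares :: "(riemann_sphere \<Rightarrow> complex) \<Rightarrow> (riemann_sphere \<Rightarrow> complex) \<Rightarrow> complex \<Rightarrow> complex \<times> complex \<times> complex" where
  "squares f1 f2 z = (let y = f1 (Fin_pt z); y' = deriv (\<lambda>w. f1 (Fin_pt w)) z; W = wronskian f1 f2 z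
     in (y\<^sup>2 / W, y * y' / W, y'\<^sup>2 / W))"

definition global_squares :: "complex \<Rightarrow> complex \<times> complex \<times> complex" where
  "global_squares z = (SOME T. \<exists>f1 f2. branch z f1 f2 \<and> T = squares f1 f2 z)"

text \<open>Passing to another branch multiplies \<open>f1\<close> and its derivative by
  \<open>l\<close> and the Wronskian by \<open>l^2\<close>, since a multiple of \<open>g1\<close>
  added to the second solution does not affect it. The three factors \<open>l^2\<close> cancel,
  which makes the choice in \<open>global_squares\<close> harmless.\<close>

lemma squares_unique:
  assumes "branch z f1 f2" "branch z g1 g2"
  shows "squares f1 f2 z = squares g1 g2 z"
proof -
  obtain l b where l: "l \<noteq> 0" and ev: "\<forall>\<^sub>F w in nhds z. f1 (Fin_pt w) = l * g1 (Fin_pt w)"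
    "\<forall>\<^sub>F w in nhds z. f2 (Fin_pt w) = l * g2 (Fin_pt w) + b * g1 (Fin_pt w)"
    using branch_related[OF assms] unfolding germ_eq_def eventually_nhds_Fin_pt by metis
  note d = branch_derivs(1,2)[OF assms(2)]
  have v: "f1 (Fin_pt z) = l * g1 (Fin_pt z)" "f2 (Fin_pt z) = l * g2 (Fin_pt z) + b * g1 (Fin_pt z)"
    using ev[THEN eventually_nhds_x_imp_x] by auto
  have d1: "deriv (\<lambda>w. f1 (Fin_pt w)) z = l * deriv (\<lambda>w. g1 (Fin_pt w)) z"
    using ev(1) d by (subst deriv_cong_ev[OF ev(1) refl]) (auto intro!: DERIV_imp_deriv derivative_eq_intros)
  have d2: "deriv (\<lambda>w. f2 (Fin_pt w)) z = l * deriv (\<lambda>w. g2 (Fin_pt w)) z + b * deriv (\<lambda>w. g1 (Fin_pt w)) z"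
    using d by (subst deriv_cong_ev[OF ev(2) refl]) (auto intro!: DERIV_imp_deriv derivative_eq_intros)
  have "wronskian f1 f2 z = l\<^sup>2 * wronskian g1 g2 z"
    by (simp add: wronskian_def v d1 d2 power2_eq_square algebra_simps)
  then show ?thesis
    using l by (simp add: squares_def Let_def v(1) d1 power2_eq_square)
qed

lemma global_squares_eq:
  assumes "branch z f1 f2"
  shows "global_squares z = squares f1 f2 z"
  unfolding global_squares_def
  by (rule some_equality) (use assms squares_unique in metis)+

definition vf :: "complex \<Rightarrow> complex" where "vf z = fst (global_squares z)"
definition pf :: "complex \<Rightarrow> complex" where "pf z = fst (snd (global_squares z))"
definition sf :: "complex \<Rightarrow> complex" where "sf z = snd (snd (global_squares z))"

lemma vf_eq: "branch z f1 f2 \<Longrightarrow> vf z = (f1 (Fin_pt z))\<^sup>2 / wronskian f1 f2 z"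
  by (simp add: vf_def global_squares_eq squares_def Let_def)

lemma pf_eq: "branch z f1 f2 \<Longrightarrow> pf z = f1 (Fin_pt z) * deriv (\<lambda>w. f1 (Fin_pt w)) z / wronskian f1 f2 z"
  by (simp add: pf_def global_squares_eq squares_def Let_def)

lemma sf_eq: "branch z f1 f2 \<Longrightarrow> sf z = (deriv (\<lambda>w. f1 (Fin_pt w)) z)\<^sup>2 / wronskian f1 f2 z"
  by (simp add: sf_def global_squares_eq squares_def Let_def)

text \<open>Near \<open>z\<close> the three functions are given by one fixed branch, and its
  formulas are differentiated using the equation and Abel's identity.\<close>

lemma system_at_finite_point:
  assumes "Fin_pt z \<notin> D"
  shows "symmetric_square_system b1 b2 vf pf sf z"
proof -
  obtain f1 f2 where br: "branch z f1 f2" using branch_exists[OF assms] .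
  let ?F = "\<lambda>w. f1 (Fin_pt w)" and ?W = "wronskian f1 f2"
  note d = branch_derivs(1,3,5)[OF br] and W = wronskian_nonzero[OF br]
  note eqs = vf_eq[OF br] pf_eq[OF br] sf_eq[OF br]
  note near = branch_nearby[OF br]
  have "((\<lambda>w. (?F w)\<^sup>2 / ?W w) has_field_derivative 2 * pf z + b1 z * vf z) (at z)"
    by (rule derivative_eq_intros d W refl)+
       (use W in \<open>simp add: eqs field_simps power2_eq_square\<close>)
  moreover have "\<forall>\<^sub>F w in nhds z. vf w = (?F w)\<^sup>2 / ?W w"
    using near by eventually_elim (rule vf_eq)
  ultimately have 1: "(vf has_field_derivative 2 * pf z + b1 z * vf z) (at z)"
    using DERIV_cong_ev[OF refl _ refl] by metis
  have "((\<lambda>w. ?F w * deriv ?F w / ?W w) has_field_derivative sf z - b2 z * vf z) (at z)"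
    by (rule derivative_eq_intros d W refl)+
       (use W in \<open>simp add: eqs field_simps power2_eq_square\<close>)
  moreover have "\<forall>\<^sub>F w in nhds z. pf w = ?F w * deriv ?F w / ?W w"
    using near by eventually_elim (rule pf_eq)
  ultimately have 2: "(pf has_field_derivative sf z - b2 z * vf z) (at z)"
    using DERIV_cong_ev[OF refl _ refl] by metis
  have "((\<lambda>w. (deriv ?F w)\<^sup>2 / ?W w) has_field_derivative - b1 z * sf z - 2 * b2 z * pf z) (at z)"
    by (rule derivative_eq_intros d W refl)+
       (use W in \<open>simp add: eqs field_simps power2_eq_square\<close>)
  moreover have "\<forall>\<^sub>F w in nhds z. sf w = (deriv ?F w)\<^sup>2 / ?W w"
    using near by eventually_elim (rule sf_eq)
  ultimately have 3: "(sf has_field_derivative - b1 z * sf z - 2 * b2 z * pf z) (at z)"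
    using DERIV_cong_ev[OF refl _ refl] by metis
  show ?thesis unfolding symmetric_square_system_def using 1 2 3 by blast
qed

lemma vf_not_identically_zero:
  assumes "Fin_pt z \<notin> D"
  shows "\<not> (\<forall>\<^sub>F w in nhds z. vf w = 0)"
proof
  assume "\<forall>\<^sub>F w in nhds z. vf w = 0"
  obtain f1 f2 where br: "branch z f1 f2" using branch_exists[OF assms] .
  from \<open>\<forall>\<^sub>F w in nhds z. vf w = 0\<close> branch_nearby[OF br]
  have "\<forall>\<^sub>F w in nhds z. f1 (Fin_pt w) = 0"
    by eventually_elim (use vf_eq wronskian_nonzero in auto)
  then show False using branch_not_zero[OF br] by simp
qed

end

section \<open>Behaviour at the singular points\<close>

text \<open>For \<open>t = 1/z\<close> the derivative of a solution and the Wronskian are both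
  multiplied by \<open>- 1/t^2\<close>. Hence y^2/w gains the factor \<open>- t^2\<close>, y y'/w
  stays the same and y'^2/w gains \<open>- 1/t^2\<close>.\<close>

lemma symmetric_square_system_at_infinity:
  assumes "symmetric_square_system b1 b2 v p s (1 / t)" "t \<noteq> 0"
  shows "symmetric_square_system (coord_coeff1 b1 Infty) (coord_coeff2 b2 Infty)
    (\<lambda>t. - t\<^sup>2 * v (1 / t)) (\<lambda>t. p (1 / t)) (\<lambda>t. - s (1 / t) / t\<^sup>2) t"
proof -
  have inv: "((\<lambda>t. 1 / t) has_field_derivative - 1 / t\<^sup>2) (at t)"
    using assms(2) by (auto intro!: derivative_eq_intros simp: power2_eq_square)
  have ch: "((\<lambda>t. f (1 / t)) has_field_derivative f' * (- 1 / t\<^sup>2)) (at t)"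
    if "(f has_field_derivative f') (at (1 / t))" for f f'
    using DERIV_chain2[OF that inv] .
  have d: "((\<lambda>t. v (1 / t)) has_field_derivative (2 * p (1 / t) + b1 (1 / t) * v (1 / t)) * (- 1 / t\<^sup>2)) (at t)"
    "((\<lambda>t. p (1 / t)) has_field_derivative (s (1 / t) - b2 (1 / t) * v (1 / t)) * (- 1 / t\<^sup>2)) (at t)"
    "((\<lambda>t. s (1 / t)) has_field_derivative (- b1 (1 / t) * s (1 / t) - 2 * b2 (1 / t) * p (1 / t)) * (- 1 / t\<^sup>2)) (at t)"
    using assms(1) unfolding symmetric_square_system_def by (blast intro: ch)+
  have t2: "t\<^sup>2 \<noteq> 0" using assms(2) by simp
  show ?thesis unfolding symmetric_square_system_def
  proof (intro conjI)
    show "((\<lambda>t. - t\<^sup>2 * v (1 / t)) has_field_derivative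
      2 * p (1 / t) + coord_coeff1 b1 Infty t * (- t\<^sup>2 * v (1 / t))) (at t)"
      by (rule derivative_eq_intros d refl)+
         (use assms(2) in \<open>simp add: field_simps power2_eq_square\<close>)
    show "((\<lambda>t. p (1 / t)) has_field_derivative
      - s (1 / t) / t\<^sup>2 - coord_coeff2 b2 Infty t * (- t\<^sup>2 * v (1 / t))) (at t)"
      by (rule DERIV_cong[OF d(2)])
         (use assms(2) in \<open>simp add: field_simps power2_eq_square power4_eq_xxxx\<close>)
    show "((\<lambda>t. - s (1 / t) / t\<^sup>2) has_field_derivative
      - coord_coeff1 b1 Infty t * (- s (1 / t) / t\<^sup>2) - 2 * coord_coeff2 b2 Infty t * p (1 / t)) (at t)"
      by (rule derivative_eq_intros d refl t2)+
         (use assms(2) in \<open>simp add: field_simps power2_eq_square power4_eq_xxxx\<close>)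
  qed
qed

lemma eventually_sph_notin:
  assumes "finite D"
  shows "\<forall>\<^sub>F t in at 0. sph a t \<notin> D"
proof -
  have "finite (sph a -` D)" using finite_vimageI[OF assms inj_sph] .
  then have "\<forall>\<^sub>F t in at 0. t \<notin> sph a -` D"
    using islimpt_finite[of "sph a -` D" 0] by (auto simp: islimpt_iff_eventually)
  then show ?thesis by simp
qed

text \<open>The vector field \<open>v \<partial>/\<partial>z\<close> in the local coordinate centred at a point.\<close>

fun vector_field_chart :: "(complex \<Rightarrow> complex) \<Rightarrow> riemann_sphere \<Rightarrow> complex \<Rightarrow> complex" where
  "vector_field_chart v (Fin_pt c) t = v (c + t)"
| "vector_field_chart v Infty t = - t\<^sup>2 * v (1 / t)"

context unipotent_pair
begin

abbreviation chart_vf :: "riemann_sphere \<Rightarrow> complex \<Rightarrow> complex" where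
  "chart_vf \<equiv> vector_field_chart vf"

lemma chart_system:
  obtains P S where
    "\<forall>\<^sub>F t in at 0. symmetric_square_system (coord_coeff1 b1 a) (coord_coeff2 b2 a) (chart_vf a) P S t"
proof (cases a)
  case (Fin_pt c)
  have eqs: "chart_vf a = (\<lambda>t. vf (c + t))" "coord_coeff1 b1 a = (\<lambda>t. b1 (c + t))"
    "coord_coeff2 b2 a = (\<lambda>t. b2 (c + t))"
    by (auto simp: Fin_pt)
  have "\<forall>\<^sub>F t in at 0. symmetric_square_system (coord_coeff1 b1 a) (coord_coeff2 b2 a) (chart_vf a)
      (\<lambda>t. pf (c + t)) (\<lambda>t. sf (c + t)) t"
    using eventually_sph_notin[OF finD, of a]
  proof eventually_elim
    case (elim t)
    then have "symmetric_square_system b1 b2 vf pf sf (c + t)"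
      by (intro system_at_finite_point) (simp add: Fin_pt)
    then show ?case
      unfolding symmetric_square_system_def eqs by (simp add: DERIV_shift add.commute[of c])
  qed
  then show thesis by (rule that)
next
  case Infty
  have eqs: "chart_vf a = (\<lambda>t. - t\<^sup>2 * vf (1 / t))" by (auto simp: Infty)
  have "\<forall>\<^sub>F t in at (0::complex). t \<noteq> 0" by (simp add: eventually_at_filter)
  with eventually_sph_notin[OF finD, of a]
  have "\<forall>\<^sub>F t in at 0. symmetric_square_system (coord_coeff1 b1 a) (coord_coeff2 b2 a) (chart_vf a)
      (\<lambda>t. pf (1 / t)) (\<lambda>t. - sf (1 / t) / t\<^sup>2) t"
    unfolding eqs
    unfolding Infty
    by eventually_elim (rule symmetric_square_system_at_infinity system_at_finite_point; simp)+
  then show thesis by (rule that)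
qed

text \<open>The 1-form dual to the vector field is \<open>dz / vf\<close> in the coordinate
  \<open>z\<close> and \<open>dt / chart_vf a\<close> in the local coordinate, so a primitive in one
  coordinate is a primitive in the other. It is transported to a function on the sphere in order to
  multiply germs.\<close>

lemma chart_primitive:
  assumes "\<forall>t\<in>ball 0 r - {0}. chart_vf a t \<noteq> 0 \<and> (H has_field_derivative 1 / chart_vf a t) (at t)"
  obtains h where "\<And>w t. t \<in> ball 0 r - {0} \<Longrightarrow> sph a t = Fin_pt w \<Longrightarrow>
     vf w \<noteq> 0 \<and> ((\<lambda>w. h (Fin_pt w)) has_field_derivative 1 / vf w) (at w)"
proof (cases a)
  case (Fin_pt c)
  \<comment> \<open>The value at \<open>Infty\<close> is a filler: \<open>h\<close> is only
    considered near finite points.\<close>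
  define h where "h = (\<lambda>q. case q of Fin_pt w \<Rightarrow> H (w - c) | Infty \<Rightarrow> 0)"
  show thesis
  proof (rule that[of h])
    fix w t assume t: "t \<in> ball 0 r - {0}" "sph a t = Fin_pt w"
    then have w: "w = c + t" by (simp add: Fin_pt)
    have "vf w \<noteq> 0" "(H has_field_derivative 1 / vf w) (at (w - c))"
      using assms t(1) by (auto simp: w Fin_pt)
    then show "vf w \<noteq> 0 \<and> ((\<lambda>w. h (Fin_pt w)) has_field_derivative 1 / vf w) (at w)"
      using DERIV_shift[of H "1 / vf w" w "- c"] by (simp add: h_def)
  qed
next
  case Infty
  define h where "h = (\<lambda>q. case q of Fin_pt w \<Rightarrow> H (1 / w) | Infty \<Rightarrow> 0)"
  show thesis
  proof (rule that[of h])
    fix w t assume t: "t \<in> ball 0 r - {0}" "sph a t = Fin_pt w"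
    then have w: "w \<noteq> 0" "t = 1 / w" by (auto simp: Infty)
    have "chart_vf a (1 / w) = - vf w / w\<^sup>2"
      using w by (simp add: Infty power_divide)
    moreover from this have "1 / chart_vf a (1 / w) = - w\<^sup>2 / vf w" by simp
    moreover have "chart_vf a (1 / w) \<noteq> 0 \<and> (H has_field_derivative 1 / chart_vf a (1 / w)) (at (1 / w))"
      using assms t(1) w(2) by metis
    ultimately have v: "vf w \<noteq> 0" "(H has_field_derivative - w\<^sup>2 / vf w) (at (1 / w))"
      by auto
    have "((\<lambda>w. 1 / w) has_field_derivative - 1 / w\<^sup>2) (at w)"
      using w by (auto intro!: derivative_eq_intros simp: power2_eq_square)
    from DERIV_chain2[OF v(2) this]
    show "vf w \<noteq> 0 \<and> ((\<lambda>w. h (Fin_pt w)) has_field_derivative 1 / vf w) (at w)"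
      using v(1) w by (simp add: h_def)
  qed
qed

section \<open>Monodromy around one singular point\<close>

text \<open>The derivative of \<open>f2 / f1\<close> is the Wronskian divided by the square of
  \<open>f1\<close>, which is \<open>1 / vf\<close>; so the quotient differs from \<open>h\<close>
  by a constant.\<close>

lemma branch_quotient_primitive:
  assumes br: "branch z f1 f2" and nz: "vf z \<noteq> 0" and "open U" "z \<in> U"
    and h: "\<And>w. w \<in> U \<Longrightarrow> ((\<lambda>w. h (Fin_pt w)) has_field_derivative 1 / vf w) (at w)"
  obtains c where "germ_eq (Fin_pt z) f2 (\<lambda>q. (h q + c) * f1 q)"
proof -
  let ?F = "\<lambda>w. f1 (Fin_pt w)" and ?G = "\<lambda>w. f2 (Fin_pt w)"
  have "?F z \<noteq> 0" using nz vf_eq[OF br] by auto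
  have "isCont ?F z" using branch_derivs(1)[OF br] by (rule DERIV_isCont)
  then have "\<forall>\<^sub>F w in nhds z. ?F w \<noteq> 0"
    using \<open>?F z \<noteq> 0\<close> by (rule isCont_eventually_nonzero)
  then have "\<forall>\<^sub>F w in nhds z. ?F w \<noteq> 0 \<and> branch w f1 f2 \<and> w \<in> U"
    using branch_nearby[OF br] eventually_nhds_in_open[OF assms(3,4)] by eventually_elim simp
  then obtain e where e: "e > 0" "\<And>w. w \<in> ball z e \<Longrightarrow> ?F w \<noteq> 0 \<and> branch w f1 f2 \<and> w \<in> U"
    unfolding eventually_nhds_metric by (auto simp: dist_commute)
  have "((\<lambda>w. ?G w / ?F w - h (Fin_pt w)) has_field_derivative 0) (at w within ball z e)"
    if w: "w \<in> ball z e" for w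
  proof -
    have w': "?F w \<noteq> 0" "branch w f1 f2" "w \<in> U" using e(2)[OF w] by simp_all
    have "((\<lambda>w. ?G w / ?F w - h (Fin_pt w)) has_field_derivative
        wronskian f1 f2 w / (?F w)\<^sup>2 - 1 / vf w) (at w)"
      by (intro derivative_intros quotient_derivative w' h)
    moreover have "wronskian f1 f2 w / (?F w)\<^sup>2 - 1 / vf w = 0"
      by (simp add: vf_eq[OF w'(2)])
    ultimately show ?thesis by (metis has_field_derivative_at_within)
  qed
  then obtain c where c: "\<And>w. w \<in> ball z e \<Longrightarrow> ?G w / ?F w - h (Fin_pt w) = c"
    using has_field_derivative_zero_constant[of "ball z e" "\<lambda>w. ?G w / ?F w - h (Fin_pt w)"] by auto
  have "?G w = (h (Fin_pt w) + c) * ?F w" if "w \<in> ball z e" for w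
    using c[OF that] e(2)[OF that] by (auto simp: field_simps)
  then have "\<forall>\<^sub>F w in nhds z. ?G w = (h (Fin_pt w) + c) * ?F w"
    unfolding eventually_nhds using e(1) by (intro exI[of _ "ball z e"]) auto
  then have "germ_eq (Fin_pt z) f2 (\<lambda>q. (h q + c) * f1 q)"
    by (simp add: germ_eq_def eventually_nhds_Fin_pt)
  then show thesis by (rule that)
qed

text \<open>If the limit were not zero, then \<open>f2 = (h + k) f1\<close> with \<open>h\<close>
  single-valued on a punctured disc. A turn around \<open>a\<close> multiplies \<open>f1\<close> by
  \<open>l\<close>, hence also \<open>f2\<close>, and the local monodromy is scalar. The assumption
  ranges over all loops homotopic to \<open>\<gamma>\<close> because the turn takes place on a
  smaller circle than the given one.\<close>

lemma chart_vf_vanishes_of_nonscalar: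
  assumes "a \<in> D" and loop: "loop_around D x0 a \<gamma>"
    and fuchsian: "pole_order_le 1 (coord_coeff1 b1 a)" "pole_order_le 2 (coord_coeff2 b2 a)"
    and nonscalar: "\<And>\<Gamma> l. \<Gamma> \<in> loops_at (- D) x0 \<Longrightarrow> homotopic_paths (- D) \<gamma> \<Gamma> \<Longrightarrow>
      continues \<Gamma> \<eta>1 (\<lambda>q. l * \<eta>1 q) \<Longrightarrow> \<not> continues \<Gamma> \<eta>2 (\<lambda>q. l * \<eta>2 q)"
  shows "(chart_vf a \<longlongrightarrow> 0) (at 0)"
proof (rule ccontr)
  assume not0: "\<not> (chart_vf a \<longlongrightarrow> 0) (at 0)"
  obtain P S where sys:
    "\<forall>\<^sub>F t in at 0. symmetric_square_system (coord_coeff1 b1 a) (coord_coeff2 b2 a) (chart_vf a) P S t"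
    using chart_system .
  obtain C N where growth: "\<forall>\<^sub>F t in at 0. norm (t ^ N * chart_vf a t) \<le> C"
    using fuchsian_system_moderate_growth[OF fuchsian sys] .
  have "\<forall>\<^sub>F t in at 0. chart_vf a field_differentiable at t"
    using sys by eventually_elim (auto simp: symmetric_square_system_def field_differentiable_def)
  from vanishes_or_reciprocal_primitive[OF growth this] not0 obtain r0 H where
    r0: "r0 > 0" and
    H: "\<forall>t\<in>ball 0 r0 - {0}. chart_vf a t \<noteq> 0 \<and> (H has_field_derivative 1 / chart_vf a t) (at t)"
    by blast
  obtain h where h: "\<And>w t. t \<in> ball 0 r0 - {0} \<Longrightarrow> sph a t = Fin_pt w \<Longrightarrow>
     vf w \<noteq> 0 \<and> ((\<lambda>w. h (Fin_pt w)) has_field_derivative 1 / vf w) (at w)"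
    using chart_primitive[OF H] by metis
  define U where "U = {w. Fin_pt w \<in> sph a ` (ball 0 r0 - {0})}"
  have "open (sph a ` (ball 0 r0 - {0}))"
    by (intro open_sph_image open_Diff) auto
  from open_sph_vimage[OF this, of "Fin_pt 0"] have "open U"
    by (simp add: U_def vimage_def)
  have hU: "vf w \<noteq> 0 \<and> ((\<lambda>w. h (Fin_pt w)) has_field_derivative 1 / vf w) (at w)" if "w \<in> U" for w
  proof -
    from that obtain t where "t \<in> ball 0 r0 - {0}" "Fin_pt w = sph a t" unfolding U_def by blast
    then show ?thesis using h[of t w] by simp
  qed
  have ana_h: "germ_analytic (Fin_pt w) h" if "w \<in> U" for w
  proof -
    have "(\<lambda>w. h (Fin_pt w)) holomorphic_on U"
      using hU \<open>open U\<close> by (auto simp: holomorphic_on_open)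
    then show ?thesis unfolding germ_analytic_Fin_pt_iff analytic_at using that \<open>open U\<close> by blast
  qed

  obtain r \<delta> where r: "r > 0" "sph a ` cball 0 r \<inter> D = {a}"
    and \<delta>: "path \<delta>" "path_image \<delta> \<subseteq> - D" "pathstart \<delta> = x0" "pathfinish \<delta> = sph a (of_real r)"
    and hom: "homotopic_paths (- D) \<gamma> (\<delta> +++ (sph a \<circ> circlepath 0 r) +++ reversepath \<delta>)"
    using loop unfolding loop_around_def by blast
  \<comment> \<open>The circle of \<open>loop_around\<close> may lie outside the disc where
    \<open>h\<close> is a primitive; half of \<open>r0\<close> keeps the new circle strictly
    inside.\<close>
  define e where "e = min r (r0 / 2)"
  have e: "0 < e" "e \<le> r" "e < r0" using r(1) r0 by (auto simp: e_def)
  have punct: "sph a ` (cball 0 r - {0}) \<subseteq> - D"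
  proof safe
    fix t assume t: "t \<in> cball 0 r" "sph a t \<in> D" "t \<noteq> 0"
    then have "sph a t \<in> sph a ` cball 0 r \<inter> D" by blast
    then have "sph a t = sph a 0" using r(2) by simp
    from injD[OF inj_sph this] t(3) show False by simp
  qed
  obtain \<sigma> where \<sigma>: "path \<sigma>" "path_image \<sigma> \<subseteq> - D" "pathstart \<sigma> = sph a (of_real r)"
      "pathfinish \<sigma> = sph a (of_real e)"
    and hom2: "homotopic_paths (- D) (sph a \<circ> circlepath 0 r) (\<sigma> +++ (sph a \<circ> circlepath 0 e) +++ reversepath \<sigma>)"
    using homotopic_circlepath_smaller[OF e(1,2) punct] .
  obtain z where z: "sph a (of_real e) = Fin_pt z" using e(1) by (cases a) auto
  define c where "c = sph a \<circ> circlepath 0 e"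
  have "path_image c = sph a ` sphere 0 e" using e(1) by (simp add: c_def path_image_compose)
  then have im_c: "path_image c \<subseteq> sph a ` (ball 0 r0 - {0})" "path_image c \<subseteq> - D"
    using e punct by (force, force)
  have c: "path c" "pathstart c = Fin_pt z" "pathfinish c = Fin_pt z"
    using z path_continuous_image[OF _ continuous_on_sph, of "circlepath 0 e" a]
    by (simp_all add: c_def pathstart_compose pathfinish_compose)
  have "z \<in> U" unfolding U_def mem_Collect_eq z[symmetric] using e by (intro imageI) simp

  define \<delta>1 where "\<delta>1 = \<delta> +++ \<sigma>"
  \<comment> \<open>Bracketed so that splitting twice isolates the continuation along
    \<open>c\<close>, from \<open>f1\<close>, \<open>f2\<close> to \<open>g1\<close>,
    \<open>g2\<close>.\<close>
  define \<Gamma> where "\<Gamma> = (\<delta>1 +++ c) +++ reversepath \<delta>1"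
  have \<delta>1: "path \<delta>1" "path_image \<delta>1 \<subseteq> - D" "pathstart \<delta>1 = x0" "pathfinish \<delta>1 = Fin_pt z"
    using \<delta> \<sigma> z by (simp_all add: \<delta>1_def path_image_join)
  have \<Gamma>: "\<Gamma> \<in> loops_at (- D) x0"
    using \<delta>1 c im_c(2) by (simp add: \<Gamma>_def loops_at_def path_image_join)
  have "homotopic_paths (- D) \<gamma> \<Gamma>"
  proof -
    note hom
    also have "homotopic_paths (- D) (\<delta> +++ (sph a \<circ> circlepath 0 r) +++ reversepath \<delta>)
        (\<delta> +++ (\<sigma> +++ c +++ reversepath \<sigma>) +++ reversepath \<delta>)"
      unfolding c_def using \<delta> hom2
      by (intro homotopic_paths_join) (simp_all add: pathstart_compose pathfinish_compose)
    also have "homotopic_paths (- D) \<dots> \<Gamma>"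
      unfolding \<Gamma>_def \<delta>1_def using \<delta> \<sigma> c im_c(2) z
      by (intro homotopic_paths_conjugate_detour) simp_all
    finally show ?thesis .
  qed
  obtain l b where l: "l \<noteq> 0" and
    m: "continues \<Gamma> \<eta>1 (\<lambda>q. l * \<eta>1 q)" "continues \<Gamma> \<eta>2 (\<lambda>q. l * \<eta>2 q + b * \<eta>1 q)"
    using loop_monodromy[OF \<Gamma>] by metis
  have ends: "pathfinish (\<delta>1 +++ c) = pathstart (reversepath \<delta>1)" "pathfinish \<delta>1 = pathstart c"
    using \<delta>1 c by simp_all
  obtain g1 where g1: "continues (\<delta>1 +++ c) \<eta>1 g1" "continues (reversepath \<delta>1) g1 (\<lambda>q. l * \<eta>1 q)"
    using continues_joinpaths_split[OF m(1)[unfolded \<Gamma>_def] ends(1)] .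
  obtain g2 where g2: "continues (\<delta>1 +++ c) \<eta>2 g2" "continues (reversepath \<delta>1) g2 (\<lambda>q. l * \<eta>2 q + b * \<eta>1 q)"
    using continues_joinpaths_split[OF m(2)[unfolded \<Gamma>_def] ends(1)] .
  obtain f1 where f1: "continues \<delta>1 \<eta>1 f1" "continues c f1 g1"
    using continues_joinpaths_split[OF g1(1) ends(2)] .
  obtain f2 where f2: "continues \<delta>1 \<eta>2 f2" "continues c f2 g2"
    using continues_joinpaths_split[OF g2(1) ends(2)] .
  have br: "branch z f1 f2" unfolding branch_def using \<delta>1 f1(1) f2(1) by metis
  obtain k where k: "germ_eq (Fin_pt z) f2 (\<lambda>q. (h q + k) * f1 q)"
    using branch_quotient_primitive[OF br _ \<open>open U\<close> \<open>z \<in> U\<close>, of h] hU \<open>z \<in> U\<close> by metis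
  \<comment> \<open>Since \<open>h + k\<close> is analytic all along \<open>c\<close>, the relation
    between \<open>f2\<close> and \<open>f1\<close> persists for \<open>g2\<close> and
    \<open>g1\<close>.\<close>
  have "germ_analytic q (\<lambda>q. h q + k)" if "q \<in> path_image c" for q
  proof -
    from that im_c(1) obtain t where t: "t \<in> ball 0 r0 - {0}" "q = sph a t" by blast
    obtain w where w: "q = Fin_pt w" using t by (cases a) auto
    then have "w \<in> U" using t unfolding U_def by blast
    from ana_h[OF this] w show ?thesis
      unfolding germ_analytic_def by (auto intro!: analytic_intros)
  qed
  from continues_mult[OF f1(2) this]
  have "continues c (\<lambda>q. (h q + k) * f1 q) (\<lambda>q. (h q + k) * g1 q)" .
  from continues_unique[OF f2(2) this c(1)] k c
  have q2: "germ_eq (Fin_pt z) g2 (\<lambda>q. (h q + k) * g1 q)" by simp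
  have e1: "germ_eq (Fin_pt z) g1 (\<lambda>q. l * f1 q)"
    using continues_unique[OF continues_reversepath[OF g1(2)], of "\<lambda>q. l * \<eta>1 q" "\<lambda>q. l * f1 q"]
      continues_scale[OF f1(1), of l] \<delta>1 by simp
  have e2: "germ_eq (Fin_pt z) g2 (\<lambda>q. l * f2 q + b * f1 q)"
    using continues_unique[OF continues_reversepath[OF g2(2)], of "\<lambda>q. l * \<eta>2 q + b * \<eta>1 q" "\<lambda>q. l * f2 q + b * f1 q"]
      continues_combine[OF f2(1) f1(1), of l b] \<delta>1 by simp
  \<comment> \<open>On one side \<open>g2 = l f2 + b f1\<close>, on the other
    \<open>g2 = (h + k) g1 = (h + k) l f1 = l f2\<close>.\<close>
  have "germ_eq (Fin_pt z) (\<lambda>q. b * f1 q + 0 * f2 q) (\<lambda>_. 0)"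
    using k q2 e1 e2 unfolding germ_eq_def by eventually_elim (simp add: algebra_simps)
  from branch_independent(1)[OF br this] have "b = 0" .
  then have "continues \<Gamma> \<eta>2 (\<lambda>q. l * \<eta>2 q)" using m(2) by simp
  with nonscalar[OF \<Gamma> \<open>homotopic_paths (- D) \<gamma> \<Gamma>\<close> m(1)] show False by simp
qed

end

section \<open>Counting zeros\<close>

lemma quadratic_three_roots:
  fixes c0 c1 c2 :: complex
  assumes "x \<noteq> y" "y \<noteq> z" "x \<noteq> z"
    and "c0 + c1 * x + c2 * x\<^sup>2 = 0" "c0 + c1 * y + c2 * y\<^sup>2 = 0" "c0 + c1 * z + c2 * z\<^sup>2 = 0"
  shows "c0 = 0 \<and> c1 = 0 \<and> c2 = 0"
proof -
  have "(x - y) * (c1 + c2 * (x + y)) = 0" "(x - z) * (c1 + c2 * (x + z)) = 0"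
    using assms(4-6) by algebra+
  then have 1: "c1 + c2 * (x + y) = 0" "c1 + c2 * (x + z) = 0" using assms by auto
  then have "c2 * (y - z) = 0" by algebra
  then have "c2 = 0" using assms by simp
  then show ?thesis using 1 assms by simp
qed

lemma linear_two_roots:
  fixes c0 c1 :: complex
  assumes "x \<noteq> y" "c0 + c1 * x = 0" "c0 + c1 * y = 0"
  shows "c0 = 0 \<and> c1 = 0"
proof -
  have "c1 * (x - y) = 0" using assms(2,3) by algebra
  then show ?thesis using assms by simp
qed

lemma three_points_cases:
  assumes "distinct [a1, a2, a3]"
  obtains x y z where "{a1, a2, a3} = {Fin_pt x, Fin_pt y, Fin_pt z}" "x \<noteq> y" "y \<noteq> z" "x \<noteq> z"
  | x y where "{a1, a2, a3} = {Fin_pt x, Fin_pt y, Infty}" "x \<noteq> y"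
proof (cases a1)
  case 1: (Fin_pt u)
  show ?thesis
  proof (cases a2)
    case 2: (Fin_pt v)
    show ?thesis
    proof (cases a3)
      case (Fin_pt w)
      with 1 2 assms that(1)[of u v w] show ?thesis by simp
    qed (use 1 2 assms that(2)[of u v] in simp)
  next
    case 2: Infty
    then obtain w where "a3 = Fin_pt w" using assms by (cases a3) auto
    then show ?thesis using 1 2 assms that(2)[of u w] by (simp add: insert_commute)
  qed
next
  case 1: Infty
  obtain v where v: "a2 = Fin_pt v" using assms 1 by (cases a2) auto
  obtain w where w: "a3 = Fin_pt w" using assms 1 by (cases a3) auto
  show ?thesis using 1 v w assms that(2)[of v w] by (simp add: insert_commute)
qed

text \<open>A vector field on the sphere has degree 2, so it cannot vanish at three points.\<close>

lemma vector_field_three_zeros: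
  fixes v :: "complex \<Rightarrow> complex"
  assumes "distinct [a1, a2, a3]" and D: "D = {a1, a2, a3}"
    and hol: "v holomorphic_on {z. Fin_pt z \<notin> D}"
    and zeros: "\<And>a. a \<in> D \<Longrightarrow> (vector_field_chart v a \<longlongrightarrow> 0) (at 0)"
    and inf: "\<forall>\<^sub>F t in at 0. norm (vector_field_chart v Infty t) \<le> C"
    and "Fin_pt z \<notin> D"
  shows "v z = 0"
proof -
  let ?K = "{z. Fin_pt z \<in> D}"
  \<comment> \<open>The finite points of \<open>D\<close> are removable with limit \<open>0\<close>,
    so this is the entire extension of \<open>v\<close>.\<close>
  define f where "f = (\<lambda>z. if z \<in> ?K then 0 else v z)"
  have fin: "finite ?K" using finite_preimage_Fin_pt[of D] D by simp
  have "f holomorphic_on UNIV"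
  proof (rule no_isolated_singularity'[OF _ _ open_UNIV fin])
    have "f holomorphic_on UNIV - ?K \<longleftrightarrow> v holomorphic_on UNIV - ?K"
      by (rule holomorphic_cong) (auto simp: f_def)
    moreover have "UNIV - ?K = {z. Fin_pt z \<notin> D}" by auto
    ultimately show "f holomorphic_on UNIV - ?K" using hol by simp
  next
    fix c assume c: "c \<in> ?K"
    have "((\<lambda>t. v (c + t)) \<longlongrightarrow> 0) (at 0)"
      using zeros[of "Fin_pt c"] c by (simp add: vector_field_chart.simps[abs_def])
    then have "(v \<longlongrightarrow> 0) (at c)"
      using filterlim_at_to_0[of v "nhds 0" c] by (simp add: add.commute)
    moreover have "\<forall>\<^sub>F w in at c. w \<notin> ?K"
      using islimpt_finite[OF fin, of c] by (auto simp: islimpt_iff_eventually)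
    then have "\<forall>\<^sub>F w in at c. v w = f w" by eventually_elim (simp add: f_def)
    ultimately have "(f \<longlongrightarrow> 0) (at c)" using Lim_transform_eventually by blast
    then show "(f \<longlongrightarrow> f c) (at c)" using c by (simp add: f_def)
  qed
  \<comment> \<open>Boundedness of \<open>- t^2 v(1/t)\<close> at infinity is quadratic growth of
    \<open>v\<close>, so Liouville leaves a polynomial of degree at most 2.\<close>
  moreover obtain A where "\<And>z. A \<le> norm z \<Longrightarrow> norm (f z) \<le> C * norm z ^ 2"
  proof -
    obtain R where R: "0 < R" "\<And>t. 0 < norm t \<Longrightarrow> norm t \<le> R \<Longrightarrow> norm (vector_field_chart v Infty t) \<le> C"
      using eventually_at_0_punctured_disc[OF inf] by metis
    have "norm (f z) \<le> C * norm z ^ 2" if z: "1 / R \<le> norm z" for z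
    proof -
      have "norm z > 0" using z R(1) by (meson divide_pos_pos less_le_trans zero_less_one)
      then have "norm (vector_field_chart v Infty (1 / z)) \<le> C"
        using z R(1) by (intro R(2)) (auto simp: norm_divide field_simps)
      moreover from this have "0 \<le> C" using order_trans[OF norm_ge_zero] by blast
      ultimately have "norm (v z) \<le> C * norm z ^ 2" "0 \<le> C"
        using \<open>norm z > 0\<close>
        by (auto simp: norm_divide norm_mult norm_power power_divide field_simps)
      then show ?thesis by (simp add: f_def)
    qed
    then show thesis by (rule that)
  qed
  ultimately have "f w = (\<Sum>k\<le>2. (deriv ^^ k) f 0 / fact k * w ^ k)" for w
    by (rule Liouville_polynomial)
  moreover define c where "c = (\<lambda>k. (deriv ^^ k) f 0 / fact k)"
  ultimately have "f w = (\<Sum>k\<le>2. c k * w ^ k)" for w by simp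
  then obtain c0 c1 c2 where f: "\<And>w. f w = c0 + c1 * w + c2 * w\<^sup>2"
    by (intro that[of "c 0" "c 1" "c 2"]) (simp add: numeral_2_eq_2)
  have root: "c0 + c1 * w + c2 * w\<^sup>2 = 0" if "Fin_pt w \<in> D" for w
    using that f[of w] by (simp add: f_def)
  have "c0 = 0 \<and> c1 = 0 \<and> c2 = 0"
  proof (cases rule: three_points_cases[OF assms(1)])
    case (1 x y z)
    with quadratic_three_roots[of x y z c0 c1 c2] root[of x] root[of y] root[of z] D
    show ?thesis by simp
  next
    \<comment> \<open>A zero at infinity is a missing leading coefficient: the chart there is
      \<open>- (c0 t^2 + c1 t + c2)\<close>. The two finite zeros then dispose of a linear
      polynomial.\<close>
    case (2 x y)
    have ev: "\<forall>\<^sub>F t in at 0. vector_field_chart v Infty t = - (c0 * t\<^sup>2 + c1 * t + c2)"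
    proof -
      have "\<forall>\<^sub>F t in at (0::complex). t \<noteq> 0" by (simp add: eventually_at_filter)
      with eventually_sph_notin[of D Infty] D
      have "\<forall>\<^sub>F t in at 0. t \<noteq> 0 \<and> Fin_pt (1 / t) \<notin> D"
        by (auto elim: eventually_elim2)
      then show ?thesis
      proof eventually_elim
        case (elim t)
        then have "v (1 / t) = c0 + c1 * (1 / t) + c2 * (1 / t)\<^sup>2"
          using f[of "1 / t"] by (simp add: f_def)
        then show ?case using elim by (simp add: field_simps power2_eq_square)
      qed
    qed
    have "((\<lambda>t. - (c0 * t\<^sup>2 + c1 * t + c2)) \<longlongrightarrow> - (c0 * 0\<^sup>2 + c1 * 0 + c2)) (at 0)"
      by (intro tendsto_intros)
    then have "(vector_field_chart v Infty \<longlongrightarrow> - (c0 * 0\<^sup>2 + c1 * 0 + c2)) (at 0)"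
      by (rule tendsto_cong[OF ev, THEN iffD2])
    moreover have "(vector_field_chart v Infty \<longlongrightarrow> 0) (at 0)"
      using zeros[of Infty] 2 D by simp
    ultimately have "- (c0 * 0\<^sup>2 + c1 * 0 + c2) = 0" by (rule tendsto_unique[rotated]) simp
    then have "c2 = 0" by simp
    then show ?thesis using linear_two_roots[of x y c0 c1] root[of x] root[of y] 2 D by simp
  qed
  then show ?thesis using f[of z] assms(6) by (simp add: f_def)
qed

lemma (in unipotent_pair) some_local_monodromy_scalar:
  assumes "distinct [a1, a2, a3]" and D: "D = {a1, a2, a3}"
    and eq: "riemann_equation D b1 b2"
    and loops: "loop_around D x0 a1 \<gamma>1" "loop_around D x0 a2 \<gamma>2" "loop_around D x0 a3 \<gamma>3"
  shows "\<exists>\<gamma>\<in>{\<gamma>1, \<gamma>2, \<gamma>3}. \<exists>\<Gamma>\<in>loops_at (- D) x0. \<exists>l. homotopic_paths (- D) \<gamma> \<Gamma> \<and>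
     continues \<Gamma> \<eta>1 (\<lambda>q. l * \<eta>1 q) \<and> continues \<Gamma> \<eta>2 (\<lambda>q. l * \<eta>2 q)"
proof (rule ccontr)
  assume contra: "\<not> ?thesis"
  have zero: "(chart_vf a \<longlongrightarrow> 0) (at 0)" if "a \<in> D" for a
  proof -
    have "a = a1 \<or> a = a2 \<or> a = a3" using that D by simp
    then obtain \<gamma> where \<gamma>: "\<gamma> \<in> {\<gamma>1, \<gamma>2, \<gamma>3}" "loop_around D x0 a \<gamma>"
      using loops by auto
    have "pole_order_le 1 (coord_coeff1 b1 a)" "pole_order_le 2 (coord_coeff2 b2 a)"
      using eq that unfolding riemann_equation_def by simp_all
    then show ?thesis
    proof (rule chart_vf_vanishes_of_nonscalar[OF that \<gamma>(2)])
      fix \<Gamma> l assume "\<Gamma> \<in> loops_at (- D) x0" "homotopic_paths (- D) \<gamma> \<Gamma>" "continues \<Gamma> \<eta>1 (\<lambda>q. l * \<eta>1 q)"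
      then show "\<not> continues \<Gamma> \<eta>2 (\<lambda>q. l * \<eta>2 q)" using contra \<gamma>(1) by blast
    qed
  qed
  \<comment> \<open>At a singular infinity the bound comes from the zero just found, at an ordinary
    one from the regular system.\<close>
  have "\<exists>C. \<forall>\<^sub>F t in at 0. norm (chart_vf Infty t) \<le> C"
  proof (cases "Infty \<in> D")
    case True
    have "\<forall>\<^sub>F t in at 0. dist (chart_vf Infty t) 0 < 1"
      using zero[OF True] by (rule tendstoD) simp
    then show ?thesis by (intro exI[of _ 1]) (auto elim: eventually_mono)
  next
    case False
    obtain P S where sys: "\<forall>\<^sub>F t in at 0.
        symmetric_square_system (coord_coeff1 b1 Infty) (coord_coeff2 b2 Infty) (chart_vf Infty) P S t"
      using chart_system .
    have "pole_order_le 0 (coord_coeff1 b1 Infty)" "pole_order_le 0 (coord_coeff2 b2 Infty)"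
      using eq False by (simp_all add: riemann_equation_def)
    from ordinary_system_bounded[OF this sys] show ?thesis by metis
  qed
  then obtain C where C: "\<forall>\<^sub>F t in at 0. norm (chart_vf Infty t) \<le> C" ..
  have "vf field_differentiable at z" if "Fin_pt z \<notin> D" for z
    using system_at_finite_point[OF that] unfolding symmetric_square_system_def field_differentiable_def
    by blast
  then have hol: "vf holomorphic_on {z. Fin_pt z \<notin> D}"
    by (simp add: holomorphic_on_def field_differentiable_at_within)
  have vf0: "vf z = 0" if "Fin_pt z \<notin> D" for z
    by (rule vector_field_three_zeros[OF assms(1) D hol zero C that])
  have "{z. Fin_pt z \<in> D} \<noteq> UNIV"
    using finite_preimage_Fin_pt[OF finD] infinite_UNIV_char_0[where 'a = complex] by metis
  then obtain z where z: "Fin_pt z \<notin> D" by blast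
  have "\<forall>\<^sub>F w in nhds z. w \<in> {z. Fin_pt z \<notin> D}"
    using open_finite_points[OF finD] z by (intro eventually_nhds_in_open) auto
  then have "\<forall>\<^sub>F w in nhds z. vf w = 0"
    by eventually_elim (simp add: vf0)
  with vf_not_identically_zero[OF z] show False by simp
qed

section \<open>Reduction to unipotent monodromy\<close>

definition det2 :: "complex ^ 2 \<Rightarrow> complex ^ 2 \<Rightarrow> complex" where
  "det2 u v = u $ 1 * v $ 2 - u $ 2 * v $ 1"

text \<open>Cramer's rule.\<close>

lemma det2_expand:
  assumes "det2 u v \<noteq> 0"
  shows "x = (det2 x v / det2 u v) *s u + (det2 u x / det2 u v) *s v"
proof -
  have "det2 u v *s x = det2 x v *s u + det2 u x *s v"
    by (simp add: vec_eq_iff forall_2 det2_def algebra_simps)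
  then have "(1 / det2 u v) *s (det2 u v *s x) = (1 / det2 u v) *s (det2 x v *s u + det2 u x *s v)"
    by simp
  then show ?thesis using assms by (simp add: vec.scale_right_distrib)
qed

lemma det2_independent:
  assumes "det2 u v \<noteq> 0" "a *s u + b *s v = 0"
  shows "a = 0" "b = 0"
proof -
  have "a * det2 u v = det2 (a *s u + b *s v) v" "b * det2 u v = det2 u (a *s u + b *s v)"
    by (simp_all add: det2_def algebra_simps)
  then show "a = 0" "b = 0" using assms by (simp_all add: det2_def)
qed

lemma det2_complement:
  assumes "u \<noteq> 0"
  obtains v where "det2 u v \<noteq> 0"
proof (cases "u $ 1 = 0")
  case True
  then have "det2 u (vector [1, 0]) \<noteq> 0"
    using assms by (auto simp: det2_def vec_eq_iff forall_2)
  then show thesis by (rule that)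
next
  case False
  then have "det2 u (vector [0, 1]) \<noteq> 0" by (simp add: det2_def)
  then show thesis by (rule that)
qed

text \<open>A second independent vector in \<open>W\<close> would generate the whole plane by
  Cramer's rule.\<close>

lemma proper_subspace_line:
  fixes W :: "(complex ^ 2) set"
  assumes "vec.subspace W" "W \<noteq> UNIV" "u \<in> W" "u \<noteq> 0" "x \<in> W"
  obtains c where "x = c *s u"
proof -
  have "det2 u x = 0"
  proof (rule ccontr)
    assume "det2 u x \<noteq> 0"
    then have "y \<in> W" for y
      using det2_expand[of u x y] assms(1,3,5) by (metis vec.subspace_add vec.subspace_scale)
    then show False using assms(2) by blast
  qed
  obtain v where v: "det2 u v \<noteq> 0" using det2_complement[OF assms(4)] .
  from det2_expand[OF v, of x] \<open>det2 u x = 0\<close> have "x = (det2 x v / det2 u v) *s u" by simp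
  then show thesis by (rule that)
qed

lemma diagonalizable_of_eigenbasis:
  fixes M :: "complex ^ 2 ^ 2"
  assumes "det2 u v \<noteq> 0" "M *v u = a *s u" "M *v v = b *s v"
  shows "diagonalizable M"
proof -
  define P :: "complex ^ 2 ^ 2" where "P = (\<chi> i j. if j = 1 then u $ i else v $ i)"
  define E :: "complex ^ 2 ^ 2" where "E = (\<chi> i j. if i = j then (if j = 1 then a else b) else 0)"
  have "det P = det2 u v" by (simp add: det_2 P_def det2_def)
  then have P: "invertible P" using assms(1) by (simp add: invertible_det_nz)
  have "M ** P = P ** E"
    using assms(2,3)
    by (simp add: vec_eq_iff forall_2 matrix_matrix_mult_def matrix_vector_mult_def sum_2 P_def E_def mult.commute)
  then have "matrix_inv P ** M ** P = matrix_inv P ** P ** E"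
    by (metis matrix_mul_assoc)
  also have "matrix_inv P ** P = mat 1"
    using someI_ex[OF P[unfolded invertible_def]] unfolding matrix_inv_def by blast
  finally have "matrix_inv P ** M ** P = E" by simp
  then show ?thesis
    unfolding diagonalizable_def using P by (intro exI[of _ P]) (simp add: E_def)
qed

lemma nondiagonalizable_triangular:
  fixes M :: "complex ^ 2 ^ 2"
  assumes "\<not> diagonalizable M" "det2 u v \<noteq> 0" "M *v u = a *s u"
  obtains b where "M *v v = a *s v + b *s u"
proof -
  obtain b m where Mv: "M *v v = b *s u + m *s v" using det2_expand[OF assms(2), of "M *v v"] by metis
  have "m = a"
  proof (rule ccontr)
    assume "m \<noteq> a"
    \<comment> \<open>The solution of \<open>b + k * a = m * k\<close>, which makes
      \<open>v + k *s u\<close> an eigenvector for the second eigenvalue \<open>m\<close>.\<close>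
    define k where "k = b / (m - a)"
    have k: "b = k * (m - a)" using \<open>m \<noteq> a\<close> by (simp add: k_def)
    have "M *v (v + k *s u) = m *s (v + k *s u)"
      by (simp add: matrix_vector_right_distrib vec.scale assms(3) Mv k vec_eq_iff algebra_simps
          flip: vector_scalar_mult_def)
    moreover have "det2 u (v + k *s u) \<noteq> 0" using assms(2) by (simp add: det2_def algebra_simps)
    ultimately show False using diagonalizable_of_eigenbasis[OF _ assms(3)] assms(1) by blast
  qed
  with Mv show thesis by (intro that[of b]) (simp add: add.commute)
qed

section \<open>From monodromy matrices to continued solutions\<close>

text \<open>The row \<open>Z\<close> times the column \<open>w\<close>. In this form
  \<open>Y = Y* G\<close> says that \<open>row_comb Y w\<close> equals \<open>row_comb\<close> of
  \<open>Y*\<close> at \<open>G *v w\<close>, so invariant columns of \<open>G\<close> become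
  solutions that are only rescaled.\<close>

definition row_comb :: "(riemann_sphere \<Rightarrow> complex ^ 2) \<Rightarrow> complex ^ 2 \<Rightarrow> riemann_sphere \<Rightarrow> complex" where
  "row_comb Z w = (\<lambda>p. w $ 1 * Z p $ 1 + w $ 2 * Z p $ 2)"

lemma row_comb_linear: "row_comb Z (a *s u + b *s v) p = a * row_comb Z u p + b * row_comb Z v p"
  by (simp add: row_comb_def algebra_simps)

lemma row_comb_vmult: "w $ 1 * (z v* G) $ 1 + w $ 2 * (z v* G) $ 2 = (G *v w) $ 1 * z $ 1 + (G *v w) $ 2 * z $ 2"
  for z w :: "complex ^ 2"
  by (simp add: vector_matrix_mult_def matrix_vector_mult_def sum_2 algebra_simps)

lemma local_solution_combine:
  assumes "local_solution b1 b2 p f" "local_solution b1 b2 p g"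
  shows "local_solution b1 b2 p (\<lambda>q. a * f q + b * g q)"
proof -
  let ?f = "\<lambda>t. f (sph p t)" and ?g = "\<lambda>t. g (sph p t)"
  let ?h = "\<lambda>t. a * ?f t + b * ?g t"
  have ana: "?f analytic_on {0}" "?g analytic_on {0}"
    using assms by (auto simp: local_solution_def)
  obtain e1 e2 where e: "e1 > 0" "?f holomorphic_on ball 0 e1" "e2 > 0" "?g holomorphic_on ball 0 e2"
    using ana unfolding analytic_at_ball by blast
  define B where "B = ball (0::complex) (min e1 e2)"
  have B: "open B" "0 \<in> B" "?f holomorphic_on B" "?g holomorphic_on B"
    using e by (auto simp: B_def intro: holomorphic_on_subset)
  have df: "(?f has_field_derivative deriv ?f t) (at t)" "(?g has_field_derivative deriv ?g t) (at t)"
    if "t \<in> B" for t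
    using B that by (auto intro: holomorphic_derivI)
  have ddf: "(deriv ?f has_field_derivative deriv (deriv ?f) t) (at t)"
    "(deriv ?g has_field_derivative deriv (deriv ?g) t) (at t)" if "t \<in> B" for t
    using B that by (auto intro!: holomorphic_derivI holomorphic_deriv)
  have d: "deriv ?h t = a * deriv ?f t + b * deriv ?g t" if "t \<in> B" for t
    using df[OF that] by (auto intro!: DERIV_imp_deriv derivative_eq_intros)
  have dd: "deriv (deriv ?h) t = a * deriv (deriv ?f) t + b * deriv (deriv ?g) t" if t: "t \<in> B" for t
  proof -
    have "\<forall>\<^sub>F s in nhds t. deriv ?h s = a * deriv ?f s + b * deriv ?g s"
      using eventually_nhds_in_open[OF B(1) t] by eventually_elim (rule d)
    then have "deriv (deriv ?h) t = deriv (\<lambda>s. a * deriv ?f s + b * deriv ?g s) t"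
      by (rule deriv_cong_ev) simp
    also have "\<dots> = a * deriv (deriv ?f) t + b * deriv (deriv ?g) t"
      using ddf[OF t] by (auto intro!: DERIV_imp_deriv derivative_eq_intros)
    finally show ?thesis .
  qed
  have "\<forall>\<^sub>F t in at 0. t \<in> B" using B(1,2) by (rule eventually_at_in_open')
  moreover have "\<forall>\<^sub>F t in at 0. deriv (deriv ?f) t + coord_coeff1 b1 p t * deriv ?f t + coord_coeff2 b2 p t * ?f t = 0"
    "\<forall>\<^sub>F t in at 0. deriv (deriv ?g) t + coord_coeff1 b1 p t * deriv ?g t + coord_coeff2 b2 p t * ?g t = 0"
    using assms unfolding local_solution_def by (rule_tac [!] conjunct2)
  ultimately have "\<forall>\<^sub>F t in at 0. deriv (deriv ?h) t + coord_coeff1 b1 p t * deriv ?h t + coord_coeff2 b2 p t * ?h t = 0"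
  proof eventually_elim
    case (elim t)
    have "deriv (deriv ?h) t + coord_coeff1 b1 p t * deriv ?h t + coord_coeff2 b2 p t * ?h t
      = a * (deriv (deriv ?f) t + coord_coeff1 b1 p t * deriv ?f t + coord_coeff2 b2 p t * ?f t)
      + b * (deriv (deriv ?g) t + coord_coeff1 b1 p t * deriv ?g t + coord_coeff2 b2 p t * ?g t)"
      by (simp add: d[OF elim(1)] dd[OF elim(1)] algebra_simps)
    then show ?case using elim(2,3) by simp
  qed
  moreover have "?h analytic_on {0}" using ana by (intro analytic_intros)
  ultimately show ?thesis unfolding local_solution_def by blast
qed

lemma continuation_along_familyD:
  assumes "continuation_along b1 b2 \<gamma> F" "t \<in> {0..1}"
  shows "local_solution b1 b2 (\<gamma> t) (F t)" "germ_analytic (\<gamma> t) (F t)"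
    "\<forall>\<^sub>F s in at t within {0..1}. germ_eq (\<gamma> s) (F s) (F t)"
  using assms local_solution_germ_analytic unfolding continuation_along_def germ_eq_def by metis+

lemma monodromy_matrixE:
  assumes "monodromy_matrix b1 b2 x Y \<gamma> G" "pathstart \<gamma> = x" "pathfinish \<gamma> = x"
  obtains Z where "\<And>w. continues \<gamma> (row_comb Y w) (row_comb Z w)"
    "\<And>w. germ_eq x (row_comb Y w) (row_comb Z (G *v w))"
proof -
  obtain F :: "real \<Rightarrow> riemann_sphere \<Rightarrow> complex ^ 2" where F: "\<And>i. continuation_along b1 b2 \<gamma> (\<lambda>t p. F t p $ i)"
    "\<forall>\<^sub>F p in nhds x. F 0 p = Y p" "\<forall>\<^sub>F p in nhds x. Y p = F 1 p v* G"
    using assms(1) unfolding monodromy_matrix_def by blast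
  have c: "continues \<gamma> (\<lambda>p. Y p $ i) (\<lambda>p. F 1 p $ i)" for i
    unfolding continues_def
  proof (intro exI[of _ "\<lambda>t p. F t p $ i"] conjI ballI)
    show "germ_eq (pathstart \<gamma>) (\<lambda>p. F 0 p $ i) (\<lambda>p. Y p $ i)"
      using F(2) unfolding assms(2) germ_eq_def by eventually_elim simp
  qed (use continuation_along_familyD[OF F(1)] in auto)
  have "continues \<gamma> (row_comb Y w) (row_comb (F 1) w)" for w
    unfolding row_comb_def by (rule continues_combine[OF c c])
  moreover have "germ_eq x (row_comb Y w) (row_comb (F 1) (G *v w))" for w
    using F(3) unfolding germ_eq_def row_comb_def
    by eventually_elim (simp add: row_comb_vmult)
  ultimately show thesis by (rule that)
qed

text \<open>Monodromy is given for loops only. Continuation along an open path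
  \<open>\<delta>\<close> is obtained from the loop that runs out along \<open>\<delta>\<close> and
  straight back, by stopping at its midpoint.\<close>

lemma monodromy_matrix_half:
  assumes "monodromy_matrix b1 b2 x Y (\<delta> +++ reversepath \<delta>) G" "pathstart \<delta> = x"
  obtains Z where "\<And>w. continues \<delta> (row_comb Y w) (row_comb Z w)"
    "\<And>w. local_solution b1 b2 (pathfinish \<delta>) (row_comb Z w)"
proof -
  obtain F :: "real \<Rightarrow> riemann_sphere \<Rightarrow> complex ^ 2" where F: "\<And>i. continuation_along b1 b2 (\<delta> +++ reversepath \<delta>) (\<lambda>t p. F t p $ i)"
    "\<forall>\<^sub>F p in nhds x. F 0 p = Y p"
    using assms(1) unfolding monodromy_matrix_def by blast
  have mid: "(\<delta> +++ reversepath \<delta>) (1 / 2) = pathfinish \<delta>"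
    by (simp add: joinpaths_def pathfinish_def)
  have sol: "local_solution b1 b2 (pathfinish \<delta>) (\<lambda>p. F (1 / 2) p $ i)" for i
    using continuation_along_familyD(1)[OF F(1), of "1 / 2" i] by (simp add: mid)
  have c: "continues \<delta> (\<lambda>p. Y p $ i) (\<lambda>p. F (1 / 2) p $ i)" for i
  proof (rule continues_cong[OF continuation_along_join_halves(1)])
    show "germ_eq (pathstart \<delta>) (\<lambda>p. F 0 p $ i) (\<lambda>p. Y p $ i)"
      using F(2) unfolding assms(2) germ_eq_def by eventually_elim simp
  qed (use continuation_along_familyD[OF F(1)] in auto)
  show thesis
    by (rule that[of "F (1 / 2)"]) (unfold row_comb_def, rule continues_combine[OF c c], rule local_solution_combine[OF sol sol])
qed

text \<open>Uniqueness of coefficients in \<open>solution_basis\<close>, applied to the zero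
  solution.\<close>

lemma row_comb_eq_zero:
  assumes "solution_basis b1 b2 x Y" "germ_eq x (row_comb Y w) (\<lambda>_. 0)"
  shows "w = 0"
proof -
  have "local_solution b1 b2 x (\<lambda>_. 0)"
    by (simp add: local_solution_def)
  then have "\<exists>!c :: complex ^ 2. \<forall>\<^sub>F p in nhds x. 0 = (\<Sum>i\<in>UNIV. c $ i * Y p $ i)"
    using assms(1) unfolding solution_basis_def by blast
  moreover have "\<forall>\<^sub>F p in nhds x. 0 = (\<Sum>i\<in>UNIV. w $ i * Y p $ i)"
    using assms(2) unfolding germ_eq_def row_comb_def by eventually_elim (simp add: sum_2)
  moreover have "\<forall>\<^sub>F p in nhds x. 0 = (\<Sum>i\<in>UNIV. (0 :: complex ^ 2) $ i * Y p $ i)"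
    by simp
  ultimately show ?thesis by blast
qed

text \<open>In the basis \<open>u\<close>, \<open>v\<close> the matrix is triangular with equal
  nonzero diagonal entries. For a fixed basis such matrices form a group, so the shape can be
  checked on generators.\<close>

definition unipotent_up_to_scalar :: "complex ^ 2 \<Rightarrow> complex ^ 2 \<Rightarrow> complex ^ 2 ^ 2 \<Rightarrow> bool" where
  "unipotent_up_to_scalar u v M \<longleftrightarrow> (\<exists>l b. l \<noteq> 0 \<and> M *v u = l *s u \<and> M *v v = l *s v + b *s u)"

lemma unipotent_up_to_scalar_mult:
  assumes "unipotent_up_to_scalar u v M" "unipotent_up_to_scalar u v N"
  shows "unipotent_up_to_scalar u v (M ** N)"
proof -
  obtain l b where M: "l \<noteq> 0" "M *v u = l *s u" "M *v v = l *s v + b *s u"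
    using assms(1) unfolding unipotent_up_to_scalar_def by blast
  obtain l' b' where N: "l' \<noteq> 0" "N *v u = l' *s u" "N *v v = l' *s v + b' *s u"
    using assms(2) unfolding unipotent_up_to_scalar_def by blast
  have "M *v (N *v u) = (l * l') *s u"
    by (simp add: N M vec.scale mult.commute)
  moreover have "M *v (N *v v) = (l * l') *s v + (l' * b + b' * l) *s u"
    by (simp add: N M vec.scale matrix_vector_right_distrib vec_eq_iff algebra_simps)
  ultimately show ?thesis
    unfolding unipotent_up_to_scalar_def matrix_vector_mul_assoc[symmetric]
    using M(1) N(1) by (intro exI[of _ "l * l'"] exI[of _ "l' * b + b' * l"]) simp
qed

lemma unipotent_up_to_scalar_inverse:
  assumes "unipotent_up_to_scalar u v M" "N ** M = mat 1"
  shows "unipotent_up_to_scalar u v N"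
proof -
  obtain l b where M: "l \<noteq> 0" "M *v u = l *s u" "M *v v = l *s v + b *s u"
    using assms(1) unfolding unipotent_up_to_scalar_def by blast
  have NM: "N *v (M *v x) = x" for x
    by (simp add: matrix_vector_mul_assoc assms(2))
  have "l *s (N *v u) = u" using NM[of u] by (simp add: M vec.scale)
  then have Nu: "N *v u = (1 / l) *s u"
    using M(1) by (metis divide_self vec.scale_one vec.scale_scale times_divide_eq_left mult_1)
  have "l *s (N *v v) + b *s (N *v u) = v"
    using NM[of v] by (simp add: M vec.scale matrix_vector_right_distrib)
  then have "l *s (N *v v) = v - (b / l) *s u" by (simp add: Nu eq_diff_eq)
  then have "(1 / l) *s (l *s (N *v v)) = (1 / l) *s (v - (b / l) *s u)" by simp
  then have "N *v v = (1 / l) *s v + (- b / l\<^sup>2) *s u"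
    using M(1) by (simp add: vec_eq_iff field_simps power2_eq_square)
  then show ?thesis unfolding unipotent_up_to_scalar_def using M(1) Nu
    by (intro exI[of _ "1 / l"] exI[of _ "- b / l\<^sup>2"]) simp
qed

lemma unipotent_pair_of_monodromy:
  assumes D: "finite D" "x0 \<notin> D"
    and eq: "riemann_equation D b1 b2"
    and basis: "solution_basis b1 b2 x0 Y"
    and mono: "\<And>\<gamma>. \<gamma> \<in> loops_at (- D) x0 \<Longrightarrow> monodromy_matrix b1 b2 x0 Y \<gamma> (\<rho> (loop_class (- D) \<gamma>))"
    and uni: "\<And>\<gamma>. \<gamma> \<in> loops_at (- D) x0 \<Longrightarrow> unipotent_up_to_scalar u v (\<rho> (loop_class (- D) \<gamma>))"
    and uv: "det2 u v \<noteq> 0"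
  shows "unipotent_pair D x0 b1 b2 (row_comb Y u) (row_comb Y v)"
proof
  show "finite D" "x0 \<notin> D" by fact+
  show "b1 holomorphic_on {z. Fin_pt z \<notin> D}" "b2 holomorphic_on {z. Fin_pt z \<notin> D}"
    using eq by (simp_all add: riemann_equation_def)
next
  fix \<delta> assume \<delta>: "path \<delta>" "path_image \<delta> \<subseteq> - D" "pathstart \<delta> = x0"
  then have "\<delta> +++ reversepath \<delta> \<in> loops_at (- D) x0"
    by (simp add: loops_at_def path_image_join)
  from monodromy_matrix_half[OF mono[OF this] \<delta>(3)] obtain Z where
    "\<And>w. continues \<delta> (row_comb Y w) (row_comb Z w)"
    "\<And>w. local_solution b1 b2 (pathfinish \<delta>) (row_comb Z w)" by metis
  then show "\<exists>f1 f2. continues \<delta> (row_comb Y u) f1 \<and> continues \<delta> (row_comb Y v) f2 \<and>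
      local_solution b1 b2 (pathfinish \<delta>) f1 \<and> local_solution b1 b2 (pathfinish \<delta>) f2"
    by metis
next
  fix \<gamma> assume \<gamma>: "\<gamma> \<in> loops_at (- D) x0"
  then have ends: "pathstart \<gamma> = x0" "pathfinish \<gamma> = x0" by (simp_all add: loops_at_def)
  define G where "G = \<rho> (loop_class (- D) \<gamma>)"
  obtain Z where Z: "\<And>w. continues \<gamma> (row_comb Y w) (row_comb Z w)"
    "\<And>w. germ_eq x0 (row_comb Y w) (row_comb Z (G *v w))"
    using monodromy_matrixE[OF mono[OF \<gamma>] ends] unfolding G_def by metis
  obtain l b where G: "l \<noteq> 0" "G *v u = l *s u" "G *v v = l *s v + b *s u"
    using uni[OF \<gamma>] unfolding unipotent_up_to_scalar_def G_def by metis
  have eu: "\<forall>\<^sub>F p in nhds x0. row_comb Y u p = l * row_comb Z u p"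
    using Z(2)[of u] row_comb_linear[of Z l u 0 v] unfolding germ_eq_def G by simp
  have ev: "\<forall>\<^sub>F p in nhds x0. row_comb Y v p = l * row_comb Z v p + b * row_comb Z u p"
    using Z(2)[of v] row_comb_linear[of Z l v b u] unfolding germ_eq_def G by simp
  \<comment> \<open>Since \<open>Y = Y* G\<close>, continuation acts by the inverse of
    \<open>G\<close>; hence \<open>1 / l\<close> here and \<open>- b / l^2\<close> below.\<close>
  have 1: "germ_eq x0 (row_comb Z u) (\<lambda>q. 1 / l * row_comb Y u q)"
    using eu unfolding germ_eq_def by eventually_elim (use G(1) in simp)
  have 2: "germ_eq x0 (row_comb Z v) (\<lambda>q. 1 / l * row_comb Y v q + (- b / l\<^sup>2) * row_comb Y u q)"
    using eu ev unfolding germ_eq_def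
    by eventually_elim (use G(1) in \<open>simp add: field_simps power2_eq_square\<close>)
  show "\<exists>l b. l \<noteq> 0 \<and> continues \<gamma> (row_comb Y u) (\<lambda>q. l * row_comb Y u q) \<and>
      continues \<gamma> (row_comb Y v) (\<lambda>q. l * row_comb Y v q + b * row_comb Y u q)"
    using continues_cong[OF Z(1)[of u] germ_eq_refl] continues_cong[OF Z(1)[of v] germ_eq_refl] 1 2 ends G(1)
    by (intro exI[of _ "1 / l"] exI[of _ "- b / l\<^sup>2"]) simp
next
  fix c1 c2 assume "germ_eq x0 (\<lambda>q. c1 * row_comb Y u q + c2 * row_comb Y v q) (\<lambda>_. 0)"
  then have "germ_eq x0 (row_comb Y (c1 *s u + c2 *s v)) (\<lambda>_. 0)"
    unfolding row_comb_linear[abs_def, symmetric] by (simp add: row_comb_linear germ_eq_def)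
  from det2_independent[OF uv row_comb_eq_zero[OF basis this]] show "c1 = 0 \<and> c2 = 0" by simp
qed

text \<open>If both basis solutions are multiplied by the same \<open>l\<close>, so is every
  solution. Comparison with \<open>Y = Y* G\<close> gives \<open>w = l *s (G *v w)\<close> for all
  \<open>w\<close>, and \<open>G\<close> is the scalar matrix \<open>1 / l\<close>.\<close>

lemma diagonalizable_of_scalar_continuation:
  assumes basis: "solution_basis b1 b2 x Y"
    and mono: "monodromy_matrix b1 b2 x Y \<gamma> G" and \<gamma>: "path \<gamma>" "pathstart \<gamma> = x" "pathfinish \<gamma> = x"
    and uv: "det2 u v \<noteq> 0"
    and scalar: "continues \<gamma> (row_comb Y u) (\<lambda>q. l * row_comb Y u q)"
      "continues \<gamma> (row_comb Y v) (\<lambda>q. l * row_comb Y v q)"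
  shows "diagonalizable G"
proof -
  obtain Z where Z: "\<And>w. continues \<gamma> (row_comb Y w) (row_comb Z w)"
    "\<And>w. germ_eq x (row_comb Y w) (row_comb Z (G *v w))"
    using monodromy_matrixE[OF mono \<gamma>(2,3)] by metis
  have e: "germ_eq x (row_comb Z u) (\<lambda>q. l * row_comb Y u q)"
    "germ_eq x (row_comb Z v) (\<lambda>q. l * row_comb Y v q)"
    using continues_unique[OF Z(1) scalar(1) \<gamma>(1)] continues_unique[OF Z(1) scalar(2) \<gamma>(1)] \<gamma> by simp_all
  have eig: "w = l *s (G *v w)" for w
  proof -
    obtain a b where ab: "G *v w = a *s u + b *s v" using det2_expand[OF uv, of "G *v w"] by metis
    have "germ_eq x (row_comb Y (1 *s w + (- l) *s (G *v w))) (\<lambda>_. 0)"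
      using Z(2)[of w] e unfolding germ_eq_def
      by eventually_elim (simp only: row_comb_linear ab, simp add: algebra_simps)
    from row_comb_eq_zero[OF basis this] show ?thesis by (simp add: vec_eq_iff)
  qed
  have "u \<noteq> 0" using uv by (auto simp: det2_def)
  then have "l \<noteq> 0" using eig[of u] by auto
  have "G *v w = (1 / l) *s w" for w
  proof -
    have "(1 / l) *s w = (1 / l) *s (l *s (G *v w))" using eig[of w] by simp
    then show ?thesis using \<open>l \<noteq> 0\<close> by simp
  qed
  then show ?thesis by (intro diagonalizable_of_eigenbasis[OF uv])
qed

text \<open>The common triangular shape passes from the generators to all loop classes, as
  single-valuedness along arbitrary loops requires.\<close>

lemma representation_unipotent_up_to_scalar:
  assumes P: "group P" and \<rho>: "\<rho> \<in> hom P GL2" and "A \<subseteq> carrier P"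
    and gens: "\<And>g. g \<in> A \<Longrightarrow> unipotent_up_to_scalar u v (\<rho> g)" and "g \<in> generate P A"
  shows "unipotent_up_to_scalar u v (\<rho> g)"
proof -
  interpret group_hom P GL2 \<rho>
    using P group_GL2 \<rho> by (simp add: group_hom_def group_hom_axioms_def)
  have carrier: "generate P A \<subseteq> carrier P" using G.generate_incl[OF assms(3)] .
  from assms(5) show ?thesis
  proof induction
    case one
    have "\<rho> \<one>\<^bsub>P\<^esub> = mat 1" using hom_one by (simp add: GL2_def)
    then show ?case
      unfolding unipotent_up_to_scalar_def by (intro exI[of _ 1] exI[of _ 0]) simp
  next
    case (incl h)
    then show ?case by (rule gens)
  next
    case (inv h)
    then have h: "h \<in> carrier P" using assms(3) by blast
    have "\<rho> (inv\<^bsub>P\<^esub> h) \<otimes>\<^bsub>GL2\<^esub> \<rho> h = \<one>\<^bsub>GL2\<^esub>"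
      using h by (simp flip: hom_mult)
    then have "\<rho> (inv\<^bsub>P\<^esub> h) ** \<rho> h = mat 1" by (simp add: GL2_def)
    with gens[OF inv] show ?case by (rule unipotent_up_to_scalar_inverse)
  next
    case (eng h1 h2)
    then have "\<rho> (h1 \<otimes>\<^bsub>P\<^esub> h2) = \<rho> h1 \<otimes>\<^bsub>GL2\<^esub> \<rho> h2"
      by (intro hom_mult subsetD[OF carrier])
    then have "\<rho> (h1 \<otimes>\<^bsub>P\<^esub> h2) = \<rho> h1 ** \<rho> h2" by (simp add: GL2_def)
    then show ?case using eng.IH by (simp add: unipotent_up_to_scalar_mult)
  qed
qed

theorem theorem1p4:
  fixes a1 a2 a3 x0 :: riemann_sphere
    and D :: "riemann_sphere set"
    and \<rho> :: "(real \<Rightarrow> riemann_sphere) set \<Rightarrow> complex ^ 2 ^ 2"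
    and b1 b2 :: "complex \<Rightarrow> complex"
    and \<gamma>1 \<gamma>2 \<gamma>3 :: "real \<Rightarrow> riemann_sphere"
  assumes "distinct [a1, a2, a3]"
    and "D = {a1, a2, a3}"
    and "x0 \<notin> D"
    and "standard_loops x0 a1 a2 a3 \<gamma>1 \<gamma>2 \<gamma>3"
    and "\<rho> \<in> hom (fundamental_group (- D) x0) GL2"
    and "reducible_representation (fundamental_group (- D) x0) \<rho>"
    and "riemann_equation D b1 b2"
    and "realizes_representation D x0 b1 b2 \<rho>"
  shows "diagonalizable (\<rho> (loop_class (- D) \<gamma>1)) \<or>
         diagonalizable (\<rho> (loop_class (- D) \<gamma>2)) \<or>
         diagonalizable (\<rho> (loop_class (- D) \<gamma>3))"
proof (rule ccontr)
  assume contra: "\<not> ?thesis"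
  define P where "P = fundamental_group (- D) x0"
  let ?A = "loop_class (- D) ` {\<gamma>1, \<gamma>2, \<gamma>3}"
  have finD: "finite D" using assms(2) by simp
  have P: "group P" unfolding P_def using assms(3) by (intro group_fundamental_group) simp
  have carrier: "carrier P = loop_class (- D) ` loops_at (- D) x0"
    by (simp add: P_def fundamental_group_def)
  have loops: "loop_around D x0 a1 \<gamma>1" "loop_around D x0 a2 \<gamma>2" "loop_around D x0 a3 \<gamma>3"
    and gen: "generate P ?A = carrier P"
    using assms(4) by (simp_all add: standard_loops_def Let_def P_def flip: assms(2))
  have loop_in: "\<gamma> \<in> loops_at (- D) x0" if "\<gamma> \<in> {\<gamma>1, \<gamma>2, \<gamma>3}" for \<gamma>
    using that loops by (auto simp: loop_around_def)
  then have A: "?A \<subseteq> carrier P" unfolding carrier by (rule image_mono[OF subsetI])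
  obtain W :: "(complex ^ 2) set" where W: "vec.subspace W" "W \<noteq> {0}" "W \<noteq> UNIV"
    "\<And>g v. g \<in> carrier P \<Longrightarrow> v \<in> W \<Longrightarrow> \<rho> g *v v \<in> W"
    using assms(6) unfolding reducible_representation_def P_def by blast
  obtain u where u: "u \<in> W" "u \<noteq> 0" using W(1,2) vec.subspace_0 by blast
  obtain v where uv: "det2 u v \<noteq> 0" using det2_complement[OF u(2)] .
  \<comment> \<open>The vector \<open>u\<close> spans the invariant line and is a common
    eigenvector; the absence of diagonalizability forces the second eigenvalue to equal the
    first.\<close>
  have "unipotent_up_to_scalar u v (\<rho> g)" if "g \<in> ?A" for g
  proof -
    have g: "g \<in> carrier P" using that A by blast
    have nd: "\<not> diagonalizable (\<rho> g)" using that contra by auto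
    obtain l where l: "\<rho> g *v u = l *s u"
      using proper_subspace_line[OF W(1,3) u W(4)[OF g u(1)]] .
    obtain b where b: "\<rho> g *v v = l *s v + b *s u"
      using nondiagonalizable_triangular[OF nd uv l] .
    have "invertible (\<rho> g)" using hom_in_carrier[OF assms(5)] g by (simp add: P_def GL2_def)
    then obtain N where "N ** \<rho> g = mat 1" unfolding invertible_def by blast
    then have "N *v (\<rho> g *v u) = u" by (simp add: matrix_vector_mul_assoc)
    then have "l \<noteq> 0" using l u(2) by auto
    with l b show ?thesis unfolding unipotent_up_to_scalar_def by blast
  qed
  then have uni: "unipotent_up_to_scalar u v (\<rho> g)" if "g \<in> carrier P" for g
    using that representation_unipotent_up_to_scalar[OF P assms(5)[folded P_def] A] unfolding gen by blast
  obtain Y where Y: "solution_basis b1 b2 x0 Y"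
    "\<And>\<gamma>. \<gamma> \<in> loops_at (- D) x0 \<Longrightarrow> monodromy_matrix b1 b2 x0 Y \<gamma> (\<rho> (loop_class (- D) \<gamma>))"
    using assms(8) unfolding realizes_representation_def by blast
  interpret unipotent_pair D x0 b1 b2 "row_comb Y u" "row_comb Y v"
    using uni by (intro unipotent_pair_of_monodromy[where \<rho> = \<rho>] finD assms(3,7) Y uv) (simp_all add: carrier)
  obtain \<gamma> \<Gamma> l where \<gamma>: "\<gamma> \<in> {\<gamma>1, \<gamma>2, \<gamma>3}" "\<Gamma> \<in> loops_at (- D) x0" "homotopic_paths (- D) \<gamma> \<Gamma>"
    "continues \<Gamma> (row_comb Y u) (\<lambda>q. l * row_comb Y u q)"
    "continues \<Gamma> (row_comb Y v) (\<lambda>q. l * row_comb Y v q)"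
    using some_local_monodromy_scalar[OF assms(1,2,7) loops] by blast
  \<comment> \<open>The scalar monodromy was found on the modified loop; \<open>\<rho>\<close>
    depends only on the class, which \<open>\<Gamma>\<close> shares with
    \<open>\<gamma>\<close>.\<close>
  have "diagonalizable (\<rho> (loop_class (- D) \<Gamma>))"
    using \<gamma>(2) by (intro diagonalizable_of_scalar_continuation[OF Y(1) Y(2)[OF \<gamma>(2)] _ _ _ uv \<gamma>(4,5)])
      (simp_all add: loops_at_def)
  then show False using contra \<gamma>(1) loop_class_eq[OF \<gamma>(3)] by auto
qed

end
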